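(* Assume $T$ is NIP. Let $M\models T$ (a small elementary substructure of $\mathcal U$) and let $p\in S(M)$ be a type which is not stable. Then there is an extension $q$ of $p$ (to a type over a larger set) which is not realized and is compressible.
   Context: $T$ is a complete first-order NIP theory in language $L$, $\mathcal U$ a monster model, parameter sets small. A type $p(x)$ is stable if there is no formula $\phi(x;y)$, realizations $(a_i)_{i<\omega}$ of $p$ and tuples $(b_i)_{i<\omega}$ with $\models\phi(a_i;b_j)\iff i\leq j$. For a set $A$ and tuple $a$, $(A,a)$ is the structure with universe $A$ and, for each $L$-formula $\phi(\bar x;y)$, a predicate for $\{\bar b\in A:\models\phi(\bar b;a)\}$. A type $\operatorname{tp}(a/A)$ is compressible if for an $|A|^+$-saturated elementary extension $(A,a)\prec(A',a)$ (with $A'\subseteq\mathcal U$) and every $L$-formula $\phi(x;y)$ there is $\zeta(x;e)\in\operatorname{tp}(a/A')$ with $\zeta(x;e)\vdash\operatorname{tp}_\phi(a/A)$, where $\operatorname{tp}_\phi(a/A)$ is the set of instances $\phi(x;b)$, $\neg\phi(x;b)$ ($b\in A$) satisfied by $a$. Equivalently: for each $\phi(x;y)$ there is $\zeta(x;t)$ such that for every finite $A_0\subseteq A$ there is $e\in A$ with $\models\zeta(a;e)$ and $\zeta(x;e)\vdash\operatorname{tp}_\phi(a/A_0)$. *)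

theory Defs
  imports Main
begin

unbundle cardinal_syntax

section \<open>First-order languages, structures and satisfaction\<close>

datatype 'f tm = Var nat | Fn 'f "'f tm list"

text \<open>Formulas use de Bruijn indices: \<open>Exists\<close> binds index \<open>0\<close>.\<close>

datatype ('f, 'r) fm =
    Eq "'f tm" "'f tm"
  | Rel 'r "'f tm list"
  | Neg "('f, 'r) fm"
  | Conj "('f, 'r) fm" "('f, 'r) fm"
  | Exists "('f, 'r) fm"

text \<open>A language assigns arities to its symbols; \<open>None\<close> means that the symbol is not in the
  language, so that either kind of symbols may be absent altogether.\<close>

record ('f, 'r) lang =
  fun_ar :: "'f \<Rightarrow> nat option"
  rel_ar :: "'r \<Rightarrow> nat option"

record ('f, 'r, 'u) fo_struct =
  univ :: "'u set"
  funI :: "'f \<Rightarrow> 'u list \<Rightarrow> 'u"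
  relI :: "'r \<Rightarrow> 'u list \<Rightarrow> bool"

fun wf_tm :: "('f, 'r) lang \<Rightarrow> 'f tm \<Rightarrow> bool" where
  "wf_tm L (Var i) \<longleftrightarrow> True"
| "wf_tm L (Fn f ts) \<longleftrightarrow> fun_ar L f = Some (length ts) \<and> (\<forall>t\<in>set ts. wf_tm L t)"

fun wf_fm :: "('f, 'r) lang \<Rightarrow> ('f, 'r) fm \<Rightarrow> bool" where
  "wf_fm L (Eq s t) \<longleftrightarrow> wf_tm L s \<and> wf_tm L t"
| "wf_fm L (Rel r ts) \<longleftrightarrow> rel_ar L r = Some (length ts) \<and> (\<forall>t\<in>set ts. wf_tm L t)"
| "wf_fm L (Neg \<phi>) \<longleftrightarrow> wf_fm L \<phi>"
| "wf_fm L (Conj \<phi> \<psi>) \<longleftrightarrow> wf_fm L \<phi> \<and> wf_fm L \<psi>"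
| "wf_fm L (Exists \<phi>) \<longleftrightarrow> wf_fm L \<phi>"

fun fv_tm :: "'f tm \<Rightarrow> nat set" where
  "fv_tm (Var i) = {i}"
| "fv_tm (Fn f ts) = (\<Union>t\<in>set ts. fv_tm t)"

fun fv :: "('f, 'r) fm \<Rightarrow> nat set" where
  "fv (Eq s t) = fv_tm s \<union> fv_tm t"
| "fv (Rel r ts) = (\<Union>t\<in>set ts. fv_tm t)"
| "fv (Neg \<phi>) = fv \<phi>"
| "fv (Conj \<phi> \<psi>) = fv \<phi> \<union> fv \<psi>"
| "fv (Exists \<phi>) = {i. Suc i \<in> fv \<phi>}"

text \<open>The \<open>L\<close>-formulas in the variables \<open>0, \<dots>, n - 1\<close>. A partitioned formula \<open>\<phi>(x;y)\<close> with
  \<open>|x| = n\<close> and \<open>|y| = m\<close> is an element of \<open>fms L (n + m)\<close>: the first \<open>n\<close> variables are \<open>x\<close>, the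
  following \<open>m\<close> are \<open>y\<close>.\<close>

definition fms :: "('f, 'r) lang \<Rightarrow> nat \<Rightarrow> ('f, 'r) fm set" where
  "fms L n = {\<phi>. wf_fm L \<phi> \<and> fv \<phi> \<subseteq> {..<n}}"

fun eval_tm :: "('f, 'r, 'u) fo_struct \<Rightarrow> (nat \<Rightarrow> 'u) \<Rightarrow> 'f tm \<Rightarrow> 'u" where
  "eval_tm N v (Var i) = v i"
| "eval_tm N v (Fn f ts) = funI N f (map (eval_tm N v) ts)"

fun sat :: "('f, 'r, 'u) fo_struct \<Rightarrow> (nat \<Rightarrow> 'u) \<Rightarrow> ('f, 'r) fm \<Rightarrow> bool" where
  "sat N v (Eq s t) \<longleftrightarrow> eval_tm N v s = eval_tm N v t"
| "sat N v (Rel r ts) \<longleftrightarrow> relI N r (map (eval_tm N v) ts)"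
| "sat N v (Neg \<phi>) \<longleftrightarrow> \<not> sat N v \<phi>"
| "sat N v (Conj \<phi> \<psi>) \<longleftrightarrow> sat N v \<phi> \<and> sat N v \<psi>"
| "sat N v (Exists \<phi>) \<longleftrightarrow> (\<exists>u\<in>univ N. sat N (case_nat u v) \<phi>)"

text \<open>Finite tuples are lists. \<open>holds N \<phi> as\<close> is only used for \<open>\<phi> \<in> fms L (length as)\<close>, so that the
  values of \<open>nth\<close> outside the list are irrelevant.\<close>

definition holds :: "('f, 'r, 'u) fo_struct \<Rightarrow> ('f, 'r) fm \<Rightarrow> 'u list \<Rightarrow> bool" where
  "holds N \<phi> as \<longleftrightarrow> sat N (\<lambda>i. as ! i) \<phi>"

definition tuples :: "'u set \<Rightarrow> nat \<Rightarrow> 'u list set" where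
  "tuples A n = {as. length as = n \<and> set as \<subseteq> A}"

definition is_struct :: "('f, 'r) lang \<Rightarrow> ('f, 'r, 'u) fo_struct \<Rightarrow> bool" where
  "is_struct L N \<longleftrightarrow> univ N \<noteq> {} \<and>
     (\<forall>f n. fun_ar L f = Some n \<longrightarrow> (\<forall>as\<in>tuples (univ N) n. funI N f as \<in> univ N))"

definition elementary_ext ::
  "('f, 'r) lang \<Rightarrow> ('f, 'r, 'u) fo_struct \<Rightarrow> ('f, 'r, 'u) fo_struct \<Rightarrow> bool" where
  "elementary_ext L M N \<longleftrightarrow> is_struct L M \<and> is_struct L N \<and> univ M \<subseteq> univ N \<and>
     (\<forall>n. \<forall>\<phi>\<in>fms L n. \<forall>as\<in>tuples (univ M) n. holds M \<phi> as \<longleftrightarrow> holds N \<phi> as)"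

definition elementary_substructure ::
  "('f, 'r) lang \<Rightarrow> 'u set \<Rightarrow> ('f, 'r, 'u) fo_struct \<Rightarrow> bool" where
  "elementary_substructure L M N \<longleftrightarrow> elementary_ext L (N\<lparr>univ := M\<rparr>) N"

section \<open>Types and saturation\<close>

text \<open>A formula \<open>\<phi>(x;b)\<close> over \<open>A\<close> with \<open>|x| = n\<close> is represented by the pair \<open>(\<phi>, b)\<close>.\<close>

definition formulas_over ::
  "('f, 'r) lang \<Rightarrow> nat \<Rightarrow> 'u set \<Rightarrow> (('f, 'r) fm \<times> 'u list) set" where
  "formulas_over L n A = {(\<phi>, b). b \<in> lists A \<and> \<phi> \<in> fms L (n + length b)}"

definition realizes ::
  "('f, 'r, 'u) fo_struct \<Rightarrow> nat \<Rightarrow> 'u list \<Rightarrow> (('f, 'r) fm \<times> 'u list) set \<Rightarrow> bool" where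
  "realizes N n a p \<longleftrightarrow> a \<in> tuples (univ N) n \<and> (\<forall>(\<phi>, b)\<in>p. holds N \<phi> (a @ b))"

definition tp :: "('f, 'r) lang \<Rightarrow> ('f, 'r, 'u) fo_struct \<Rightarrow> 'u list \<Rightarrow> 'u set
    \<Rightarrow> (('f, 'r) fm \<times> 'u list) set" where
  "tp L N a A = {(\<phi>, b)\<in>formulas_over L (length a) A. holds N \<phi> (a @ b)}"

text \<open>The complete \<open>n\<close>-types over \<open>A\<close>, with respect to the elementary diagram of \<open>N\<close>.\<close>

definition complete_types :: "('f, 'r) lang \<Rightarrow> ('f, 'r, 'u) fo_struct \<Rightarrow> nat \<Rightarrow> 'u set
    \<Rightarrow> (('f, 'r) fm \<times> 'u list) set set" where
  "complete_types L N n A = {p. p \<subseteq> formulas_over L n A \<and>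
     (\<forall>p\<^sub>0. finite p\<^sub>0 \<and> p\<^sub>0 \<subseteq> p \<longrightarrow> (\<exists>a. realizes N n a p\<^sub>0)) \<and>
     (\<forall>(\<phi>, b)\<in>formulas_over L n A. (\<phi>, b) \<in> p \<or> (Neg \<phi>, b) \<in> p)}"

definition saturated :: "('f, 'r) lang \<Rightarrow> 'k rel \<Rightarrow> ('f, 'r, 'u) fo_struct \<Rightarrow> bool" where
  "saturated L \<kappa> N \<longleftrightarrow> (\<forall>A n. A \<subseteq> univ N \<and> |A| <o \<kappa> \<longrightarrow>
     (\<forall>p\<in>complete_types L N n A. \<exists>a. realizes N n a p))"

section \<open>Monster models\<close>

definition automorphism :: "('f, 'r) lang \<Rightarrow> ('f, 'r, 'u) fo_struct \<Rightarrow> ('u \<Rightarrow> 'u) \<Rightarrow> bool" where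
  "automorphism L N g \<longleftrightarrow> bij_betw g (univ N) (univ N) \<and>
     (\<forall>f n. fun_ar L f = Some n \<longrightarrow>
        (\<forall>as\<in>tuples (univ N) n. g (funI N f as) = funI N f (map g as))) \<and>
     (\<forall>r n. rel_ar L r = Some n \<longrightarrow>
        (\<forall>as\<in>tuples (univ N) n. relI N r (map g as) \<longleftrightarrow> relI N r as))"

definition elementary_map ::
  "('f, 'r) lang \<Rightarrow> ('f, 'r, 'u) fo_struct \<Rightarrow> 'u set \<Rightarrow> ('u \<Rightarrow> 'u) \<Rightarrow> bool" where
  "elementary_map L N A h \<longleftrightarrow> A \<subseteq> univ N \<and> h ` A \<subseteq> univ N \<and>
     (\<forall>n. \<forall>\<phi>\<in>fms L n. \<forall>as\<in>tuples A n. holds N \<phi> as \<longleftrightarrow> holds N \<phi> (map h as))"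

definition strongly_homogeneous ::
  "('f, 'r) lang \<Rightarrow> 'k rel \<Rightarrow> ('f, 'r, 'u) fo_struct \<Rightarrow> bool" where
  "strongly_homogeneous L \<kappa> N \<longleftrightarrow> (\<forall>A h. |A| <o \<kappa> \<and> elementary_map L N A h \<longrightarrow>
     (\<exists>g. automorphism L N g \<and> (\<forall>x\<in>A. g x = h x)))"

definition strong_limit :: "'k rel \<Rightarrow> bool" where
  "strong_limit \<kappa> \<longleftrightarrow> Card_order \<kappa> \<and> (\<forall>A. A \<subseteq> Field \<kappa> \<and> |A| <o \<kappa> \<longrightarrow> |Pow A| <o \<kappa>)"

text \<open>A complete theory is taken to be closed under consequence; its satisfiability is part of
  having a monster model.\<close>

definition complete_theory :: "('f, 'r) lang \<Rightarrow> ('f, 'r) fm set \<Rightarrow> bool" where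
  "complete_theory L T \<longleftrightarrow> T \<subseteq> fms L 0 \<and> (\<forall>\<sigma>\<in>fms L 0. \<sigma> \<in> T \<or> Neg \<sigma> \<in> T)"

definition models :: "('f, 'r) lang \<Rightarrow> ('f, 'r, 'u) fo_struct \<Rightarrow> ('f, 'r) fm set \<Rightarrow> bool" where
  "models L N T \<longleftrightarrow> is_struct L N \<and> (\<forall>\<sigma>\<in>T. holds N \<sigma> [])"

text \<open>The cardinal \<open>\<kappa>\<close> is the bound for smallness. It exceeds the number of \<open>L\<close>-formulas, hence
  is uncountable; the strong limit condition keeps the usual constructions (such as saturated
  elementary extensions of small structures) inside the monster model.\<close>

definition monster_model ::
  "('f, 'r) lang \<Rightarrow> ('f, 'r) fm set \<Rightarrow> 'k rel \<Rightarrow> ('f, 'r, 'u) fo_struct \<Rightarrow> bool" where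
  "monster_model L T \<kappa> U \<longleftrightarrow> strong_limit \<kappa> \<and> |{\<phi>. wf_fm L \<phi>}| <o \<kappa> \<and>
     models L U T \<and> saturated L \<kappa> U \<and> strongly_homogeneous L \<kappa> U"

definition small_subset :: "'k rel \<Rightarrow> ('f, 'r, 'u) fo_struct \<Rightarrow> 'u set \<Rightarrow> bool" where
  "small_subset \<kappa> U A \<longleftrightarrow> A \<subseteq> univ U \<and> |A| <o \<kappa>"

section \<open>NIP, stable and compressible types\<close>

definition shatters ::
  "('f, 'r, 'u) fo_struct \<Rightarrow> ('f, 'r) fm \<Rightarrow> nat \<Rightarrow> 'u list set \<Rightarrow> bool" where
  "shatters U \<phi> m X \<longleftrightarrow>
     (\<forall>I\<subseteq>X. \<exists>b\<in>tuples (univ U) m. \<forall>a\<in>X. holds U \<phi> (a @ b) \<longleftrightarrow> a \<in> I)"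

text \<open>NIP for the theory of \<open>U\<close>, evaluated as usual in its monster model \<open>U\<close>.\<close>

definition NIP :: "('f, 'r) lang \<Rightarrow> ('f, 'r, 'u) fo_struct \<Rightarrow> bool" where
  "NIP L U \<longleftrightarrow> (\<forall>n m. \<forall>\<phi>\<in>fms L (n + m).
     \<not> (\<exists>X. X \<subseteq> tuples (univ U) n \<and> infinite X \<and> shatters U \<phi> m X))"

definition stable_type :: "('f, 'r) lang \<Rightarrow> ('f, 'r, 'u) fo_struct \<Rightarrow> nat
    \<Rightarrow> (('f, 'r) fm \<times> 'u list) set \<Rightarrow> bool" where
  "stable_type L U n p \<longleftrightarrow>
     \<not> (\<exists>m. \<exists>\<phi>\<in>fms L (n + m). \<exists>(a :: nat \<Rightarrow> 'u list) (b :: nat \<Rightarrow> 'u list).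
          (\<forall>i. realizes U n (a i) p) \<and> (\<forall>i. b i \<in> tuples (univ U) m) \<and>
          (\<forall>i j. holds U \<phi> (a i @ b j) \<longleftrightarrow> i \<le> j))"

text \<open>The structure \<open>(A, a)\<close> and its language, for \<open>|a| = n\<close>: it is purely relational, and the
  symbol \<open>(k, \<phi>)\<close> is a \<open>k\<close>-ary predicate naming the subset of \<open>A\<^sup>k\<close> defined by \<open>\<phi>(x\<^sub>1,\<dots>,x\<^sub>k;a)\<close>.\<close>

definition pair_lang :: "('f, 'r) lang \<Rightarrow> nat \<Rightarrow> ('f, nat \<times> ('f, 'r) fm) lang" where
  "pair_lang L n = \<lparr>fun_ar = (\<lambda>_. None),
     rel_ar = (\<lambda>(k, \<phi>). if \<phi> \<in> fms L (k + n) then Some k else None)\<rparr>"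

definition pair_struct ::
  "('f, 'r, 'u) fo_struct \<Rightarrow> 'u set \<Rightarrow> 'u list \<Rightarrow> ('f, nat \<times> ('f, 'r) fm, 'u) fo_struct" where
  "pair_struct U A a = \<lparr>univ = A, funI = (\<lambda>_ _. undefined),
     relI = (\<lambda>(k, \<phi>) b. b \<in> tuples A k \<and> holds U \<phi> (b @ a))\<rparr>"

text \<open>\<open>\<zeta>(x;e) \<turnstile> tp\<^sub>\<phi>(a/A)\<close> for \<open>\<phi>(x;y)\<close> with \<open>|y| = m\<close>.\<close>

definition entails_tp_fm :: "('f, 'r, 'u) fo_struct \<Rightarrow> ('f, 'r) fm \<Rightarrow> 'u list
    \<Rightarrow> ('f, 'r) fm \<Rightarrow> nat \<Rightarrow> 'u list \<Rightarrow> 'u set \<Rightarrow> bool" where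
  "entails_tp_fm U \<zeta> e \<phi> m a A \<longleftrightarrow>
     (\<forall>a'\<in>tuples (univ U) (length a). holds U \<zeta> (a' @ e) \<longrightarrow>
        (\<forall>b\<in>tuples A m. holds U \<phi> (a' @ b) \<longleftrightarrow> holds U \<phi> (a @ b)))"

definition compressible_tp ::
  "('f, 'r) lang \<Rightarrow> 'k rel \<Rightarrow> ('f, 'r, 'u) fo_struct \<Rightarrow> 'u list \<Rightarrow> 'u set \<Rightarrow> bool" where
  "compressible_tp L \<kappa> U a A \<longleftrightarrow>
     (\<exists>A'. small_subset \<kappa> U A' \<and>
        elementary_ext (pair_lang L (length a)) (pair_struct U A a) (pair_struct U A' a) \<and>
        saturated (pair_lang L (length a)) (cardSuc |A| ) (pair_struct U A' a) \<and>
        (\<forall>m. \<forall>\<phi>\<in>fms L (length a + m).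
           \<exists>(\<zeta>, e)\<in>tp L U a A'. entails_tp_fm U \<zeta> e \<phi> m a A))"

definition compressible :: "('f, 'r) lang \<Rightarrow> 'k rel \<Rightarrow> ('f, 'r, 'u) fo_struct \<Rightarrow> nat \<Rightarrow> 'u set
    \<Rightarrow> (('f, 'r) fm \<times> 'u list) set \<Rightarrow> bool" where
  "compressible L \<kappa> U n A q \<longleftrightarrow>
     (\<exists>a\<in>tuples (univ U) n. q = tp L U a A \<and> compressible_tp L \<kappa> U a A)"

end

theory Submission
  imports Defs
begin

text \<open>By instability and NIP, some formula with parameters defines a strict partial order on \<open>n\<close>-tuples
  such that every finite part of \<open>p\<close> contains arbitrarily long finite chains. Call a partial type with
  this property large. Being large is of finite character, and one of two complementary
  definable sets can always be added to a large type, so large types extend to complete large types.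
  A complete large type over \<open>B\<close> is not realized in \<open>B\<close>, as the formula \<open>x = b\<close> contains no chain
  of length two.

  Let \<open>tp(a/B)\<close> be large. The main step finds, for a given \<open>\<phi>(x;y)\<close>, a formula \<open>\<zeta>(x;e)\<close>, with \<open>e\<close>
  anywhere in the monster model, which is large together with \<open>tp(a/B)\<close> and implies \<open>tp\<^sub>\<phi>(a/B)\<close>. For an
  ultrafilter \<open>r\<close> on the tuples of \<open>B\<close> take a coheir sequence \<open>(b\<^sub>i)\<close> of \<open>r\<close>. By NIP there is a longest
  pattern \<open>\<phi>(x;b\<^sub>i) \<leftrightarrow> i even\<close>, for \<open>i < k\<close>, that can be added. After adding it, for \<open>r\<close>-almost all
  \<open>b\<close> the solutions on which \<open>\<phi>(x;b)\<close> has the wrong value have bounded chains. Treating all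
  ultrafilters, compactness gives one formula that works for all \<open>b \<in> B\<close>, and then no solution with a
  wrong value lies in an interval between two realizations \<open>c < c'\<close> of the same type over \<open>B\<close> and the
  parameters used, since the maximal length of a chain of wrong solutions below \<open>c\<close> and below \<open>c'\<close>
  is the same.

  Repeating this along a chain whose length is a regular cardinal above the number of formulas makes
  \<open>\<zeta>\<close> depend on \<open>\<phi>\<close> only, and turns the parameters \<open>e\<close> into elements of the base. By saturation of
  an extension \<open>(A', a)\<close> of \<open>(B, a)\<close>, a single \<open>e\<close> in \<open>A'\<close> then serves all finite subsets of \<open>B\<close>. The
  structure \<open>(A', a)\<close> is the union of a chain of ultrapowers, cut down to size \<open>2\<^sup>\<nu>\<close> by
  Loewenheim-Skolem and realized inside the monster model.\<close>

section \<open>Renaming of variables and definability\<close>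

text \<open>Chains are used because they attach integers to points: if a definable set has no
  arbitrarily long chains, the maximal length of its chains below a point is finite and is
  determined by the type of that point. Sets without long chains form an ideal, so largeness can
  replace consistency in every extension argument, and the integers turn smallness of a set of wrong
  solutions into emptiness between two points of the same type. The obstacle is that the formulas
  found over a base carry parameters outside it, namely terms of coheir sequences and interval ends.
  Adding these to the base creates new instances that have to be decided again, and nothing in one
  step bounds how \<open>\<zeta>\<close> varies. Uniformity is therefore proved by contradiction
  after all steps: one finite counterexample for each candidate \<open>\<zeta>\<close> is so little
  data that it lies in a single stage, and the following stage decides \<open>\<phi>\<close> over
  all of it.\<close>

fun ren_tm :: "(nat \<Rightarrow> nat) \<Rightarrow> 'f tm \<Rightarrow> 'f tm" where
  "ren_tm g (Var i) = Var (g i)"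
| "ren_tm g (Fn f ts) = Fn f (map (ren_tm g) ts)"

fun ren :: "(nat \<Rightarrow> nat) \<Rightarrow> ('f, 'r) fm \<Rightarrow> ('f, 'r) fm" where
  "ren g (Eq s t) = Eq (ren_tm g s) (ren_tm g t)"
| "ren g (Rel r ts) = Rel r (map (ren_tm g) ts)"
| "ren g (Neg \<phi>) = Neg (ren g \<phi>)"
| "ren g (Conj \<phi> \<psi>) = Conj (ren g \<phi>) (ren g \<psi>)"
| "ren g (Exists \<phi>) = Exists (ren (case_nat 0 (\<lambda>i. Suc (g i))) \<phi>)"

lemma eval_tm_ren: "eval_tm N v (ren_tm g t) = eval_tm N (v \<circ> g) t"
  by (induction t) (auto cong: map_cong simp: comp_def)

lemma sat_ren: "sat N v (ren g \<phi>) \<longleftrightarrow> sat N (v \<circ> g) \<phi>"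
proof (induction \<phi> arbitrary: v g)
  case (Exists \<phi>)
  have "case_nat u v \<circ> case_nat 0 (\<lambda>i. Suc (g i)) = case_nat u (v \<circ> g)" for u
    by (auto simp: fun_eq_iff split: nat.split)
  then show ?case by (simp only: ren.simps sat.simps Exists)
qed (auto simp: eval_tm_ren comp_def)

lemma wf_tm_ren: "wf_tm L (ren_tm g t) \<longleftrightarrow> wf_tm L t"
  by (induction t) auto

lemma wf_fm_ren: "wf_fm L (ren g \<phi>) \<longleftrightarrow> wf_fm L \<phi>"
  by (induction \<phi> arbitrary: g) (auto simp: wf_tm_ren)

lemma fv_tm_ren: "fv_tm (ren_tm g t) = g ` fv_tm t"
  by (induction t) auto

lemma fv_ren: "fv (ren g \<phi>) = g ` fv \<phi>"
proof (induction \<phi> arbitrary: g)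
  case (Exists \<phi>)
  have "Suc i \<in> case_nat 0 (\<lambda>i. Suc (g i)) ` fv \<phi> \<longleftrightarrow> i \<in> g ` {i. Suc i \<in> fv \<phi>}" for i
  proof
    assume "Suc i \<in> case_nat 0 (\<lambda>i. Suc (g i)) ` fv \<phi>"
    then obtain j where "j \<in> fv \<phi>" "Suc i = case_nat 0 (\<lambda>i. Suc (g i)) j" by blast
    then show "i \<in> g ` {i. Suc i \<in> fv \<phi>}" by (cases j) auto
  next
    assume "i \<in> g ` {i. Suc i \<in> fv \<phi>}"
    then obtain j where "Suc j \<in> fv \<phi>" "i = g j" by blast
    then show "Suc i \<in> case_nat 0 (\<lambda>i. Suc (g i)) ` fv \<phi>"
      by (intro image_eqI[of _ _ "Suc j"]) auto
  qed
  then show ?case by (auto simp: Exists)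
qed (auto simp: fv_tm_ren)

lemma eval_tm_cong: "(\<And>i. i \<in> fv_tm t \<Longrightarrow> v i = w i) \<Longrightarrow> eval_tm N v t = eval_tm N w t"
proof (induction t)
  case (Fn f ts)
  then have "map (eval_tm N v) ts = map (eval_tm N w) ts" by (intro map_cong) auto
  then show ?case by (simp del: map_eq_conv)
qed simp

lemma sat_cong: "(\<And>i. i \<in> fv \<phi> \<Longrightarrow> v i = w i) \<Longrightarrow> sat N v \<phi> \<longleftrightarrow> sat N w \<phi>"
proof (induction \<phi> arbitrary: v w)
  case (Eq s t)
  then show ?case using eval_tm_cong[of s v w N] eval_tm_cong[of t v w N] by auto
next
  case (Rel r ts)
  then have "map (eval_tm N v) ts = map (eval_tm N w) ts"
    by (intro map_cong eval_tm_cong) auto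
  then show ?case by (simp del: map_eq_conv)
next
  case (Conj \<phi> \<psi>)
  have "sat N v \<phi> \<longleftrightarrow> sat N w \<phi>" "sat N v \<psi> \<longleftrightarrow> sat N w \<psi>"
    using Conj.prems by (auto intro!: Conj.IH)
  then show ?case by simp
next
  case (Exists \<phi>)
  have "sat N (case_nat u v) \<phi> \<longleftrightarrow> sat N (case_nat u w) \<phi>" for u
    by (rule Exists.IH) (use Exists.prems in \<open>auto split: nat.split\<close>)
  then show ?case by simp
next
  case (Neg \<phi>)
  have "sat N v \<phi> \<longleftrightarrow> sat N w \<phi>"
    using Neg.prems by (auto intro!: Neg.IH)
  then show ?case by simp
qed

lemma finite_fv_tm: "finite (fv_tm t)"
  by (induction t) auto

lemma finite_fv: "finite (fv \<phi>)"
proof (induction \<phi>)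
  case (Exists \<phi>)
  have "{i. Suc i \<in> fv \<phi>} = Suc -` fv \<phi>" by auto
  then show ?case using Exists by (simp add: finite_vimageI)
qed (auto simp: finite_fv_tm)

lemma fms_ren:
  assumes "\<phi> \<in> fms L k" "\<And>i. i < k \<Longrightarrow> g i < k'"
  shows "ren g \<phi> \<in> fms L k'"
  using assms by (auto simp: fms_def wf_fm_ren fv_ren)

lemma holds_cong:
  assumes "\<phi> \<in> fms L k" "\<And>i. i < k \<Longrightarrow> as ! i = bs ! i"
  shows "holds N \<phi> as \<longleftrightarrow> holds N \<phi> bs"
  unfolding holds_def by (rule sat_cong) (use assms in \<open>auto simp: fms_def\<close>)

lemma holds_ren:
  assumes "\<phi> \<in> fms L k" "\<And>i. i < k \<Longrightarrow> as ! g i = bs ! i"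
  shows "holds N (ren g \<phi>) as \<longleftrightarrow> holds N \<phi> bs"
  unfolding holds_def sat_ren by (rule sat_cong) (use assms in \<open>auto simp: fms_def\<close>)

lemma holds_simps [simp]:
  "holds N (Neg \<phi>) as \<longleftrightarrow> \<not> holds N \<phi> as"
  "holds N (Conj \<phi> \<psi>) as \<longleftrightarrow> holds N \<phi> as \<and> holds N \<psi> as"
  by (simp_all add: holds_def)

lemma holds_Exists: "holds N (Exists \<phi>) as \<longleftrightarrow> (\<exists>u\<in>univ N. holds N \<phi> (u # as))"
proof -
  have "(\<lambda>i. (u # as) ! i) = case_nat u (\<lambda>i. as ! i)" for u
    by (auto simp: fun_eq_iff nth_Cons)
  then show ?thesis by (simp add: holds_def)
qed

lemma fms_simps [simp]:
  "Neg \<phi> \<in> fms L k \<longleftrightarrow> \<phi> \<in> fms L k"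
  "Conj \<phi> \<psi> \<in> fms L k \<longleftrightarrow> \<phi> \<in> fms L k \<and> \<psi> \<in> fms L k"
  "Exists \<phi> \<in> fms L k \<longleftrightarrow> \<phi> \<in> fms L (Suc k)"
proof -
  have "{i. Suc i \<in> fv \<phi>} \<subseteq> {..<k} \<longleftrightarrow> fv \<phi> \<subseteq> {..<Suc k}"
  proof
    assume *: "{i. Suc i \<in> fv \<phi>} \<subseteq> {..<k}"
    show "fv \<phi> \<subseteq> {..<Suc k}"
    proof
      fix i assume "i \<in> fv \<phi>"
      then show "i \<in> {..<Suc k}" using * by (cases i) auto
    qed
  qed auto
  then show "Exists \<phi> \<in> fms L k \<longleftrightarrow> \<phi> \<in> fms L (Suc k)" by (simp add: fms_def)
qed (auto simp: fms_def)

lemma fms_mono: "\<phi> \<in> fms L k \<Longrightarrow> k \<le> k' \<Longrightarrow> \<phi> \<in> fms L k'"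
  by (auto simp: fms_def)

lemma fms_Exists_power: "(Exists ^^ n) \<phi> \<in> fms L k \<longleftrightarrow> \<phi> \<in> fms L (n + k)"
proof (induction n arbitrary: \<phi>)
  case (Suc n)
  then show ?case by (simp add: funpow_swap1)
qed simp

lemma tuples_Suc: "x \<in> tuples A (Suc n) \<longleftrightarrow> (\<exists>y u. x = u # y \<and> u \<in> A \<and> y \<in> tuples A n)"
  by (cases x) (auto simp: tuples_def)

lemma holds_Exists_power:
  "holds N ((Exists ^^ n) \<phi>) as \<longleftrightarrow> (\<exists>x\<in>tuples (univ N) n. holds N \<phi> (x @ as))"
proof (induction n arbitrary: \<phi>)
  case 0
  then show ?case by (simp add: tuples_def)
next
  case (Suc n)
  have "holds N ((Exists ^^ Suc n) \<phi>) as \<longleftrightarrow> (\<exists>x\<in>tuples (univ N) n. \<exists>u\<in>univ N. holds N \<phi> (u # x @ as))"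
    by (simp add: funpow_swap1 Suc holds_Exists)
  then show ?case unfolding Bex_def tuples_Suc by (metis append_Cons)
qed

lemma tuples_append: "x \<in> tuples A n \<Longrightarrow> y \<in> tuples A m \<Longrightarrow> x @ y \<in> tuples A (n + m)"
  by (auto simp: tuples_def)

lemma tuples_mono: "A \<subseteq> B \<Longrightarrow> tuples A n \<subseteq> tuples B n"
  by (auto simp: tuples_def)

lemma tuples_length: "x \<in> tuples A n \<Longrightarrow> length x = n"
  by (simp add: tuples_def)

lemma tuples_lists: "x \<in> tuples A n \<Longrightarrow> x \<in> lists A"
  by (auto simp: tuples_def)

lemma lists_select:
  assumes "set xs \<subseteq> set ys"
  obtains js where "xs = map ((!) ys) js" "\<forall>j\<in>set js. j < length ys"
proof -
  have "\<forall>x\<in>set xs. \<exists>j. j < length ys \<and> ys ! j = x"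
    using assms by (metis in_set_conv_nth subsetD)
  then obtain f where "\<forall>x\<in>set xs. f x < length ys \<and> ys ! f x = x" by metis
  then have "xs = map ((!) ys) (map f xs)" "\<forall>j\<in>set (map f xs). j < length ys"
    by (auto simp: map_idI)
  then show ?thesis using that by blast
qed

section \<open>Finite conjunctions of formulas with parameters\<close>

text \<open>One conjunction serves all structures and all relabellings \<open>h\<close> of the
  parameters. In \<open>embed_ultrapower\<close> the parameters are pairs of a function and an
  element of the monster model, and \<open>h\<close> is evaluation at an index in one place and
  \<open>snd\<close> in another.\<close>

lemma conj_over_map:
  assumes "finite p" "p \<subseteq> formulas_over L n A"
  shows "\<exists>\<chi> d. (\<chi>, d) \<in> formulas_over L n A \<and>
    (\<forall>(N :: ('f, 'r, 'u) fo_struct) h x. length x = n \<longrightarrow>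
       (holds N \<chi> (x @ map h d) \<longleftrightarrow> (\<forall>(\<phi>, b)\<in>p. holds N \<phi> (x @ map h b))))"
  using assms
proof (induction p rule: finite_induct)
  case empty
  \<comment> \<open>The empty conjunction must be closed, because \<open>n\<close> may be 0, and
    free of symbols of \<open>L\<close>, which may have none.\<close>
  let ?\<chi> = "Neg (Conj (Exists (Eq (Var 0) (Var 0))) (Neg (Exists (Eq (Var 0) (Var 0))))) :: ('f, 'r) fm"
  have "(?\<chi>, []) \<in> formulas_over L n A"
    by (simp add: formulas_over_def fms_def)
  moreover have "holds N ?\<chi> (x @ map h [])" for N :: "('f, 'r, 'u) fo_struct" and h x
    by simp
  ultimately show ?case by blast
next
  case (insert P p)
  then obtain \<chi> d where \<chi>: "(\<chi>, d) \<in> formulas_over L n A"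
    "\<And>(N :: ('f, 'r, 'u) fo_struct) h x. length x = n \<Longrightarrow>
       holds N \<chi> (x @ map h d) \<longleftrightarrow> (\<forall>(\<phi>, b)\<in>p. holds N \<phi> (x @ map h b))"
    by auto
  obtain \<phi> b where P: "P = (\<phi>, b)" by force
  define g where "g i = (if i < n then i else i + length d)" for i
  have f: "\<phi> \<in> fms L (n + length b)" "b \<in> lists A" "\<chi> \<in> fms L (n + length d)" "d \<in> lists A"
    using insert.prems \<chi>(1) by (auto simp: P formulas_over_def)
  have "ren g \<phi> \<in> fms L (n + length (d @ b))"
    by (rule fms_ren[OF f(1)]) (auto simp: g_def)
  moreover have "\<chi> \<in> fms L (n + length (d @ b))"
    using f(3) by (rule fms_mono) simp
  ultimately have "(Conj \<chi> (ren g \<phi>), d @ b) \<in> formulas_over L n A"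
    using f by (simp add: formulas_over_def)
  moreover have "holds N (Conj \<chi> (ren g \<phi>)) (x @ map h (d @ b)) \<longleftrightarrow> (\<forall>(\<phi>, b)\<in>insert P p. holds N \<phi> (x @ map h b))"
    if "length x = n" for N :: "('f, 'r, 'u) fo_struct" and h x
  proof -
    have "holds N (ren g \<phi>) (x @ map h (d @ b)) \<longleftrightarrow> holds N \<phi> (x @ map h b)"
      by (rule holds_ren[OF f(1)]) (auto simp: g_def nth_append that)
    moreover have "holds N \<chi> (x @ map h (d @ b)) \<longleftrightarrow> holds N \<chi> (x @ map h d)"
      by (rule holds_cong[OF f(3)]) (auto simp: nth_append that)
    ultimately show ?thesis using \<chi>(2)[OF that] by (auto simp: P)
  qed
  ultimately show ?case by blast
qed

lemma conj_over:
  assumes "finite p" "p \<subseteq> formulas_over L n A"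
  shows "\<exists>\<chi> d. (\<chi>, d) \<in> formulas_over L n A \<and>
    (\<forall>(N :: ('f, 'r, 'u) fo_struct) x. length x = n \<longrightarrow>
       (holds N \<chi> (x @ d) \<longleftrightarrow> (\<forall>(\<phi>, b)\<in>p. holds N \<phi> (x @ b))))"
proof -
  obtain \<chi> d where \<chi>: "(\<chi>, d) \<in> formulas_over L n A"
    "\<forall>(N :: ('f, 'r, 'u) fo_struct) h x. length x = n \<longrightarrow>
       (holds N \<chi> (x @ map h d) \<longleftrightarrow> (\<forall>(\<phi>, b)\<in>p. holds N \<phi> (x @ map h b)))"
    using conj_over_map[OF assms] by blast
  show ?thesis
    by (rule exI[of _ \<chi>], rule exI[of _ d]) (use \<chi>(1) \<chi>(2)[rule_format, where h = "\<lambda>x. x"] in simp)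
qed

text \<open>The maps \<open>S\<close> that assemble a tuple from entries of the argument and elements of \<open>B\<close>, as they
  occur inside definable conditions.\<close>

definition sel :: "'u set \<Rightarrow> nat \<Rightarrow> ('u list \<Rightarrow> 'u list) \<Rightarrow> bool" where
  "sel B k S \<longleftrightarrow> (\<exists>js d. d \<in> lists B \<and> (\<forall>j\<in>set js. j < k + length d) \<and>
     (\<forall>as. length as = k \<longrightarrow> S as = map ((!) (as @ d)) js))"

lemma sel_id: "sel B k (\<lambda>as. as)"
  unfolding sel_def
  by (rule exI[of _ "[0..<k]"], rule exI[of _ "[]"]) (auto simp: map_nth)

lemma sel_const: "d \<in> lists B \<Longrightarrow> sel B k (\<lambda>as. d)"
proof -
  assume d: "d \<in> lists B"
  have "d = map ((!) (as @ d)) [k..<k + length d]" if "length as = k" for as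
    by (rule nth_equalityI) (simp_all flip: that)
  then show ?thesis unfolding sel_def
    by (intro exI[of _ "[k..<k + length d]"] exI[of _ d]) (use d in simp)
qed

lemma sel_take: "sel B k S \<Longrightarrow> sel B k (\<lambda>as. take i (S as))"
proof -
  assume "sel B k S"
  then obtain js d where 1: "d \<in> lists B" "\<forall>j\<in>set js. j < k + length d"
     "\<forall>as. length as = k \<longrightarrow> S as = map ((!) (as @ d)) js" by (auto simp: sel_def)
  show ?thesis unfolding sel_def
    by (rule exI[of _ "take i js"], rule exI[of _ d]) (use 1 in \<open>auto simp: take_map dest: in_set_takeD\<close>)
qed

lemma sel_drop: "sel B k S \<Longrightarrow> sel B k (\<lambda>as. drop i (S as))"
proof -
  assume "sel B k S"
  then obtain js d where 1: "d \<in> lists B" "\<forall>j\<in>set js. j < k + length d"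
     "\<forall>as. length as = k \<longrightarrow> S as = map ((!) (as @ d)) js" by (auto simp: sel_def)
  show ?thesis unfolding sel_def
    by (rule exI[of _ "drop i js"], rule exI[of _ d]) (use 1 in \<open>auto simp: drop_map dest: in_set_dropD\<close>)
qed

lemma sel_append:
  assumes "sel B k S" "sel B k S'"
  shows "sel B k (\<lambda>as. S as @ S' as)"
proof -
  obtain js d where 1: "d \<in> lists B" "\<forall>j\<in>set js. j < k + length d"
     "\<forall>as. length as = k \<longrightarrow> S as = map ((!) (as @ d)) js" using assms(1) by (auto simp: sel_def)
  obtain js' d' where 2: "d' \<in> lists B" "\<forall>j\<in>set js'. j < k + length d'"
     "\<forall>as. length as = k \<longrightarrow> S' as = map ((!) (as @ d')) js'" using assms(2) by (auto simp: sel_def)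
  define g where "g j = (if j < k then j else j + length d)" for j
  show ?thesis unfolding sel_def
  proof (intro exI conjI allI impI)
    show "d @ d' \<in> lists B" using 1 2 by simp
    show "\<forall>j\<in>set (js @ map g js'). j < k + length (d @ d')"
      using 1 2 by (auto simp: g_def)
    fix as :: "'a list" assume as: "length as = k"
    have "map ((!) (as @ d)) js = map ((!) (as @ d @ d')) js"
      using 1(2) as by (auto simp: nth_append)
    moreover have "map ((!) (as @ d')) js' = map ((!) (as @ d @ d')) (map g js')"
      using 2(2) as by (auto simp: nth_append g_def)
    ultimately show "S as @ S' as = map ((!) (as @ d @ d')) (js @ map g js')"
      using 1(3) 2(3) as by simp
  qed
qed

lemmas sel_intros = sel_id sel_const sel_take sel_drop sel_append

section \<open>Predicates on tuples definable with parameters\<close>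

locale fo =
  fixes L :: "('f, 'r) lang" and U :: "('f, 'r, 'u) fo_struct"
begin

text \<open>\<open>pd B k P\<close>: on \<open>k\<close>-tuples, \<open>P\<close> is definable with parameters in \<open>B\<close>.\<close>

definition pd :: "'u set \<Rightarrow> nat \<Rightarrow> ('u list \<Rightarrow> bool) \<Rightarrow> bool" where
  "pd B k P \<longleftrightarrow> (\<exists>\<phi> b. (\<phi>, b) \<in> formulas_over L k B \<and>
     (\<forall>as\<in>tuples (univ U) k. P as \<longleftrightarrow> holds U \<phi> (as @ b)))"

abbreviation V :: "nat \<Rightarrow> 'u list set" where "V k \<equiv> tuples (univ U) k"

lemma pdE:
  assumes "pd B k P"
  obtains \<phi> b where "b \<in> lists B" "\<phi> \<in> fms L (k + length b)"
    "\<And>as. as \<in> V k \<Longrightarrow> P as \<longleftrightarrow> holds U \<phi> (as @ b)"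
  using assms by (auto simp: pd_def formulas_over_def)

lemma pd_over: "(\<phi>, b) \<in> formulas_over L k B \<Longrightarrow> pd B k (\<lambda>as. holds U \<phi> (as @ b))"
  by (auto simp: pd_def)

lemma pd_cong:
  assumes "pd B k P" "\<And>as. as \<in> V k \<Longrightarrow> P as \<longleftrightarrow> Q as" shows "pd B k Q"
  using assms by (auto simp: pd_def)

lemma pd_mono: "pd B k P \<Longrightarrow> B \<subseteq> B' \<Longrightarrow> pd B' k P"
  by (fastforce simp: pd_def formulas_over_def)

lemma pd_finite: "pd B k P \<Longrightarrow> \<exists>B0. finite B0 \<and> B0 \<subseteq> B \<and> pd B0 k P"
proof -
  assume "pd B k P"
  then obtain \<phi> b where "b \<in> lists B" "\<phi> \<in> fms L (k + length b)"
    "\<And>as. as \<in> V k \<Longrightarrow> P as \<longleftrightarrow> holds U \<phi> (as @ b)" by (rule pdE) auto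
  then show ?thesis by (intro exI[of _ "set b"]) (auto simp: pd_def formulas_over_def)
qed

lemma pd_holds:
  assumes "\<phi> \<in> fms L l" "sel B k S" "\<And>as. length as = k \<Longrightarrow> length (S as) = l"
  shows "pd B k (\<lambda>as. holds U \<phi> (S as))"
proof -
  obtain js d where 1: "d \<in> lists B" "\<forall>j\<in>set js. j < k + length d"
     "\<forall>as. length as = k \<longrightarrow> S as = map ((!) (as @ d)) js" using assms(2) by (auto simp: sel_def)
  have len: "length js = l"
    using 1(3)[rule_format, of "replicate k undefined"] assms(3)[of "replicate k undefined"] by simp
  have "ren ((!) js) \<phi> \<in> fms L (k + length d)"
    by (rule fms_ren[OF assms(1)]) (use 1 len in auto)
  moreover have "holds U \<phi> (S as) \<longleftrightarrow> holds U (ren ((!) js) \<phi>) (as @ d)" if "as \<in> V k" for as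
    by (rule holds_ren[OF assms(1), symmetric]) (use 1 len that in \<open>auto simp: tuples_def\<close>)
  ultimately show ?thesis using 1 by (auto simp: pd_def formulas_over_def)
qed

lemma pd_sel:
  assumes "pd B l P" "sel B k S" "\<And>as. length as = k \<Longrightarrow> length (S as) = l" "B \<subseteq> univ U"
  shows "pd B k (\<lambda>as. P (S as))"
proof -
  obtain \<phi> b where 1: "b \<in> lists B" "\<phi> \<in> fms L (l + length b)"
    "\<And>as. as \<in> V l \<Longrightarrow> P as \<longleftrightarrow> holds U \<phi> (as @ b)" using assms(1) by (rule pdE) auto
  have "pd B k (\<lambda>as. holds U \<phi> (S as @ b))"
    by (rule pd_holds[OF 1(2)]) (use assms 1 in \<open>auto intro!: sel_intros\<close>)
  then show ?thesis
  proof (rule pd_cong)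
    fix as assume as: "as \<in> V k"
    obtain js d where d: "d \<in> lists B" "\<forall>j\<in>set js. j < k + length d"
     "\<forall>as. length as = k \<longrightarrow> S as = map ((!) (as @ d)) js" using assms(2) by (auto simp: sel_def)
    have *: "set (as @ d) \<subseteq> univ U" using as d(1) assms(4) by (auto simp: tuples_def)
    have "set (S as) \<subseteq> set (as @ d)"
      using d as by (auto simp: tuples_def simp del: set_append intro!: nth_mem)
    then have "S as \<in> V l" using * assms(3)[of as] as unfolding tuples_def by blast
    then show "holds U \<phi> (S as @ b) \<longleftrightarrow> P (S as)" using 1 by simp
  qed
qed

lemma pd_not: "pd B k P \<Longrightarrow> pd B k (\<lambda>as. \<not> P as)"
proof -
  assume "pd B k P"
  then obtain \<phi> b where "b \<in> lists B" "\<phi> \<in> fms L (k + length b)"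
    "\<And>as. as \<in> V k \<Longrightarrow> P as \<longleftrightarrow> holds U \<phi> (as @ b)" by (rule pdE) auto
  then show ?thesis unfolding pd_def
    by (intro exI[of _ "Neg \<phi>"] exI[of _ b]) (auto simp: formulas_over_def)
qed

lemma pd_ball_finite:
  assumes "finite I" "\<And>i. i \<in> I \<Longrightarrow> pd B k (P i)"
  shows "pd B k (\<lambda>as. \<forall>i\<in>I. P i as)"
proof -
  have "\<forall>i\<in>I. \<exists>q. q \<in> formulas_over L k B \<and>
      (\<forall>as\<in>V k. P i as \<longleftrightarrow> holds U (fst q) (as @ snd q))"
    using assms(2) by (fastforce simp: pd_def)
  from bchoice[OF this] obtain f where f: "\<And>i. i \<in> I \<Longrightarrow> f i \<in> formulas_over L k B \<and>
      (\<forall>as\<in>V k. P i as \<longleftrightarrow> holds U (fst (f i)) (as @ snd (f i)))"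
    by blast
  have fin: "finite (f ` I)" "f ` I \<subseteq> formulas_over L k B" using assms(1) f by auto
  obtain \<chi> d where \<chi>: "(\<chi>, d) \<in> formulas_over L k B"
    "\<And>N x. length x = k \<Longrightarrow> holds (N :: ('f, 'r, 'u) fo_struct) \<chi> (x @ d) \<longleftrightarrow> (\<forall>(\<phi>, b)\<in>f ` I. holds N \<phi> (x @ b))"
    using conj_over[OF fin] by blast
  then have "(\<forall>i\<in>I. P i as) \<longleftrightarrow> holds U \<chi> (as @ d)" if "as \<in> V k" for as
    using f that \<chi>(2)[OF tuples_length[OF that]] by (auto simp: case_prod_beta)
  then show ?thesis using \<chi>(1) by (auto simp: pd_def)
qed

lemma pd_conj:
  assumes "pd B k P" "pd B k Q" shows "pd B k (\<lambda>as. P as \<and> Q as)"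
proof -
  have "pd B k (\<lambda>as. \<forall>R\<in>{P, Q}. R as)"
    by (rule pd_ball_finite) (use assms in auto)
  then show ?thesis by simp
qed

lemma pd_imp: "pd B k P \<Longrightarrow> pd B k Q \<Longrightarrow> pd B k (\<lambda>as. P as \<longrightarrow> Q as)"
  by (rule pd_cong[OF pd_not[OF pd_conj[OF _ pd_not]]]) auto

lemma pd_iff: "pd B k P \<Longrightarrow> pd B k Q \<Longrightarrow> pd B k (\<lambda>as. P as \<longleftrightarrow> Q as)"
  by (rule pd_cong[OF pd_conj[OF pd_imp[of B k P Q] pd_imp[of B k Q P]]]) auto

lemma pd_True: "pd B k (\<lambda>_. True)"
  using pd_ball_finite[of "{}" B k] by simp

lemma pd_const: "pd B k (\<lambda>_. P)"
  using pd_True pd_not[OF pd_True] by (cases P) auto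

text \<open>De Bruijn quantifiers bind the lowest indices, so only the leading block of a tuple can
  be quantified. This is why later applications permute blocks, as in
  \<open>drop l z @ take l z\<close>.\<close>

lemma pd_ex_append:
  assumes "pd B (n + k) P"
  shows "pd B k (\<lambda>as. \<exists>x\<in>V n. P (x @ as))"
proof -
  obtain \<phi> b where 1: "b \<in> lists B" "\<phi> \<in> fms L (n + k + length b)"
    "\<And>as. as \<in> V (n + k) \<Longrightarrow> P as \<longleftrightarrow> holds U \<phi> (as @ b)" using assms(1) by (rule pdE) auto
  have "((Exists ^^ n) \<phi>, b) \<in> formulas_over L k B"
    using 1 by (simp add: formulas_over_def fms_Exists_power add.assoc)
  moreover have "(\<exists>x\<in>V n. P (x @ as)) \<longleftrightarrow> holds U ((Exists ^^ n) \<phi>) (as @ b)" if "as \<in> V k" for as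
    using 1(3) tuples_append[OF _ that] by (auto simp: holds_Exists_power)
  ultimately show ?thesis by (auto simp: pd_def)
qed

lemma pd_ex:
  assumes "pd B (n + k) (\<lambda>as. P (take n as) (drop n as))"
  shows "pd B k (\<lambda>as. \<exists>x\<in>V n. P x as)"
  using pd_ex_append[OF assms] by (rule pd_cong) (auto simp: tuples_def)

lemma pd_all:
  assumes "pd B (n + k) (\<lambda>as. P (take n as) (drop n as))"
  shows "pd B k (\<lambda>as. \<forall>x\<in>V n. P x as)"
  by (rule pd_cong[OF pd_not[OF pd_ex[OF pd_not[OF assms]]]]) auto

lemma pd_eq:
  assumes "b \<in> tuples B n" shows "pd B n (\<lambda>x. x = b)"
proof -
  have "pd B n (\<lambda>x. holds U (Eq (Var 0) (Var 1)) (take 1 (drop i x) @ [b ! i]))" if "i < n" for i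
    by (rule pd_holds[of _ 2])
      (use assms that in \<open>auto intro!: sel_intros simp: fms_def tuples_def\<close>)
  then have "pd B n (\<lambda>x. \<forall>i\<in>{..<n}. holds U (Eq (Var 0) (Var 1)) (take 1 (drop i x) @ [b ! i]))"
    by (intro pd_ball_finite) auto
  then show ?thesis
  proof (rule pd_cong)
    fix x assume x: "x \<in> V n"
    have "take 1 (drop i x) = [x ! i]" if "i < n" for i
      using x that by (simp add: tuples_def take_Suc_conv_app_nth[of 0, simplified] hd_drop_conv_nth
          take_Suc hd_conv_nth)
    then have "(\<forall>i\<in>{..<n}. holds U (Eq (Var 0) (Var 1)) (take 1 (drop i x) @ [b ! i])) \<longleftrightarrow> (\<forall>i<n. x ! i = b ! i)"
      by (auto simp: holds_def)
    then show "(\<forall>i\<in>{..<n}. holds U (Eq (Var 0) (Var 1)) (take 1 (drop i x) @ [b ! i])) \<longleftrightarrow> x = b"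
      using assms x by (auto simp: tuples_def list_eq_iff_nth_eq)
  qed
qed

end

section \<open>Maximality and ultrafilters\<close>

text \<open>Maximality is recorded as a finite obstruction for each omitted element, the form in
  which the applications consume it.\<close>

definition fin_maximal :: "('a set \<Rightarrow> bool) \<Rightarrow> 'a set \<Rightarrow> 'a set \<Rightarrow> 'a set \<Rightarrow> bool" where
  "fin_maximal Q X0 F M \<longleftrightarrow> X0 \<subseteq> M \<and> M \<subseteq> F \<and> (\<forall>H. finite H \<longrightarrow> H \<subseteq> M \<longrightarrow> Q H) \<and>
     (\<forall>x\<in>F - M. \<exists>H. finite H \<and> H \<subseteq> M \<and> \<not> Q (insert x H))"

text \<open>Zorn's lemma for a property of finite character. It yields ultrafilters, complete types,
  complete large types, a simultaneous choice for all ultrafilters, and the realization of an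
  ultrapower inside the monster model.\<close>

lemma tukey:
  assumes anti: "\<And>H H'. Q H \<Longrightarrow> H' \<subseteq> H \<Longrightarrow> Q H'"
    and X0: "X0 \<subseteq> F" "\<And>H. finite H \<Longrightarrow> H \<subseteq> X0 \<Longrightarrow> Q H"
  shows "\<exists>M. fin_maximal Q X0 F M"
proof -
  define A where "A = {X. X0 \<subseteq> X \<and> X \<subseteq> F \<and> (\<forall>H. finite H \<longrightarrow> H \<subseteq> X \<longrightarrow> Q H)}"
  have A: "X \<in> A \<longleftrightarrow> X0 \<subseteq> X \<and> X \<subseteq> F \<and> (\<forall>H. finite H \<longrightarrow> H \<subseteq> X \<longrightarrow> Q H)" for X
    by (simp add: A_def)
  have "\<exists>M\<in>A. \<forall>X\<in>A. M \<subseteq> X \<longrightarrow> X = M"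
  proof (rule subset_Zorn_nonempty)
    have "X0 \<in> A" unfolding A using X0 by simp
    then show "A \<noteq> {}" by blast
    fix C assume C: "C \<noteq> {}" "subset.chain A C"
    then have sub: "C \<subseteq> A" by (simp add: subset.chain_def)
    show "\<Union>C \<in> A"
      unfolding A
    proof (intro conjI allI impI)
      show "X0 \<subseteq> \<Union>C" using C(1) sub A by blast
      show "\<Union>C \<subseteq> F" using sub A by blast
      fix Y assume Y: "finite Y" "Y \<subseteq> \<Union>C"
      obtain X where "X \<in> C" "Y \<subseteq> X"
        by (rule finite_subset_Union_chain[OF Y C])
      then show "Q Y" using sub A[of X] Y by blast
    qed
  qed
  then obtain M where M: "M \<in> A" "\<And>X. X \<in> A \<Longrightarrow> M \<subseteq> X \<Longrightarrow> X = M" by blast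
  show ?thesis
    unfolding fin_maximal_def
  proof (rule exI[of _ M], intro conjI ballI)
    show "X0 \<subseteq> M" "M \<subseteq> F" "\<forall>H. finite H \<longrightarrow> H \<subseteq> M \<longrightarrow> Q H"
      using M(1) unfolding A by auto
    fix x assume "x \<in> F - M"
    then have x: "x \<in> F" "x \<notin> M" by auto
    then have "insert x M \<notin> A" using M(2)[of "insert x M"] by blast
    then obtain H where H: "finite H" "H \<subseteq> insert x M" "\<not> Q H"
      using x(1) M(1) unfolding A by blast
    show "\<exists>H. finite H \<and> H \<subseteq> M \<and> \<not> Q (insert x H)"
    proof (intro exI conjI)
      \<comment> \<open>The failing set may contain \<open>x\<close> itself; putting
        \<open>x\<close> back gives a superset of \<open>H\<close>, which fails as well.\<close>
      show "finite (H - {x})" "H - {x} \<subseteq> M" using H by auto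
      show "\<not> Q (insert x (H - {x}))" using H(3) anti[of "insert x (H - {x})" H] by blast
    qed
  qed
qed

section \<open>Ultrafilters and the quantifier for almost all\<close>

definition ultrafilter :: "'a set \<Rightarrow> 'a set set \<Rightarrow> bool" where
  "ultrafilter T r \<longleftrightarrow> r \<subseteq> Pow T \<and> {} \<notin> r \<and> (\<forall>X\<in>r. \<forall>Y\<in>r. X \<inter> Y \<in> r) \<and>
     (\<forall>X. X \<subseteq> T \<longrightarrow> X \<in> r \<or> T - X \<in> r)"

definition ev :: "'a set \<Rightarrow> 'a set set \<Rightarrow> ('a \<Rightarrow> bool) \<Rightarrow> bool" where
  "ev T r P \<longleftrightarrow> {x \<in> T. P x} \<in> r"

lemma ultrafilter_extend:
  assumes "G \<subseteq> Pow T" "\<And>H. finite H \<Longrightarrow> H \<subseteq> G \<Longrightarrow> T \<inter> \<Inter>H \<noteq> {}"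
  obtains r where "ultrafilter T r" "G \<subseteq> r"
proof -
  have "\<exists>r. fin_maximal (\<lambda>H. T \<inter> \<Inter>H \<noteq> {}) G (Pow T) r"
  proof (rule tukey)
    show "T \<inter> \<Inter>H' \<noteq> {}" if "T \<inter> \<Inter>H \<noteq> {}" "H' \<subseteq> H" for H H'
      using that by blast
  qed (use assms in auto)
  then obtain r where "fin_maximal (\<lambda>H. T \<inter> \<Inter>H \<noteq> {}) G (Pow T) r" by (elim exE)
  note * = this[unfolded fin_maximal_def]
  note r = *[THEN conjunct1] *[THEN conjunct2, THEN conjunct1]
    *[THEN conjunct2, THEN conjunct2, THEN conjunct1, rule_format]
    *[THEN conjunct2, THEN conjunct2, THEN conjunct2, rule_format, OF DiffI]
  \<comment> \<open>Adding such an \<open>X\<close> to \<open>r\<close> creates no empty finite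
    intersection, so maximality forces \<open>X\<close> into \<open>r\<close>.\<close>
  have big: "X \<in> r" if "X \<subseteq> T" "H \<subseteq> r" "finite H" "T \<inter> \<Inter>H \<subseteq> X" for X H
  proof (rule ccontr)
    assume "X \<notin> r"
    from r(4)[OF PowI[OF that(1)] this]
    obtain K where K: "finite K" "K \<subseteq> r" "T \<inter> \<Inter>(insert X K) = {}" by blast
    have "T \<inter> \<Inter>(H \<union> K) \<noteq> {}" using r(3) K that by simp
    then show False using K(3) that(4) by blast
  qed
  have "ultrafilter T r"
    unfolding ultrafilter_def
  proof (intro conjI ballI allI impI)
    show "r \<subseteq> Pow T" by (fact r)
    show "{} \<notin> r" using r(3)[of "{{}}"] by auto
    fix X Y assume "X \<in> r" "Y \<in> r"
    then show "X \<inter> Y \<in> r" using r(2) by (intro big[of _ "{X, Y}"]) auto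
  next
    fix X assume X: "X \<subseteq> T"
    show "X \<in> r \<or> T - X \<in> r"
    proof (rule disjCI)
      assume "T - X \<notin> r"
      from r(4)[OF PowI[OF Diff_subset] this]
      obtain H where H: "finite H" "H \<subseteq> r" "T \<inter> \<Inter>(insert (T - X) H) = {}" by blast
      have "T \<inter> \<Inter>H \<subseteq> X" using H(3) by auto
      then show "X \<in> r" using X H by (intro big)
    qed
  qed
  then show ?thesis using r(1) that by blast
qed

lemma ultrafilter_Int: "ultrafilter T r \<Longrightarrow> X \<in> r \<Longrightarrow> Y \<in> r \<Longrightarrow> X \<inter> Y \<in> r"
  and ultrafilter_empty: "ultrafilter T r \<Longrightarrow> {} \<notin> r"
  and ultrafilter_Compl: "ultrafilter T r \<Longrightarrow> X \<subseteq> T \<Longrightarrow> X \<notin> r \<Longrightarrow> T - X \<in> r"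
  by (auto simp: ultrafilter_def)

lemma ultrafilter_up: "ultrafilter T r \<Longrightarrow> X \<in> r \<Longrightarrow> X \<subseteq> Y \<Longrightarrow> Y \<subseteq> T \<Longrightarrow> Y \<in> r"
proof -
  assume a: "ultrafilter T r" "X \<in> r" "X \<subseteq> Y" "Y \<subseteq> T"
  have "T - Y \<notin> r"
  proof
    assume "T - Y \<in> r"
    then have "X \<inter> (T - Y) \<in> r" using a(1,2) by (intro ultrafilter_Int)
    moreover have "X \<inter> (T - Y) = {}" using a by blast
    ultimately show False using ultrafilter_empty[OF a(1)] by simp
  qed
  then show ?thesis using ultrafilter_Compl[OF a(1,4)] by blast
qed

lemma ev_mono:
  assumes "ultrafilter T r" "ev T r P" "\<And>x. x \<in> T \<Longrightarrow> P x \<Longrightarrow> Q x" shows "ev T r Q"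
  using assms(2) unfolding ev_def by (rule ultrafilter_up[OF assms(1)]) (use assms(3) in auto)

lemma ev_cong:
  assumes "\<And>x. x \<in> T \<Longrightarrow> P x \<longleftrightarrow> Q x" shows "ev T r P \<longleftrightarrow> ev T r Q"
  using assms by (auto simp: ev_def cong: conj_cong)

lemma ev_not: assumes "ultrafilter T r" shows "ev T r (\<lambda>x. \<not> P x) \<longleftrightarrow> \<not> ev T r P"
proof -
  have *: "{x \<in> T. \<not> P x} = T - {x \<in> T. P x}" by auto
  show ?thesis
  proof
    assume a: "ev T r (\<lambda>x. \<not> P x)"
    show "\<not> ev T r P"
    proof
      assume "ev T r P"
      then have "{x \<in> T. P x} \<inter> {x \<in> T. \<not> P x} \<in> r"
        using a unfolding ev_def by (rule ultrafilter_Int[OF assms])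
      moreover have "{x \<in> T. P x} \<inter> {x \<in> T. \<not> P x} = {}" by auto
      ultimately show False using ultrafilter_empty[OF assms] by simp
    qed
  next
    assume "\<not> ev T r P"
    then show "ev T r (\<lambda>x. \<not> P x)" unfolding ev_def * by (intro ultrafilter_Compl[OF assms]) auto
  qed
qed

lemma ev_conj: assumes "ultrafilter T r" shows "ev T r (\<lambda>x. P x \<and> Q x) \<longleftrightarrow> ev T r P \<and> ev T r Q"
proof
  assume "ev T r P \<and> ev T r Q"
  then have "{x \<in> T. P x} \<inter> {x \<in> T. Q x} \<in> r" unfolding ev_def using ultrafilter_Int[OF assms] by simp
  moreover have "{x \<in> T. P x} \<inter> {x \<in> T. Q x} = {x \<in> T. P x \<and> Q x}" by auto
  ultimately show "ev T r (\<lambda>x. P x \<and> Q x)" by (simp add: ev_def)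
next
  assume a: "ev T r (\<lambda>x. P x \<and> Q x)"
  then show "ev T r P \<and> ev T r Q"
    using ev_mono[OF assms a, of P] ev_mono[OF assms a, of Q] by blast
qed

lemma ev_True: assumes "ultrafilter T r" "\<And>x. x \<in> T \<Longrightarrow> P x" shows "ev T r P"
proof -
  have "{x \<in> T. P x} = T" using assms(2) by auto
  moreover have "T \<in> r" using ultrafilter_Compl[OF assms(1), of "{}"] ultrafilter_empty[OF assms(1)] by simp
  ultimately show ?thesis by (simp add: ev_def)
qed

lemma ev_ex: assumes "ultrafilter T r" "ev T r P" shows "\<exists>x\<in>T. P x"
proof (rule ccontr)
  assume "\<not> (\<exists>x\<in>T. P x)"
  then have *: "{x \<in> T. P x} = {}" by auto
  show False using assms(2) ultrafilter_empty[OF assms(1)] unfolding ev_def * by contradiction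
qed

lemma ev_const: assumes "ultrafilter T r" shows "ev T r (\<lambda>_. P) \<longleftrightarrow> P"
  using ev_True[OF assms, of "\<lambda>_. P"] ev_ex[OF assms, of "\<lambda>_. P"] by (cases P) auto

lemma ev_ball_finite:
  assumes "ultrafilter T r" "finite I"
  shows "ev T r (\<lambda>x. \<forall>i\<in>I. P i x) \<longleftrightarrow> (\<forall>i\<in>I. ev T r (P i))"
  using assms(2) by (induction I rule: finite_induct) (auto simp: ev_conj[OF assms(1)] ev_const[OF assms(1)])

text \<open>Sequences of \<open>m\<close>-tuples are coded as one concatenated list, since
  definability is formulated for single tuples; block \<open>j\<close> starts at position
  \<open>j * m\<close>.\<close>

lemma take_drop_concat:
  assumes "\<forall>x\<in>set xss. length x = m" "j < length xss"
  shows "take m (drop (j * m) (concat xss)) = xss ! j"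
  using assms
proof (induction xss arbitrary: j)
  case (Cons x xss)
  then show ?case by (cases j) auto
qed simp

lemma length_concat_const: "(\<forall>x\<in>set xss. length x = m) \<Longrightarrow> length (concat xss) = length xss * m"
  by (induction xss) auto

abbreviation Fm :: "('f, 'r) lang \<Rightarrow> ('f, 'r) fm set" where
  "Fm L \<equiv> {\<phi>. wf_fm L \<phi>}"

text \<open>Finite obstructions to a formula and to its negation cannot coexist, since a realization
  of their union satisfies one of the two. The lemma lives in \<open>fo\<close>, without saturation,
  so that it also applies to pair structures.\<close>

lemma (in fo) complete_extension:
  assumes "p \<subseteq> formulas_over L n A" "\<And>p0. finite p0 \<Longrightarrow> p0 \<subseteq> p \<Longrightarrow> \<exists>a. realizes U n a p0"
  shows "\<exists>q\<in>complete_types L U n A. p \<subseteq> q"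
proof -
  have "\<exists>q. fin_maximal (\<lambda>H. \<exists>a. realizes U n a H) p (formulas_over L n A) q"
  proof (rule tukey)
    show "\<exists>a. realizes U n a H'" if "\<exists>a. realizes U n a H" "H' \<subseteq> H" for H H'
      using that unfolding realizes_def by blast
  qed (use assms in auto)
  then obtain q where "fin_maximal (\<lambda>H. \<exists>a. realizes U n a H) p (formulas_over L n A) q" by (elim exE)
  note * = this[unfolded fin_maximal_def]
  note q = *[THEN conjunct1] *[THEN conjunct2, THEN conjunct1]
    *[THEN conjunct2, THEN conjunct2, THEN conjunct1, rule_format]
    *[THEN conjunct2, THEN conjunct2, THEN conjunct2, rule_format, OF DiffI]
  have "(\<phi>, b) \<in> q \<or> (Neg \<phi>, b) \<in> q" if \<phi>: "(\<phi>, b) \<in> formulas_over L n A" for \<phi> b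
  proof (rule ccontr)
    assume n: "\<not> ((\<phi>, b) \<in> q \<or> (Neg \<phi>, b) \<in> q)"
    have "(Neg \<phi>, b) \<in> formulas_over L n A" using \<phi> by (simp add: formulas_over_def)
    then obtain H K where H: "finite H" "H \<subseteq> q" "\<not> (\<exists>a. realizes U n a (insert (\<phi>, b) H))"
      and K: "finite K" "K \<subseteq> q" "\<not> (\<exists>a. realizes U n a (insert (Neg \<phi>, b) K))"
      using n q(4)[OF \<phi>] q(4)[of "(Neg \<phi>, b)"] by blast
    have "\<exists>a. realizes U n a (H \<union> K)" using H K by (intro q(3)) auto
    then obtain a where a: "realizes U n a (H \<union> K)" by blast
    have "realizes U n a (insert (\<phi>, b) H) \<or> realizes U n a (insert (Neg \<phi>, b) K)"
      using a by (cases "holds U \<phi> (a @ b)") (auto simp: realizes_def)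
    then show False using H K by blast
  qed
  then have "q \<in> complete_types L U n A"
    unfolding complete_types_def using q by auto
  then show ?thesis using q(1) by blast
qed

section \<open>Coheir sequences\<close>

locale monster = fo L U for L :: "('f, 'r) lang" and U :: "('f, 'r, 'u) fo_struct" +
  fixes \<kappa> :: "'k rel"
  assumes struct: "is_struct L U" and limit: "strong_limit \<kappa>"
    and few: "|Fm L| <o \<kappa>" and saturated: "saturated L \<kappa> U"
begin

section \<open>Small parameter sets and realization of types\<close>

abbreviation small :: "'u set \<Rightarrow> bool" where "small \<equiv> small_subset \<kappa> U"

lemma infinite_wf: "infinite (Fm L)"
proof -
  have "inj (\<lambda>i. Eq (Var i) (Var i))" by (simp add: inj_def)
  then have "infinite (range (\<lambda>i. Eq (Var i) (Var i) :: ('f, 'r) fm))"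
    using finite_imageD infinite_UNIV_nat by blast
  moreover have "range (\<lambda>i. Eq (Var i) (Var i)) \<subseteq> Fm L" by auto
  ultimately show ?thesis using finite_subset by blast
qed

lemma card_order: "Card_order \<kappa>"
  using limit by (simp add: strong_limit_def)

lemma infinite_Field: "infinite (Field \<kappa>)"
proof -
  have "|Fm L| \<le>o |Field \<kappa>|"
    using ordLess_imp_ordLeq[OF few] ordIso_symmetric[OF card_of_Field_ordIso[OF card_order]]
    by (rule ordLeq_ordIso_trans)
  then show ?thesis using infinite_wf by (rule card_of_ordLeq_infinite)
qed

lemma countable_less:
  assumes "\<And>i :: nat. finite (A i)" shows "|\<Union>i. A i| <o \<kappa>"
proof -
  have "|\<Union>i\<in>UNIV. A i| \<le>o |Fm L|"
  proof (rule card_of_UNION_ordLeq_infinite[OF infinite_wf])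
    show "|UNIV :: nat set| \<le>o |Fm L|"
      using infinite_wf infinite_iff_card_of_nat by blast
    show "\<forall>i\<in>UNIV. |A i| \<le>o |Fm L|"
      using assms infinite_wf by (meson card_of_ordLeq_infinite card_of_Well_order ordLeq_total)
  qed
  then show ?thesis using few by (rule ordLeq_ordLess_trans)
qed

lemma finite_less: "finite A \<Longrightarrow> |A| <o \<kappa>"
  using countable_less[of "\<lambda>_. A"] by simp

lemma small_countable: "(\<And>i :: nat. finite (A i)) \<Longrightarrow> (\<And>i. A i \<subseteq> univ U) \<Longrightarrow> small (\<Union>i. A i)"
  using countable_less by (auto simp: small_subset_def)

lemma small_finite: "finite A \<Longrightarrow> A \<subseteq> univ U \<Longrightarrow> small A"
  using finite_less by (simp add: small_subset_def)

lemma small_Un: "small A \<Longrightarrow> small B \<Longrightarrow> small (A \<union> B)"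
  unfolding small_subset_def
  using card_of_Un_ordLess_infinite_Field[OF infinite_Field card_order] by blast

lemma small_subset: "small A \<Longrightarrow> B \<subseteq> A \<Longrightarrow> small B"
  unfolding small_subset_def using card_of_mono1 ordLeq_ordLess_trans by blast

lemma small_set: "b \<in> V m \<Longrightarrow> small (set b)"
  by (rule small_finite) (auto simp: tuples_def)

lemma realize_formulas:
  assumes "small B" "p \<subseteq> formulas_over L n B"
    "\<And>p0. finite p0 \<Longrightarrow> p0 \<subseteq> p \<Longrightarrow> \<exists>a\<in>V n. \<forall>(\<phi>, b)\<in>p0. holds U \<phi> (a @ b)"
  shows "\<exists>a\<in>V n. \<forall>(\<phi>, b)\<in>p. holds U \<phi> (a @ b)"
proof -
  obtain q where q: "q \<in> complete_types L U n B" "p \<subseteq> q"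
    using complete_extension[OF assms(2)] assms(3) unfolding realizes_def by metis
  then obtain a where "realizes U n a q"
    using saturated assms(1) unfolding saturated_def small_subset_def by blast
  then show ?thesis using q(2) unfolding realizes_def by blast
qed

text \<open>Compactness for predicates instead of formulas. Each predicate is replaced by all
  formulas over \<open>B\<close> that define it, so that no defining formula has to be
  chosen.\<close>

lemma realize:
  assumes "small B" "\<And>P. P \<in> PP \<Longrightarrow> pd B n P"
    "\<And>PP0. finite PP0 \<Longrightarrow> PP0 \<subseteq> PP \<Longrightarrow> \<exists>a\<in>V n. \<forall>P\<in>PP0. P a"
  shows "\<exists>a\<in>V n. \<forall>P\<in>PP. P a"
proof -
  define R where "R P q \<longleftrightarrow> q \<in> formulas_over L n B \<and> (\<forall>as\<in>V n. P as \<longleftrightarrow> holds U (fst q) (as @ snd q))" for P q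
  define p where "p = {q. \<exists>P\<in>PP. R P q}"
  have "\<exists>a\<in>V n. \<forall>(\<phi>, b)\<in>p. holds U \<phi> (a @ b)"
  proof (rule realize_formulas[OF assms(1)])
    show "p \<subseteq> formulas_over L n B" by (auto simp: p_def R_def)
    fix p0 assume p0: "finite p0" "p0 \<subseteq> p"
    then have "\<forall>q\<in>p0. \<exists>P. P \<in> PP \<and> R P q" by (auto simp: p_def)
    from bchoice[OF this] obtain f where f: "\<forall>q\<in>p0. f q \<in> PP \<and> R (f q) q" by blast
    have "\<exists>a\<in>V n. \<forall>P\<in>f ` p0. P a" using p0 f by (intro assms(3)) auto
    then show "\<exists>a\<in>V n. \<forall>(\<phi>, b)\<in>p0. holds U \<phi> (a @ b)" using f by (fastforce simp: R_def)
  qed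
  then obtain a where a: "a \<in> V n" "\<forall>(\<phi>, b)\<in>p. holds U \<phi> (a @ b)" by blast
  have "P a" if P: "P \<in> PP" for P
  proof -
    obtain \<phi> b where "(\<phi>, b) \<in> formulas_over L n B" "\<forall>as\<in>V n. P as \<longleftrightarrow> holds U \<phi> (as @ b)"
      using assms(2)[OF P] by (auto simp: pd_def)
    then have "R P (\<phi>, b)" by (simp add: R_def)
    then have "(\<phi>, b) \<in> p" using P by (auto simp: p_def)
    then show ?thesis using a \<open>\<forall>as\<in>V n. P as \<longleftrightarrow> holds U \<phi> (as @ b)\<close> by auto
  qed
  then show ?thesis using a(1) by blast
qed

section \<open>Generic tuples and generic sequences of an ultrafilter\<close>

text \<open>The tuple \<open>b\<close> realizes over \<open>D\<close> the average type of
  \<open>r\<close>, a type finitely satisfiable in \<open>T\<close>.\<close>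

definition generic :: "nat \<Rightarrow> 'u list set \<Rightarrow> 'u list set set \<Rightarrow> 'u set \<Rightarrow> 'u list \<Rightarrow> bool" where
  "generic m T r D b \<longleftrightarrow> b \<in> V m \<and> (\<forall>P. pd D m P \<longrightarrow> (P b \<longleftrightarrow> ev T r P))"

lemma generic_exists:
  assumes "ultrafilter T r" "T \<subseteq> V m" "small D"
  shows "\<exists>b. generic m T r D b"
proof -
  have "\<exists>b\<in>V m. \<forall>P\<in>{P. pd D m P \<and> ev T r P}. P b"
  proof (rule realize[OF assms(3)])
    fix PP assume "finite PP" "PP \<subseteq> {P. pd D m P \<and> ev T r P}"
    then have "ev T r (\<lambda>b. \<forall>P\<in>PP. P b)"
      using ev_ball_finite[OF assms(1), of PP "\<lambda>P. P"] by auto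
    then show "\<exists>b\<in>V m. \<forall>P\<in>PP. P b" using ev_ex[OF assms(1)] assms(2) by blast
  qed simp
  then obtain b where b: "b \<in> V m" "\<And>P. pd D m P \<Longrightarrow> ev T r P \<Longrightarrow> P b" by blast
  have "P b \<longleftrightarrow> ev T r P" if "pd D m P" for P
    using b(2)[OF that] b(2)[OF pd_not[OF that]] ev_not[OF assms(1), of P] by blast
  then show ?thesis using b(1) by (auto simp: generic_def)
qed

text \<open>In model-theoretic terms, a Morley sequence of the coheir given by
  \<open>r\<close>.\<close>

definition generic_seq :: "nat \<Rightarrow> 'u list set \<Rightarrow> 'u list set set \<Rightarrow> 'u set \<Rightarrow> (nat \<Rightarrow> 'u list) \<Rightarrow> bool" where
  "generic_seq m T r D bs \<longleftrightarrow> (\<forall>i. generic m T r (D \<union> (\<Union>j<i. set (bs j))) (bs i))"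

lemma generic_seq_exists:
  assumes "ultrafilter T r" "T \<subseteq> V m" "small D"
  obtains bs where "generic_seq m T r D bs"
proof -
  \<comment> \<open>The state pairs the base accumulated so far with the next term, so that each
    choice depends on the previous state only.\<close>
  have "\<exists>f. \<forall>k. (small (fst (f k)) \<and> generic m T r (fst (f k)) (snd (f k)) \<and> (k = 0 \<longrightarrow> fst (f k) = D)) \<and>
    fst (f (Suc k)) = fst (f k) \<union> set (snd (f k))"
  proof (rule dependent_nat_choice)
    show "\<exists>x. small (fst x) \<and> generic m T r (fst x) (snd x) \<and> (0 = (0::nat) \<longrightarrow> fst x = D)"
      using generic_exists[OF assms] assms(3) by auto
  next
    fix x :: "'u set \<times> 'u list" and k :: nat
    assume x: "small (fst x) \<and> generic m T r (fst x) (snd x) \<and> (k = 0 \<longrightarrow> fst x = D)"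
    then have s: "small (fst x \<union> set (snd x))" by (auto simp: generic_def intro!: small_Un small_set)
    then obtain b where "generic m T r (fst x \<union> set (snd x)) b"
      using generic_exists[OF assms(1,2)] by blast
    then show "\<exists>y. (small (fst y) \<and> generic m T r (fst y) (snd y) \<and> (Suc k = 0 \<longrightarrow> fst y = D)) \<and>
        fst y = fst x \<union> set (snd x)"
      using s by (intro exI[of _ "(fst x \<union> set (snd x), b)"]) simp
  qed
  then obtain f where f: "\<And>k. generic m T r (fst (f k)) (snd (f k))" "fst (f 0) = D"
    "\<And>k. fst (f (Suc k)) = fst (f k) \<union> set (snd (f k))" by blast
  have "fst (f k) = D \<union> (\<Union>j<k. set (snd (f j)))" for k
    by (induction k) (auto simp: f lessThan_Suc)
  then have "generic_seq m T r D (\<lambda>k. snd (f k))"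
    using f(1) unfolding generic_seq_def by metis
  then show ?thesis using that by blast
qed

lemma generic_seq_in: "generic_seq m T r D bs \<Longrightarrow> bs i \<in> V m"
  by (auto simp: generic_seq_def generic_def)

text \<open>The earlier terms lie in the base over which the last one is generic, so they can be
  treated as parameters and the last coordinate as an ultrafilter quantifier. Inductions along the
  sequence peel off entries from the right in this way.\<close>

lemma generic_seq_last:
  assumes "ultrafilter T r" "T \<subseteq> tuples D m" "D \<subseteq> univ U" "generic_seq m T r D bs" "pd D (k * m + m) P"
    "sorted_wrt (<) (is @ [j])" "length is = k"
  shows "P (concat (map bs (is @ [j]))) \<longleftrightarrow> ev T r (\<lambda>y. P (concat (map bs is) @ y))"
proof -
  note in_V = generic_seq_in[OF assms(4)]
  let ?D = "D \<union> (\<Union>l<j. set (bs l))"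
  have D: "?D \<subseteq> univ U" using assms(3) in_V by (auto simp: tuples_def)
  have "set is \<subseteq> {..<j}" using assms(6) by (auto simp: sorted_wrt_append)
  then have "concat (map bs is) \<in> lists ?D" by fastforce
  moreover have "length (concat (map bs is)) = k * m"
    using length_concat_const[of "map bs is" m] in_V assms(7) by (auto simp: tuples_def)
  ultimately have "pd ?D m (\<lambda>y. P (concat (map bs is) @ y))"
    by (intro pd_sel[OF pd_mono[OF assms(5)]] sel_intros D) auto
  then have "P (concat (map bs is) @ bs j) \<longleftrightarrow> ev T r (\<lambda>y. P (concat (map bs is) @ y))"
    using assms(4) by (auto simp: generic_seq_def generic_def)
  then show ?thesis by simp
qed

text \<open>Once the last entry is replaced by a tuple \<open>y\<close> of \<open>T\<close>, it is a
  parameter from \<open>D\<close>, and the induction hypothesis applies to the shorter sequence with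
  \<open>y\<close> fixed. This is where \<open>T\<close> must consist of tuples of
  \<open>D\<close>.\<close>

lemma generic_seq_indisc:
  assumes "ultrafilter T r" "T \<subseteq> tuples D m" "D \<subseteq> univ U" "generic_seq m T r D bs"
    "pd D (k * m) P" "sorted_wrt (<) is" "length is = k"
  shows "P (concat (map bs is)) \<longleftrightarrow> P (concat (map bs [0..<k]))"
  using assms(5-)
proof (induction k arbitrary: P "is")
  case (Suc k)
  then obtain js j where js: "is = js @ [j]" "length js = k"
    by (metis length_Suc_conv_rev)
  have P: "pd D (k * m + m) P" using Suc.prems(1) by (simp add: add.commute)
  have "P (concat (map bs is)) \<longleftrightarrow> ev T r (\<lambda>y. P (concat (map bs js) @ y))"
    using generic_seq_last[OF assms(1-4) P] Suc.prems js by simp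
  also have "\<dots> \<longleftrightarrow> ev T r (\<lambda>y. P (concat (map bs [0..<k]) @ y))"
  proof (rule ev_cong)
    fix y assume "y \<in> T"
    then have y: "y \<in> tuples D m" using assms(2) by blast
    have "pd D (k * m) (\<lambda>z. P (z @ y))"
      using y by (intro pd_sel[OF P] sel_intros assms(3)) (auto simp: tuples_def)
    then show "P (concat (map bs js) @ y) \<longleftrightarrow> P (concat (map bs [0..<k]) @ y)"
      using Suc.prems(2) js by (intro Suc.IH) (auto simp: sorted_wrt_append)
  qed
  also have "\<dots> \<longleftrightarrow> P (concat (map bs ([0..<k] @ [k])))"
    by (rule generic_seq_last[OF assms(1-4) P, symmetric]) (auto simp: sorted_wrt_append)
  finally show ?case by simp
qed simp

section \<open>NIP along sequences\<close>

text \<open>If all finite patterns were consistent, compactness would realize the infinite ones too,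
  and the range of the sequence would be an infinite shattered set.\<close>

lemma nip_pattern:
  assumes "NIP L U" "\<phi> \<in> fms L (n + m)" "\<And>i. a i \<in> V n"
  shows "\<exists>(N :: nat) \<eta>. \<not> (\<exists>b\<in>V m. \<forall>i<N. holds U \<phi> (a i @ b) \<longleftrightarrow> \<eta> i)"
proof (rule ccontr)
  assume "\<not> ?thesis"
  then have *: "\<forall>(N :: nat) \<eta>. \<exists>b\<in>V m. \<forall>i<N. holds U \<phi> (a i @ b) \<longleftrightarrow> \<eta> i"
    unfolding not_ex not_not .
  have pat: "\<exists>b\<in>V m. \<forall>i<N. holds U \<phi> (a i @ b) \<longleftrightarrow> \<eta> i" for N :: nat and \<eta>
    by (rule *[THEN spec, THEN spec])
  \<comment> \<open>\<open>NIP\<close> speaks of an infinite set, not of a sequence; the pattern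
    that is true only at \<open>i\<close> separates \<open>a i\<close> from the other terms.\<close>
  have "inj a"
  proof
    fix i j :: nat assume ij: "a i = a j"
    obtain b where b: "\<forall>l<Suc (max i j). holds U \<phi> (a l @ b) \<longleftrightarrow> l = i"
      using pat[of "Suc (max i j)" "\<lambda>l. l = i"] by (elim bexE)
    have "holds U \<phi> (a i @ b)" using b[rule_format, of i] by simp
    then have "holds U \<phi> (a j @ b)" unfolding ij .
    then show "i = j" using b[rule_format, of j] by simp
  qed
  then have "infinite (range a)" using finite_imageD[of a UNIV] by auto
  moreover have "shatters U \<phi> m (range a)"
    unfolding shatters_def
  proof (intro allI impI)
    fix I assume "I \<subseteq> range a"
    let ?B = "\<Union>i. set (a i)"
    define R where "R i b \<longleftrightarrow> (holds U \<phi> (a i @ b) \<longleftrightarrow> a i \<in> I)" for i b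
    have "\<exists>b\<in>V m. \<forall>P\<in>range R. P b"
    proof (rule realize)
      show "small ?B" using assms(3) by (intro small_countable) (auto simp: tuples_def)
      show "pd ?B m P" if "P \<in> range R" for P
      proof -
        from that obtain i where "P = R i" by blast
        moreover have "pd ?B m (R i)"
          unfolding R_def
        proof (rule pd_iff[OF pd_holds[OF assms(2)] pd_const])
          show "sel ?B m ((@) (a i))" by (intro sel_intros) auto
        qed (use assms(3)[of i] in \<open>simp add: tuples_def\<close>)
        ultimately show ?thesis by simp
      qed
      fix PP assume "finite PP" "PP \<subseteq> range R"
      then obtain J where J: "finite J" "PP = R ` J" using finite_subset_image[of PP R UNIV] by blast
      obtain N where N: "\<And>j. j \<in> J \<Longrightarrow> j < N"
        using J(1) finite_nat_set_iff_bounded[of J] by blast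
      obtain b where "b \<in> V m" "\<forall>i<N. holds U \<phi> (a i @ b) \<longleftrightarrow> a i \<in> I"
        using pat[of N "\<lambda>i. a i \<in> I"] by (elim bexE)
      then show "\<exists>b\<in>V m. \<forall>P\<in>PP. P b" by (intro bexI[of _ b]) (auto simp: J(2) N R_def)
    qed
    then show "\<exists>b\<in>V m. \<forall>a'\<in>range a. holds U \<phi> (a' @ b) \<longleftrightarrow> a' \<in> I" by (simp add: R_def)
  qed
  moreover have "range a \<subseteq> V n" using assms(3) by auto
  moreover have "\<not> (\<exists>X. X \<subseteq> V n \<and> infinite X \<and> shatters U \<phi> m X)"
    using assms(1)[unfolded NIP_def] assms(2) by simp
  ultimately show False by blast
qed

text \<open>An alternation on \<open>2 * N\<close> terms contains every pattern of length
  \<open>N\<close> on a subsequence, and indiscernibility moves it to the first \<open>N\<close>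
  terms, against \<open>nip_pattern\<close>.\<close>

lemma generic_seq_alternation:
  assumes "NIP L U" "ultrafilter T r" "T \<subseteq> tuples D m" "D \<subseteq> univ U" "generic_seq m T r D bs" "\<phi> \<in> fms L (n + m)"
  shows "\<exists>k. \<not> (\<exists>x\<in>V n. \<forall>i<k. holds U \<phi> (x @ bs i) \<longleftrightarrow> even i)"
proof (rule ccontr)
  assume "\<not> ?thesis"
  then have alt: "\<exists>x\<in>V n. \<forall>i<k. holds U \<phi> (x @ bs i) \<longleftrightarrow> even i" for k by simp
  note in_V = generic_seq_in[OF assms(5)]
  \<comment> \<open>\<open>nip_pattern\<close> shatters tuples on the left of the formula. Here
    these are the terms of the sequence, so the two blocks of variables are exchanged.\<close>
  define g where "g i = (if i < n then i + m else i - n)" for i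
  have swap: "holds U (ren g \<phi>) (bs i @ x) \<longleftrightarrow> holds U \<phi> (x @ bs i)" if "x \<in> V n" for i x
    by (rule holds_ren[OF assms(6)]) (use that in_V[of i] in \<open>auto simp: g_def nth_append tuples_def\<close>)
  have "ren g \<phi> \<in> fms L (m + n)" by (rule fms_ren[OF assms(6)]) (auto simp: g_def)
  from nip_pattern[of \<open>ren g \<phi>\<close> m n bs, OF assms(1) this in_V] obtain N \<eta>
    where "\<not> (\<exists>x\<in>V n. \<forall>i<N. holds U (ren g \<phi>) (bs i @ x) \<longleftrightarrow> \<eta> i)" by (elim exE)
  then have N: "\<not> (\<exists>x\<in>V n. \<forall>i<N. holds U \<phi> (x @ bs i) \<longleftrightarrow> \<eta> i)"
    by (simp add: swap cong: bex_cong_simp)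
  obtain x where x: "x \<in> V n" "\<forall>i<2 * N. holds U \<phi> (x @ bs i) \<longleftrightarrow> even i"
    using alt[of "2 * N"] by (elim bexE)
  \<comment> \<open>From the pair \<open>2 * j\<close>, \<open>2 * j + 1\<close> the member with the
    truth value \<open>\<eta> j\<close> is taken; the resulting indices still increase.\<close>
  define l where "l j = 2 * j + (if \<eta> j then 0 else 1)" for j :: nat
  define P where "P z \<longleftrightarrow> (\<exists>x\<in>V n. \<forall>j\<in>{..<N}. holds U \<phi> (x @ take m (drop (j * m) z)) \<longleftrightarrow> \<eta> j)" for z
  have le: "j * m + m \<le> N * m" if "j < N" for j
  proof -
    have "Suc j * m \<le> N * m" using that by (intro mult_le_mono1) simp
    then show ?thesis by simp
  qed
  have "pd D (n + N * m) (\<lambda>z. holds U \<phi> (take n z @ take m (drop (j * m) (drop n z))))" if "j < N" for j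
    by (rule pd_holds[OF assms(6)]) (use le[OF that] in \<open>auto intro!: sel_intros\<close>)
  then have "pd D (N * m) P"
    unfolding P_def
    by (intro pd_ex pd_ball_finite pd_iff[OF _ pd_const]) auto
  moreover have "sorted_wrt (<) (map l [0..<N])"
    by (auto simp: sorted_wrt_iff_nth_less l_def)
  ultimately have "P (concat (map bs (map l [0..<N]))) \<longleftrightarrow> P (concat (map bs [0..<N]))"
    using generic_seq_indisc[OF assms(2-5), of N P "map l [0..<N]"] by simp
  moreover have "take m (drop (j * m) (concat (map bs (map l [0..<N])))) = bs (l j)"
    "take m (drop (j * m) (concat (map bs [0..<N]))) = bs j" if "j < N" for j
    using take_drop_concat[of "map bs (map l [0..<N])" m j] take_drop_concat[of "map bs [0..<N]" m j] that in_V
    by (simp_all add: tuples_def)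
  ultimately have *: "(\<exists>x\<in>V n. \<forall>j<N. holds U \<phi> (x @ bs (l j)) \<longleftrightarrow> \<eta> j) \<longleftrightarrow>
      (\<exists>x\<in>V n. \<forall>j<N. holds U \<phi> (x @ bs j) \<longleftrightarrow> \<eta> j)" by (simp add: P_def Ball_def)
  have "\<forall>j<N. holds U \<phi> (x @ bs (l j)) \<longleftrightarrow> \<eta> j"
    using x(2) by (auto simp: l_def)
  then show False using N x(1) unfolding *[symmetric] by blast
qed

end

section \<open>Chains in partial orders\<close>

text \<open>\<open>ht S lt k D x\<close>: some \<open>lt\<close>-chain of length \<open>k\<close> in \<open>D\<close> lies below \<open>x\<close>.\<close>

fun ht :: "'a set \<Rightarrow> ('a \<Rightarrow> 'a \<Rightarrow> bool) \<Rightarrow> nat \<Rightarrow> ('a \<Rightarrow> bool) \<Rightarrow> 'a \<Rightarrow> bool" where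
  "ht S lt 0 D x \<longleftrightarrow> True"
| "ht S lt (Suc k) D x \<longleftrightarrow> (\<exists>y\<in>S. D y \<and> lt y x \<and> ht S lt k D y)"

definition big :: "'a set \<Rightarrow> ('a \<Rightarrow> 'a \<Rightarrow> bool) \<Rightarrow> ('a \<Rightarrow> bool) \<Rightarrow> bool" where
  "big S lt D \<longleftrightarrow> (\<forall>k. \<exists>x\<in>S. D x \<and> ht S lt k D x)"

lemma ht_mono: "ht S lt k D x \<Longrightarrow> k' \<le> k \<Longrightarrow> (\<And>y. y \<in> S \<Longrightarrow> D y \<Longrightarrow> D' y) \<Longrightarrow> ht S lt k' D' x"
proof (induction k arbitrary: k' x)
  case (Suc k)
  show ?case
  proof (cases k')
    case (Suc j)
    obtain y where "y \<in> S" "D y" "lt y x" "ht S lt k D y" using Suc.prems(1) by auto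
    moreover from this have "ht S lt j D' y" using Suc.IH[of y j] Suc.prems Suc by simp
    ultimately show ?thesis using Suc.prems(3) Suc by auto
  qed simp
qed simp

lemma big_mono: "big S lt D \<Longrightarrow> (\<And>y. y \<in> S \<Longrightarrow> D y \<Longrightarrow> D' y) \<Longrightarrow> big S lt D'"
  unfolding big_def using ht_mono[of S lt _ D _ _ D'] by (meson order_refl)

definition trans_lt :: "'a set \<Rightarrow> ('a \<Rightarrow> 'a \<Rightarrow> bool) \<Rightarrow> bool" where
  "trans_lt S lt \<longleftrightarrow> (\<forall>x\<in>S. \<forall>y\<in>S. \<forall>z\<in>S. lt x y \<longrightarrow> lt y z \<longrightarrow> lt x z)"

lemma ht_up:
  assumes "ht S lt k D x" "lt x y" "x \<in> S" "y \<in> S"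
    and trans: "trans_lt S lt"
  shows "ht S lt k D y"
proof (cases k)
  case (Suc j)
  then obtain z where z: "z \<in> S" "D z" "lt z x" "ht S lt j D z" using assms(1) by auto
  have "lt z y" using trans z(1,3) assms(2-4) unfolding trans_lt_def by blast
  then show ?thesis using z Suc by auto
qed simp

lemma ht_disj:
  assumes "ht S lt k (\<lambda>x. D x \<or> E x) x" "x \<in> S"
    and trans: "trans_lt S lt"
  shows "\<exists>i j. i + j = k \<and> ht S lt i D x \<and> ht S lt j E x"
  using assms(1,2)
proof (induction k arbitrary: x)
  case (Suc k)
  then obtain y where y: "y \<in> S" "D y \<or> E y" "lt y x" "ht S lt k (\<lambda>x. D x \<or> E x) y" by auto
  then obtain i j where ij: "i + j = k" "ht S lt i D y" "ht S lt j E y" using Suc.IH by blast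
  have "ht S lt i D x" "ht S lt j E x"
    using ht_up[OF ij(2) y(3,1) Suc.prems(2) trans] ht_up[OF ij(3) y(3,1) Suc.prems(2) trans] by blast+
  moreover have "ht S lt (Suc i) D x \<or> ht S lt (Suc j) E x" using y ij by auto
  ultimately show ?case using ij(1) by (metis add_Suc add_Suc_right)
qed simp

text \<open>By pigeonhole, sets without long chains are closed under union. This ideal property
  carries all extension arguments for large types.\<close>

lemma big_disj:
  assumes "big S lt (\<lambda>x. D x \<or> E x)"
    and trans: "trans_lt S lt"
  shows "big S lt D \<or> big S lt E"
proof (rule ccontr)
  assume "\<not> ?thesis"
  then obtain i j where i: "\<And>x. x \<in> S \<Longrightarrow> D x \<Longrightarrow> \<not> ht S lt i D x"
    and j: "\<And>x. x \<in> S \<Longrightarrow> E x \<Longrightarrow> \<not> ht S lt j E x"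
    by (auto simp: big_def)
  \<comment> \<open>One more than each bound: the top of a chain of length \<open>Suc i\<close> in
    \<open>D\<close> is itself a point of \<open>D\<close> of height at least \<open>i\<close>,
    which \<open>i\<close> excludes.\<close>
  obtain x where x: "x \<in> S" "ht S lt (Suc i + Suc j) (\<lambda>x. D x \<or> E x) x"
    using assms(1) unfolding big_def by blast
  obtain i' j' where ij: "i' + j' = Suc i + Suc j" "ht S lt i' D x" "ht S lt j' E x"
    using ht_disj[OF x(2,1) trans] by blast
  have "Suc i \<le> i' \<or> Suc j \<le> j'" using ij(1) by arith
  then show False
  proof
    assume "Suc i \<le> i'"
    then have "ht S lt (Suc i) D x" using ht_mono[OF ij(2)] by blast
    then show False using i by auto
  next
    assume "Suc j \<le> j'"
    then have "ht S lt (Suc j) E x" using ht_mono[OF ij(3)] by blast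
    then show False using j by auto
  qed
qed

text \<open>For fixed \<open>k\<close> the height condition is first-order. The order and
  \<open>D\<close> may depend on the leading \<open>l\<close> entries, because these parameters are
  found by compactness only afterwards.\<close>

lemma (in fo) pd_ht:
  assumes lt: "pd B (l + (n + n)) (\<lambda>z. lt (take l z) (take n (drop l z)) (drop (l + n) z))"
    and D: "pd B (l + n) (\<lambda>z. D (take l z) (drop l z))" and B: "B \<subseteq> univ U"
  shows "pd B (l + n) (\<lambda>z. ht (V n) (lt (take l z)) k (D (take l z)) (drop l z))"
proof (induction k)
  case 0
  show ?case by (simp add: pd_True)
next
  case (Suc k)
  let ?P = "\<lambda>x z. D (take l z) x \<and> lt (take l z) x (drop l z) \<and> ht (V n) (lt (take l z)) k (D (take l z)) x"
  have "pd B (n + (l + n)) (\<lambda>z. D (take l (take l (drop n z) @ take n z)) (drop l (take l (drop n z) @ take n z)))"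
    by (rule pd_sel[OF D]) (auto intro!: sel_intros B)
  moreover have "pd B (n + (l + n)) (\<lambda>z.
      lt (take l (take l (drop n z) @ take n z @ drop (n + l) z))
        (take n (drop l (take l (drop n z) @ take n z @ drop (n + l) z)))
        (drop (l + n) (take l (drop n z) @ take n z @ drop (n + l) z)))"
    by (rule pd_sel[OF lt]) (auto intro!: sel_intros B)
  moreover have "pd B (n + (l + n)) (\<lambda>z. ht (V n) (lt (take l (take l (drop n z) @ take n z))) k
      (D (take l (take l (drop n z) @ take n z))) (drop l (take l (drop n z) @ take n z)))"
    by (rule pd_sel[OF Suc]) (auto intro!: sel_intros B)
  ultimately have "pd B (n + (l + n)) (\<lambda>z. ?P (take n z) (drop n z))"
    by - (rule pd_cong[OF pd_conj[OF _ pd_conj]], assumption+, simp add: tuples_def add.commute)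
  then have "pd B (l + n) (\<lambda>z. \<exists>x\<in>V n. ?P x z)" by (rule pd_ex)
  then show ?case by simp
qed

section \<open>A definable order on an unstable type\<close>

text \<open>Bubble sort, used contrapositively: if sorted patterns have \<open>Q\<close> and some
  pattern lacks it, then exchanging an adjacent pair False, True destroys \<open>Q\<close>
  somewhere.\<close>

lemma sort_by_swaps:
  assumes swap: "\<And>u w. Q (u @ [False, True] @ w) \<Longrightarrow> Q (u @ [True, False] @ w)"
    and sorted: "\<And>k l. Q (replicate k False @ replicate l True)"
  shows "Q xs"
proof -
  have move: "Q (u @ replicate k False @ True # w) \<Longrightarrow> Q (u @ True # replicate k False @ w)" for u k w
  proof (induction k arbitrary: w)
    case (Suc k)
    have "Q ((u @ replicate k False) @ [False, True] @ w)"
      using Suc.prems by (simp add: replicate_app_Cons_same)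
    from swap[OF this] have "Q (u @ replicate k False @ True # False # w)" by simp
    from Suc.IH[OF this] have "Q (u @ True # replicate k False @ False # w)" by simp
    then show ?case by (simp add: replicate_app_Cons_same)
  qed simp
  have "Q (u @ replicate (count_list xs False) False @ replicate (count_list xs True) True) \<Longrightarrow> Q (u @ xs)" for u
  proof (induction xs arbitrary: u)
    case (Cons x xs)
    show ?case
    proof (cases x)
      case True
      then have "Q (u @ True # replicate (count_list xs False) False @ replicate (count_list xs True) True)"
        using move Cons.prems by simp
      then show ?thesis using Cons.IH[of "u @ [True]"] True by simp
    next
      case False
      then show ?thesis using Cons.IH[of "u @ [False]"] Cons.prems by simp
    qed
  qed simp
  from this[of "[]"] show ?thesis using sorted by simp
qed

context monster begin

text \<open>The last entry of a coheir sequence is replaced first, by some \<open>a i\<close>, and the earlier entries then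
  by \<open>a j\<close> with larger \<open>j\<close>; so the sequence looks like a decreasing one.\<close>

lemma generic_seq_decreasing:
  assumes "ultrafilter (range a) r" "range a \<subseteq> tuples D n" "D \<subseteq> univ U" "generic_seq n (range a) r D bs"
    "\<And>i :: nat. a ` {i..} \<in> r" "pd D (N * n) P"
    "\<And>is. length is = N \<Longrightarrow> sorted_wrt (>) is \<Longrightarrow> \<forall>i\<in>set is. K \<le> i \<Longrightarrow> P (concat (map a is))"
  shows "P (concat (map bs [0..<N]))"
  using assms(6,7)
proof (induction N arbitrary: P K)
  case (Suc N)
  have P: "pd D (N * n + n) P" using Suc.prems(1) by (simp add: add.commute)
  have "P (concat (map bs ([0..<N] @ [N]))) \<longleftrightarrow> ev (range a) r (\<lambda>y. P (concat (map bs [0..<N]) @ y))"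
    by (rule generic_seq_last[OF assms(1-4) P]) (auto simp: sorted_wrt_append)
  moreover have "ev (range a) r (\<lambda>y. P (concat (map bs [0..<N]) @ y))"
  proof (rule ev_mono[OF assms(1)])
    have "{x \<in> range a. x \<in> a ` {K..}} = a ` {K..}" by auto
    then show "ev (range a) r (\<lambda>y. y \<in> a ` {K..})" using assms(5)[of K] by (simp add: ev_def)
    fix y assume "y \<in> a ` {K..}"
    then obtain j where j: "y = a j" "K \<le> j" by auto
    have y: "y \<in> tuples D n" using assms(2) j by auto
    show "P (concat (map bs [0..<N]) @ y)"
    proof (rule Suc.IH[where K = "Suc j"])
      show "pd D (N * n) (\<lambda>z. P (z @ y))"
        using y by (intro pd_sel[OF P] sel_intros assms(3)) (auto simp: tuples_def)
      fix "is" assume "is": "length is = N" "sorted_wrt (>) is" "\<forall>i\<in>set is. Suc j \<le> i"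
      have "P (concat (map a (is @ [j])))"
        using "is" j(2) by (intro Suc.prems(2)) (auto simp: sorted_wrt_append dest: Suc_le_lessD)
      then show "P (concat (map a is) @ y)" using j by simp
    qed
  qed
  ultimately show ?case by simp
next
  case 0
  have "P (concat (map a []))" by (rule "0.prems"(2)) auto
  then show ?case by simp
qed

text \<open>Replaces the witnesses of instability by an indiscernible sequence that still satisfies
  \<open>p\<close>. The cut patterns come out with the inequality reversed, since a generic sequence
  imitates decreasing sequences of indices.\<close>

lemma unstable_generic:
  assumes "small M" "p \<subseteq> formulas_over L n M" "\<phi> \<in> fms L (n + m)"
    "\<And>i :: nat. realizes U n (a i) p" "\<And>i :: nat. b i \<in> V m"
    "\<And>i j. holds U \<phi> (a i @ b j) \<longleftrightarrow> i \<le> j"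
  shows "\<exists>T r D bs. ultrafilter T r \<and> T \<subseteq> tuples D n \<and> small D \<and> M \<subseteq> D \<and> generic_seq n T r D bs \<and>
    (\<forall>i. \<forall>(\<theta>, d)\<in>p. holds U \<theta> (bs i @ d)) \<and>
    (\<forall>N k. \<exists>y\<in>V m. \<forall>l<N. holds U \<phi> (bs l @ y) \<longleftrightarrow> k \<le> l)"
proof -
  define D where "D = M \<union> (\<Union>i. set (a i))"
  have a: "a i \<in> V n" for i using assms(4) by (simp add: realizes_def)
  have D: "small D" unfolding D_def
    using a by (intro small_Un assms(1) small_countable) (auto simp: tuples_def)
  then have DU: "D \<subseteq> univ U" by (simp add: small_subset_def)
  have T: "range a \<subseteq> tuples D n" using a by (auto simp: D_def tuples_def)
  \<comment> \<open>Tails are put into the ultrafilter so that an index beyond any given one can be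
    chosen at each step.\<close>
  obtain r where r: "ultrafilter (range a) r" "range (\<lambda>i. a ` {i..}) \<subseteq> r"
  proof (rule ultrafilter_extend[of "range (\<lambda>i. a ` {i..})" "range a"])
    fix H assume H: "finite H" "H \<subseteq> range (\<lambda>i. a ` {i..})"
    then obtain J where J: "finite J" "H = (\<lambda>i. a ` {i..}) ` J"
      using finite_subset_image[of H "\<lambda>i. a ` {i..}" UNIV] by blast
    obtain N where "\<forall>j\<in>J. j < N" using J(1) finite_nat_set_iff_bounded[of J] by blast
    then have "a N \<in> range a \<inter> \<Inter>H" using J(2) by (auto intro: imageI less_imp_le)
    then show "range a \<inter> \<Inter>H \<noteq> {}" by blast
  qed auto
  have "range a \<subseteq> V n" using a by auto
  then obtain bs where bs: "generic_seq n (range a) r D bs" by (rule generic_seq_exists[OF r(1) _ D])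
  have bV: "bs i \<in> V n" for i by (rule generic_seq_in[OF bs])
  have "holds U \<theta> (bs i @ d)" if "(\<theta>, d) \<in> p" for i \<theta> d
  proof -
    have "(\<theta>, d) \<in> formulas_over L n D" using that assms(2) by (fastforce simp: formulas_over_def D_def)
    then have "pd (D \<union> (\<Union>j<i. set (bs j))) n (\<lambda>x. holds U \<theta> (x @ d))"
      by (rule pd_mono[OF pd_over]) auto
    moreover have "ev (range a) r (\<lambda>x. holds U \<theta> (x @ d))"
      using assms(4) that by (intro ev_True[OF r(1)]) (auto simp: realizes_def)
    ultimately show ?thesis using bs by (auto simp: generic_seq_def generic_def)
  qed
  moreover have "\<exists>y\<in>V m. \<forall>l<N. holds U \<phi> (bs l @ y) \<longleftrightarrow> k \<le> l" for N k
  proof -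
    define P where "P z \<longleftrightarrow> (\<exists>y\<in>V m. \<forall>l\<in>{..<N}. holds U \<phi> (take n (drop (l * n) z) @ y) \<longleftrightarrow> k \<le> l)" for z
    have le: "l * n + n \<le> N * n" if "l < N" for l
    proof -
      have "Suc l * n \<le> N * n" using that by (intro mult_le_mono1) simp
      then show ?thesis by simp
    qed
    have "pd D (m + N * n) (\<lambda>z. holds U \<phi> (take n (drop (l * n) (drop m z)) @ take m z))" if "l < N" for l
      by (rule pd_holds[OF assms(3)]) (use le[OF that] in \<open>auto intro!: sel_intros\<close>)
    then have "pd D (N * n) P"
      unfolding P_def by (intro pd_ex pd_ball_finite pd_iff[OF _ pd_const]) auto
    have "P (concat (map bs [0..<N]))"
    proof (rule generic_seq_decreasing[OF r(1) T DU bs, where K = 1])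
      show "pd D (N * n) P" by fact
      show "a ` {i..} \<in> r" for i using r(2) by auto
      fix "is" :: "nat list" assume "is": "length is = N" "sorted_wrt (>) is" "\<forall>i\<in>set is. 1 \<le> i"
      have blk: "take n (drop (l * n) (concat (map a is))) = a (is ! l)" if "l < N" for l
        using take_drop_concat[of "map a is" n l] a that "is"(1) by (simp add: tuples_def)
      \<comment> \<open>If the cut \<open>k\<close> lies beyond the block, every instance must fail.
        Index 0 serves then, since the choice \<open>K = 1\<close> keeps all entries of the sequence
        of indices positive.\<close>
      define j where "j = (if k < N then is ! k else 0)"
      have "is ! l \<le> j \<longleftrightarrow> k \<le> l" if l: "l < N" for l
      proof (cases "k < N")
        case True
        have "k < l \<Longrightarrow> is ! l < is ! k" "l < k \<Longrightarrow> is ! k < is ! l"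
          using "is"(1,2) l True by (simp_all add: sorted_wrt_iff_nth_less)
        then show ?thesis using True by (cases k l rule: linorder_cases) (auto simp: j_def)
      next
        case False
        have "1 \<le> is ! l" using "is"(1,3) l nth_mem by blast
        then show ?thesis using False l by (auto simp: j_def)
      qed
      then have "\<forall>l\<in>{..<N}. holds U \<phi> (take n (drop (l * n) (concat (map a is))) @ b j) \<longleftrightarrow> k \<le> l"
        using blk assms(6) by simp
      then show "P (concat (map a is))" unfolding P_def using assms(5) by blast
    qed
    moreover have "take n (drop (l * n) (concat (map bs [0..<N]))) = bs l" if "l < N" for l
      using take_drop_concat[of "map bs [0..<N]" n l] bV that by (simp add: tuples_def)
    ultimately show ?thesis by (simp add: P_def Ball_def)
  qed
  ultimately show ?thesis
    by (intro exI[of _ "range a"] exI[of _ r] exI[of _ D] exI[of _ bs])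
      (use r(1) T D bs in \<open>auto simp: D_def\<close>)
qed

text \<open>NIP makes some pattern on the indiscernible sequence inconsistent. Sorting it, there is a consistent
  pattern \<open>u01w\<close> for which \<open>u10w\<close> is inconsistent. With the entries for \<open>u\<close> and \<open>w\<close> as parameters \<open>c\<close>
  and \<open>X c y\<close> saying that \<open>y\<close> has the pattern \<open>uw\<close> on them, the sets \<open>{y. X c y \<and> \<phi>(x;y)}\<close> strictly
  increase along the sequence; \<open>lt c\<close> compares them by inclusion.\<close>

lemma order_exists:
  assumes nip: "NIP L U" and M: "small M" and p: "p \<subseteq> formulas_over L n M"
    and unst: "\<not> stable_type L U n p"
  obtains C lt where "finite C" "C \<subseteq> univ U" "pd C (n + n) (\<lambda>z. lt (take n z) (drop n z))"
    "\<And>x. \<not> lt x x" "trans_lt (V n) lt"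
    "\<And>p0. finite p0 \<Longrightarrow> p0 \<subseteq> p \<Longrightarrow> big (V n) lt (\<lambda>x. \<forall>(\<theta>, d)\<in>p0. holds U \<theta> (x @ d))"
proof -
  obtain m \<phi> a b where \<phi>: "\<phi> \<in> fms L (n + m)" and ab: "\<And>i :: nat. realizes U n (a i) p" "\<And>i :: nat. b i \<in> V m"
    "\<And>i j. holds U \<phi> (a i @ b j) \<longleftrightarrow> i \<le> j"
    using unst unfolding stable_type_def by blast
  obtain T r D bs where *: "ultrafilter T r \<and> T \<subseteq> tuples D n \<and> small D \<and> M \<subseteq> D \<and> generic_seq n T r D bs \<and>
    (\<forall>i. \<forall>(\<theta>, d)\<in>p. holds U \<theta> (bs i @ d)) \<and>
    (\<forall>N k. \<exists>y\<in>V m. \<forall>l<N. holds U \<phi> (bs l @ y) \<longleftrightarrow> k \<le> l)"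
    using unstable_generic[OF M p \<phi> ab] by (elim exE)
  then have bs: "ultrafilter T r" "T \<subseteq> tuples D n" "small D" "M \<subseteq> D" "generic_seq n T r D bs"
    and bs_p: "\<And>i \<theta> d. (\<theta>, d) \<in> p \<Longrightarrow> holds U \<theta> (bs i @ d)"
    by fast+
  have ord: "\<exists>y\<in>V m. \<forall>l<N. holds U \<phi> (bs l @ y) \<longleftrightarrow> k \<le> l" for N k
    using * by simp
  have DU: "D \<subseteq> univ U" using bs(3) by (simp add: small_subset_def)
  have MU: "M \<subseteq> univ U" using M by (simp add: small_subset_def)
  have bV: "bs i \<in> V n" for i by (rule generic_seq_in[OF bs(5)])
  define cons where "cons is xs \<longleftrightarrow> (\<exists>y\<in>V m. list_all2 (\<lambda>i v. holds U \<phi> (bs i @ y) \<longleftrightarrow> v) is xs)" for "is" xs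
  have le: "l * n + n \<le> N * n" if "l < N" for l N
  proof -
    have "Suc l * n \<le> N * n" using that by (intro mult_le_mono1) simp
    then show ?thesis by simp
  qed
  have blk: "take n (drop (l * n) (concat (map bs is))) = bs (is ! l)" if "l < length is" for l "is"
    using take_drop_concat[of "map bs is" n l] bV that by (simp add: tuples_def)
  have indisc: "cons is xs \<longleftrightarrow> cons [0..<length xs] xs" if "is": "sorted_wrt (<) is" "length is = length xs" for "is" xs
  proof -
    let ?N = "length xs"
    define P where "P z \<longleftrightarrow> (\<exists>y\<in>V m. \<forall>l\<in>{..<?N}. holds U \<phi> (take n (drop (l * n) z) @ y) \<longleftrightarrow> xs ! l)" for z
    have "pd D (m + ?N * n) (\<lambda>z. holds U \<phi> (take n (drop (l * n) (drop m z)) @ take m z))" if "l < ?N" for l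
      by (rule pd_holds[OF \<phi>]) (use le[OF that] in \<open>auto intro!: sel_intros\<close>)
    then have "pd D (?N * n) P"
      unfolding P_def by (intro pd_ex pd_ball_finite pd_iff[OF _ pd_const]) auto
    then have "P (concat (map bs is)) \<longleftrightarrow> P (concat (map bs [0..<?N]))"
      using generic_seq_indisc[OF bs(1,2) DU bs(5)] "is" by blast
    moreover have "P (concat (map bs js)) \<longleftrightarrow> cons js xs" if "length js = ?N" for js
      using blk[of _ js] that by (simp add: P_def cons_def list_all2_conv_all_nth Ball_def)
    ultimately show ?thesis using "is"(2) by simp
  qed
  obtain N \<eta> where "\<not> (\<exists>y\<in>V m. \<forall>i<N. holds U \<phi> (bs i @ y) \<longleftrightarrow> \<eta> i)"
    using nip_pattern[of \<phi> n m bs, OF nip \<phi> bV] by (elim exE)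
  then have "\<not> cons [0..<length (map \<eta> [0..<N])] (map \<eta> [0..<N])"
    by (simp add: cons_def list_all2_conv_all_nth)
  moreover have "cons [0..<length (replicate k False @ replicate l True)] (replicate k False @ replicate l True)" for k l
  proof -
    obtain y where "y \<in> V m" "\<forall>i<k + l. holds U \<phi> (bs i @ y) \<longleftrightarrow> k \<le> i"
      using ord[of "k + l" k] by (elim bexE)
    then show ?thesis unfolding cons_def
      by (intro bexI[of _ y]) (auto simp: list_all2_conv_all_nth nth_append)
  qed
  \<comment> \<open>The contrapositive of \<open>sort_by_swaps\<close>, applied to the sorted
    patterns, which are consistent, and to \<open>\<eta>\<close>, which is not.\<close>
  ultimately obtain u w where uw: "cons [0..<length (u @ [False, True] @ w)] (u @ [False, True] @ w)"
    "\<not> cons [0..<length (u @ [True, False] @ w)] (u @ [True, False] @ w)"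
    using sort_by_swaps[of "\<lambda>xs. cons [0..<length xs] xs"] by meson
  define s where "s = length u"
  define t where "t = length w"
  define l where "l = (s + t) * n"
  note s_t_l_def = s_def t_def l_def
  define X where "X c y \<longleftrightarrow> (\<forall>i\<in>{..<s + t}. holds U \<phi> (take n (drop (i * n) c) @ y) \<longleftrightarrow> (u @ w) ! i)" for c y
  define E where "E c x x' \<longleftrightarrow> (\<exists>y\<in>V m. X c y \<and> \<not> holds U \<phi> (x @ y) \<and> holds U \<phi> (x' @ y))" for c x x'
  \<comment> \<open>\<open>E c x x'\<close> denies the inclusion of the set of \<open>x'\<close> in
    that of \<open>x\<close>, so this is the strict part of a preorder; irreflexivity and
    transitivity come for free.\<close>
  define lt where "lt c x x' \<longleftrightarrow> E c x x' \<and> \<not> E c x' x" for c x x'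
  have "pd {} (m + (l + (n + n))) (\<lambda>z. holds U \<phi> (take n (drop (i * n) (take l (drop m z))) @ take m z))" if "i < s + t" for i
    by (rule pd_holds[OF \<phi>]) (use le[OF that] in \<open>auto intro!: sel_intros simp: l_def\<close>)
  then have pX: "pd {} (m + (l + (n + n))) (\<lambda>z. X (take l (drop m z)) (take m z))"
    unfolding X_def by (intro pd_ball_finite pd_iff[OF _ pd_const]) auto
  have pE: "pd {} (l + (n + n)) (\<lambda>z. E (take l z) (take n (drop l z)) (drop (l + n) z))"
    unfolding E_def
    by (intro pd_ex pd_conj pd_not pX pd_holds[OF \<phi>] sel_intros) auto
  have "pd {} (l + (n + n)) (\<lambda>z. E (take l (take l z @ drop (l + n) z @ take n (drop l z)))
      (take n (drop l (take l z @ drop (l + n) z @ take n (drop l z))))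
      (drop (l + n) (take l z @ drop (l + n) z @ take n (drop l z))))"
    by (rule pd_sel[OF pE]) (auto intro!: sel_intros)
  then have "pd {} (l + (n + n)) (\<lambda>z. E (take l z) (drop (l + n) z) (take n (drop l z)))"
    by (rule pd_cong) (simp add: tuples_def)
  then have plt: "pd {} (l + (n + n)) (\<lambda>z. lt (take l z) (take n (drop l z)) (drop (l + n) z))"
    unfolding lt_def by (intro pd_conj pE pd_not)
  have trans: "trans_lt (V n) (lt c)" for c
    unfolding trans_lt_def lt_def E_def by blast
  have irrefl: "\<not> lt c x x" for c x by (simp add: lt_def)
  \<comment> \<open>The parameters for \<open>u\<close> and \<open>w\<close> are taken on both sides
    of a gap of \<open>K\<close> places. Any \<open>i < j\<close> in the gap complete them to an
    increasing index list, on which indiscernibility decides both patterns.\<close>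
  have chain: "lt (concat (map bs ([0..<s] @ [s + K..<s + K + t]))) (bs i) (bs j)"
    if ij: "s \<le> i" "i < j" "j < s + K" for K i j
  proof -
    let ?iu = "[0..<s]" and ?iw = "[s + K..<s + K + t]"
    let ?c = "concat (map bs (?iu @ ?iw))"
    have X: "X ?c y \<longleftrightarrow> list_all2 (\<lambda>i v. holds U \<phi> (bs i @ y) \<longleftrightarrow> v) ?iu u \<and>
        list_all2 (\<lambda>i v. holds U \<phi> (bs i @ y) \<longleftrightarrow> v) ?iw w" for y
    proof -
      have "X ?c y \<longleftrightarrow> list_all2 (\<lambda>i v. holds U \<phi> (bs i @ y) \<longleftrightarrow> v) (?iu @ ?iw) (u @ w)"
        using blk[of _ "?iu @ ?iw"] unfolding X_def list_all2_conv_all_nth by (simp add: s_t_l_def Ball_def)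
      then show ?thesis by (simp add: list_all2_append s_t_l_def)
    qed
    have c: "cons (?iu @ [i, j] @ ?iw) (u @ [v, v'] @ w) \<longleftrightarrow>
        (\<exists>y\<in>V m. X ?c y \<and> (holds U \<phi> (bs i @ y) \<longleftrightarrow> v) \<and> (holds U \<phi> (bs j @ y) \<longleftrightarrow> v'))" for v v'
      unfolding X cons_def by (intro bex_cong refl) (auto simp: list_all2_append s_t_l_def)
    have i: "cons (?iu @ [i, j] @ ?iw) (u @ [v, v'] @ w) \<longleftrightarrow>
        cons [0..<length (u @ [v, v'] @ w)] (u @ [v, v'] @ w)" for v v'
      by (rule indisc) (use ij in \<open>auto simp: sorted_wrt_append s_t_l_def\<close>)
    have "E ?c (bs i) (bs j)" using uw(1) i[of False True] c[of False True] by (auto simp: E_def)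
    moreover have "\<not> E ?c (bs j) (bs i)" using uw(2) i[of True False] c[of True False] by (auto simp: E_def)
    ultimately show ?thesis by (simp add: lt_def)
  qed
  define Dp where "Dp p0 x \<longleftrightarrow> (\<forall>(\<theta>, d)\<in>p0. holds U \<theta> (x @ d))" for p0 x
  define Q where "Q p0 k c \<longleftrightarrow> (\<exists>x\<in>V n. Dp p0 x \<and> ht (V n) (lt c) k (Dp p0) x)" for p0 k c
  have pQ: "pd M l (Q p0 k)" if p0: "finite p0" "p0 \<subseteq> p" for p0 k
  proof -
    have "pd M n (\<lambda>x. \<forall>q\<in>p0. holds U (fst q) (x @ snd q))"
      using p0 p by (intro pd_ball_finite pd_over) auto
    then have pD: "pd M n (Dp p0)" unfolding Dp_def by (rule pd_cong) auto
    have "pd M (l + n) (\<lambda>z. Dp p0 (drop l z))"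
      by (rule pd_sel[OF pD]) (auto intro!: sel_intros MU)
    then have h: "pd M (l + n) (\<lambda>z. ht (V n) (lt (take l z)) k (Dp p0) (drop l z))"
      using pd_ht[OF pd_mono[OF plt] _ MU, of "\<lambda>_. Dp p0" k] by simp
    have "pd M (n + l) (\<lambda>z. ht (V n) (lt (take l (drop n z @ take n z))) k (Dp p0) (drop l (drop n z @ take n z)))"
      by (rule pd_sel[OF h]) (auto intro!: sel_intros MU)
    then have "pd M (n + l) (\<lambda>z. ht (V n) (lt (drop n z)) k (Dp p0) (take n z))"
      by (rule pd_cong) (simp add: tuples_def)
    moreover have "pd M (n + l) (\<lambda>z. Dp p0 (take n z))"
      by (rule pd_sel[OF pD]) (auto intro!: sel_intros MU)
    ultimately show ?thesis unfolding Q_def by (intro pd_ex pd_conj)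
  qed
  \<comment> \<open>The gap, and with it \<open>c\<close>, depends on \<open>K\<close>; compactness
    produces one \<open>c\<close> for all finite parts of \<open>p\<close> and all chain
    lengths.\<close>
  have "\<exists>c\<in>V l. \<forall>P\<in>(\<lambda>(p0, k). Q p0 k) ` ({p0. finite p0 \<and> p0 \<subseteq> p} \<times> UNIV). P c"
  proof (rule realize[OF M])
    fix PP assume "finite PP" "PP \<subseteq> (\<lambda>(p0, k). Q p0 k) ` ({p0. finite p0 \<and> p0 \<subseteq> p} \<times> UNIV)"
    then obtain J where J: "finite J" "J \<subseteq> {p0. finite p0 \<and> p0 \<subseteq> p} \<times> UNIV" "PP = (\<lambda>(p0, k). Q p0 k) ` J"
      by (rule finite_subset_image[elim_format]) auto
    obtain K where K: "\<forall>k\<in>snd ` J. k < K" using J(1) finite_nat_set_iff_bounded[of "snd ` J"] by blast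
    let ?c = "concat (map bs ([0..<s] @ [s + K..<s + K + t]))"
    have "?c \<in> V l"
      using length_concat_const[of "map bs ([0..<s] @ [s + K..<s + K + t])" n] bV
      by (auto simp: tuples_def s_t_l_def)
    moreover have "Q p0 k ?c" if "(p0, k) \<in> J" for p0 k
    proof -
      have "p0 \<subseteq> p" using that J(2) by blast
      then have D: "Dp p0 (bs i)" for i using bs_p by (auto simp: Dp_def)
      have "i < K \<Longrightarrow> ht (V n) (lt ?c) i (Dp p0) (bs (s + i))" for i
      proof (induction i)
        case (Suc i)
        then have "lt ?c (bs (s + i)) (bs (s + Suc i))" by (intro chain) auto
        then show ?case using Suc D bV by auto
      qed simp
      moreover have "k < K" using K that by force
      ultimately show ?thesis unfolding Q_def using D bV by blast
    qed
    ultimately show "\<exists>c\<in>V l. \<forall>P\<in>PP. P c" using J(3) by (intro bexI[of _ ?c]) auto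
  qed (use pQ in auto)
  then obtain c where c: "c \<in> V l" "\<And>p0 k. finite p0 \<Longrightarrow> p0 \<subseteq> p \<Longrightarrow> Q p0 k c" by auto
  show ?thesis
  proof (rule that)
    show "finite (set c)" "set c \<subseteq> univ U" using c(1) by (auto simp: tuples_def)
    have "pd (set c) (n + n) (\<lambda>z. lt (take l (c @ z)) (take n (drop l (c @ z))) (drop (l + n) (c @ z)))"
      by (rule pd_sel[OF pd_mono[OF plt]]) (use c(1) in \<open>auto intro!: sel_intros simp: tuples_def\<close>)
    then show "pd (set c) (n + n) (\<lambda>z. lt c (take n z) (drop n z))"
      by (rule pd_cong) (use c(1) in \<open>simp add: tuples_def\<close>)
    show "\<not> lt c x x" for x by (rule irrefl)
    show "trans_lt (V n) (lt c)" by (rule trans)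
    show "big (V n) (lt c) (\<lambda>x. \<forall>(\<theta>, d)\<in>p0. holds U \<theta> (x @ d))" if "finite p0" "p0 \<subseteq> p" for p0
      using c(2)[OF that] unfolding big_def Q_def Dp_def by blast
  qed
qed

end

section \<open>Large types\<close>

lemma ht_below:
  assumes "ht S lt k D x" "x \<in> S" "trans_lt S lt"
  shows "ht S lt k (\<lambda>y. D y \<and> lt y x) x"
  using assms(1,2)
proof (induction k arbitrary: x)
  case (Suc k)
  then obtain y where y: "y \<in> S" "D y" "lt y x" "ht S lt k D y" by auto
  have "ht S lt k (\<lambda>z. D z \<and> lt z y) y" by (rule Suc.IH[OF y(4,1)])
  then have "ht S lt k (\<lambda>z. D z \<and> lt z x) y"
  proof (rule ht_mono)
    fix z assume "z \<in> S" "D z \<and> lt z y"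
    then show "D z \<and> lt z x" using y(1,3) Suc.prems(2) assms(3) unfolding trans_lt_def by blast
  qed simp
  then show ?case using y by auto
qed simp

text \<open>Giving up the lowest member leaves \<open>k\<close> members above it. Together with
  \<open>ht_below\<close> this moves a long chain into an open interval, as \<open>interval\<close>
  requires.\<close>

lemma ht_bottom:
  assumes "ht S lt (Suc k) D x" "x \<in> S" "trans_lt S lt"
  shows "\<exists>c\<in>S. D c \<and> lt c x \<and> ht S lt k (\<lambda>y. D y \<and> lt c y) x"
  using assms(1,2)
proof (induction k arbitrary: x)
  case (Suc k)
  then obtain y where y: "y \<in> S" "D y" "lt y x" "ht S lt (Suc k) D y" by auto
  obtain c where c: "c \<in> S" "D c" "lt c y" "ht S lt k (\<lambda>z. D z \<and> lt c z) y"
    using Suc.IH[OF y(4,1)] by blast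
  have "lt c x" using c(1,3) y(1,3) Suc.prems(2) assms(3) unfolding trans_lt_def by blast
  then show ?case using c y by auto
qed auto

locale ordered = monster L U \<kappa> for L :: "('f, 'r) lang" and U :: "('f, 'r, 'u) fo_struct" and \<kappa> :: "'k rel" +
  fixes n :: nat and C :: "'u set" and lt :: "'u list \<Rightarrow> 'u list \<Rightarrow> bool"
  assumes nip: "NIP L U" and C: "finite C" "C \<subseteq> univ U"
    and pd_lt: "pd C (n + n) (\<lambda>z. lt (take n z) (drop n z))"
    and irrefl: "\<not> lt x x" and trans: "trans_lt (V n) lt"
begin

abbreviation "Big \<equiv> big (V n) lt"
abbreviation "Ht \<equiv> ht (V n) lt"

definition large :: "('u list \<Rightarrow> bool) set \<Rightarrow> bool" where
  "large F \<longleftrightarrow> (\<forall>H. finite H \<longrightarrow> H \<subseteq> F \<longrightarrow> Big (\<lambda>x. \<forall>P\<in>H. P x))"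

definition tpp :: "'u list \<Rightarrow> 'u set \<Rightarrow> ('u list \<Rightarrow> bool) set" where
  "tpp a B = {P. pd B n P \<and> P a}"

lemma largeD: "large F \<Longrightarrow> finite H \<Longrightarrow> H \<subseteq> F \<Longrightarrow> Big (\<lambda>x. \<forall>P\<in>H. P x)"
  by (simp add: large_def)

lemma large_mono: "large F \<Longrightarrow> F' \<subseteq> F \<Longrightarrow> large F'"
  unfolding large_def by (meson order_trans)

lemma large_equiv:
  assumes "large F" "\<And>P. P \<in> F' \<Longrightarrow> \<exists>P'\<in>F. \<forall>x\<in>V n. P' x \<longrightarrow> P x" shows "large F'"
  unfolding large_def
proof (intro allI impI)
  fix H assume H: "finite H" "H \<subseteq> F'"
  then have "\<forall>P\<in>H. \<exists>P'. P' \<in> F \<and> (\<forall>x\<in>V n. P' x \<longrightarrow> P x)" using assms(2) by blast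
  from bchoice[OF this] obtain f where f: "\<forall>P\<in>H. f P \<in> F \<and> (\<forall>x\<in>V n. f P x \<longrightarrow> P x)" by blast
  have "Big (\<lambda>x. \<forall>P\<in>f ` H. P x)" using H f by (intro largeD[OF assms(1)]) auto
  then show "Big (\<lambda>x. \<forall>P\<in>H. P x)" by (rule big_mono) (use f in auto)
qed

lemma not_large_insert:
  assumes "\<not> large (insert P F)"
  shows "\<exists>H. finite H \<and> H \<subseteq> F \<and> \<not> Big (\<lambda>x. (\<forall>Q\<in>H. Q x) \<and> P x)"
proof -
  obtain K where K: "finite K" "K \<subseteq> insert P F" "\<not> Big (\<lambda>x. \<forall>Q\<in>K. Q x)"
    using assms unfolding large_def by blast
  have "\<not> Big (\<lambda>x. (\<forall>Q\<in>K - {P}. Q x) \<and> P x)"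
    using K(3) big_mono[of "V n" lt "\<lambda>x. (\<forall>Q\<in>K - {P}. Q x) \<and> P x" "\<lambda>x. \<forall>Q\<in>K. Q x"] by blast
  then show ?thesis using K(1,2) by (intro exI[of _ "K - {P}"]) auto
qed

lemma large_dichotomy:
  assumes "large F" shows "large (insert P F) \<or> large (insert (\<lambda>x. \<not> P x) F)"
proof (rule ccontr)
  assume "\<not> ?thesis"
  then have "\<not> large (insert P F)" "\<not> large (insert (\<lambda>x. \<not> P x) F)" by auto
  from not_large_insert[OF this(1)] not_large_insert[OF this(2)]
  obtain H K where H: "finite H" "H \<subseteq> F" "\<not> Big (\<lambda>x. (\<forall>Q\<in>H. Q x) \<and> P x)"
    and K: "finite K" "K \<subseteq> F" "\<not> Big (\<lambda>x. (\<forall>Q\<in>K. Q x) \<and> \<not> P x)"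
    by blast
  have "Big (\<lambda>x. \<forall>Q\<in>H \<union> K. Q x)" using H K by (intro largeD[OF assms]) auto
  then have "Big (\<lambda>x. ((\<forall>Q\<in>H. Q x) \<and> P x) \<or> ((\<forall>Q\<in>K. Q x) \<and> \<not> P x))"
    by (rule big_mono) auto
  from big_disj[OF this trans] H(3) K(3) show False by blast
qed

lemma Big_ex: "Big P \<Longrightarrow> \<exists>x\<in>V n. P x"
  unfolding big_def by blast

text \<open>The usual extension to a complete type with largeness in place of consistency. A
  realization \<open>a\<close> of a maximal large family \<open>M\<close> has type exactly
  \<open>M\<close>: a formula true at \<open>a\<close> has its negation outside \<open>M\<close>, so
  the dichotomy admits the formula.\<close>

lemma large_complete:
  assumes "large F" "\<And>P. P \<in> F \<Longrightarrow> pd B n P" "small B"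
  shows "\<exists>a\<in>V n. F \<subseteq> tpp a B \<and> large (tpp a B)"
proof -
  define Q where "Q H \<longleftrightarrow> Big (\<lambda>x. \<forall>P\<in>H. P x)" for H
  define Def where "Def = {P. pd B n P}"
  have anti: "Q H'" if "Q H" "H' \<subseteq> H" for H H'
    using that(1) unfolding Q_def by (rule big_mono) (use that(2) in blast)
  have F: "F \<subseteq> Def" "\<And>H. finite H \<Longrightarrow> H \<subseteq> F \<Longrightarrow> Q H"
    using assms(2) largeD[OF assms(1)] unfolding Def_def Q_def by blast+
  have "\<exists>M. fin_maximal Q F Def M"
    by (rule tukey) (use anti F in auto)
  then obtain M where "fin_maximal Q F Def M" by (elim exE)
  note M0 = this[unfolded fin_maximal_def]
  have M: "F \<subseteq> M" "M \<subseteq> {P. pd B n P}"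
    "\<And>H. finite H \<Longrightarrow> H \<subseteq> M \<Longrightarrow> Big (\<lambda>x. \<forall>P\<in>H. P x)"
    "\<And>P. P \<in> {P. pd B n P} \<Longrightarrow> P \<notin> M \<Longrightarrow> \<exists>H. finite H \<and> H \<subseteq> M \<and> \<not> Big (\<lambda>x. \<forall>P\<in>insert P H. P x)"
    using M0 unfolding Q_def Def_def by blast+
  have lM: "large M" unfolding large_def using M(3) by blast
  have in_M: "P \<in> M" if "pd B n P" "large (insert P M)" for P
  proof (rule ccontr)
    assume "P \<notin> M"
    from M(4)[OF CollectI[of "pd B n", OF that(1)] this]
    obtain H where "finite H \<and> H \<subseteq> M \<and> \<not> Big (\<lambda>x. \<forall>P\<in>insert P H. P x)" by (elim exE)
    then have H: "finite H" "H \<subseteq> M" "\<not> Big (\<lambda>x. \<forall>P\<in>insert P H. P x)" by simp_all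
    have "Big (\<lambda>x. \<forall>P\<in>insert P H. P x)" using H by (intro largeD[OF that(2)]) auto
    then show False using H(3) by contradiction
  qed
  have "\<exists>a\<in>V n. \<forall>P\<in>M. P a"
  proof (rule realize[OF assms(3)])
    show "pd B n P" if "P \<in> M" for P using that M(2) by blast
    fix H assume "finite H" "H \<subseteq> M"
    then show "\<exists>a\<in>V n. \<forall>P\<in>H. P a" using Big_ex[OF M(3)] by blast
  qed
  then obtain a where a: "a \<in> V n" "\<And>P. P \<in> M \<Longrightarrow> P a" by blast
  have "tpp a B \<subseteq> M"
  proof
    fix P assume "P \<in> tpp a B"
    then have P: "pd B n P" "P a" by (auto simp: tpp_def)
    have "(\<lambda>x. \<not> P x) \<notin> M" using a(2)[of "\<lambda>x. \<not> P x"] P(2) by blast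
    then have "\<not> large (insert (\<lambda>x. \<not> P x) M)" using in_M[OF pd_not[OF P(1)]] by blast
    then have "large (insert P M)" using large_dichotomy[OF lM, of P] by blast
    then show "P \<in> M" by (rule in_M[OF P(1)])
  qed
  then have "large (tpp a B)" using lM large_mono by blast
  moreover have "F \<subseteq> tpp a B" using M(1,2) a(2) by (auto simp: tpp_def)
  ultimately show ?thesis using a(1) by blast
qed

lemma pd_lt_sel:
  assumes "sel B k S" "sel B k S'" "\<And>z. length z = k \<Longrightarrow> length (S z) = n"
    "\<And>z. length z = k \<Longrightarrow> length (S' z) = n" "C \<subseteq> B" "B \<subseteq> univ U"
  shows "pd B k (\<lambda>z. lt (S z) (S' z))"
proof -
  have "pd B k (\<lambda>z. lt (take n (S z @ S' z)) (drop n (S z @ S' z)))"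
    by (rule pd_sel[OF pd_mono[OF pd_lt assms(5)]]) (use assms in \<open>auto intro!: sel_append\<close>)
  then show ?thesis by (rule pd_cong) (use assms(3,4) in \<open>simp add: tuples_def\<close>)
qed

lemma pd_Ht:
  assumes D: "pd B (l + n) (\<lambda>z. D (take l z) (drop l z))" and B: "C \<subseteq> B" "B \<subseteq> univ U"
  shows "pd B (l + n) (\<lambda>z. Ht k (D (take l z)) (drop l z))"
proof (rule pd_ht[OF _ D B(2), of "\<lambda>_. lt"])
  show "pd B (l + (n + n)) (\<lambda>z. lt (take n (drop l z)) (drop (l + n) z))"
    by (rule pd_lt_sel) (auto intro!: sel_intros B)
qed

lemma pd_chain:
  assumes D: "pd B (l + n) (\<lambda>z. D (take l z) (drop l z))" and B: "C \<subseteq> B" "B \<subseteq> univ U"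
  shows "pd B l (\<lambda>e. \<exists>x\<in>V n. D e x \<and> Ht k (D e) x)"
proof -
  have "pd B (l + n) (\<lambda>z. D (take l z) (drop l z) \<and> Ht k (D (take l z)) (drop l z))"
    by (intro pd_conj D pd_Ht B)
  then have "pd B (n + l) (\<lambda>z. D (take l (drop n z @ take n z)) (drop l (drop n z @ take n z)) \<and>
      Ht k (D (take l (drop n z @ take n z))) (drop l (drop n z @ take n z)))"
    by (rule pd_sel) (auto intro!: sel_intros B(2))
  then have "pd B (n + l) (\<lambda>z. D (drop n z) (take n z) \<and> Ht k (D (drop n z)) (take n z))"
    by (rule pd_cong) (simp add: tuples_def)
  then show ?thesis by (rule pd_ex)
qed

text \<open>Compactness with the pair \<open>e\<close> of endpoints as unknown: a long chain in a
  finite part of the type supplies both ends and a long chain between them.\<close>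

lemma interval:
  assumes "large (tpp a B)" "small B" "C \<subseteq> B"
  shows "\<exists>c\<in>V n. \<exists>c'\<in>V n. tpp a B \<subseteq> tpp c B \<and> tpp a B \<subseteq> tpp c' B \<and>
    large (insert (\<lambda>x. lt c x \<and> lt x c') (tpp a B))"
proof -
  have BU: "B \<subseteq> univ U" using assms(2) by (simp add: small_subset_def)
  define D where "D H e x \<longleftrightarrow> (\<forall>P\<in>H. P x) \<and> lt (take n e) x \<and> lt x (drop n e)" for H e x
  define R where "R H k e \<longleftrightarrow> (\<forall>P\<in>H. P (take n e)) \<and> (\<forall>P\<in>H. P (drop n e)) \<and> (\<exists>x\<in>V n. D H e x \<and> Ht k (D H e) x)"
    for H k e
  let ?I = "{H. finite H \<and> H \<subseteq> tpp a B} \<times> (UNIV :: nat set)"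
  have pH: "pd B n (\<lambda>x. \<forall>P\<in>H. P x)" if "finite H" "H \<subseteq> tpp a B" for H
    using that by (intro pd_ball_finite) (auto simp: tpp_def)
  have "\<exists>e\<in>V (n + n). \<forall>P\<in>(\<lambda>(H, k). R H k) ` ?I. P e"
  proof (rule realize[OF assms(2)])
    fix P assume "P \<in> (\<lambda>(H, k). R H k) ` ?I"
    then obtain H k where H: "finite H" "H \<subseteq> tpp a B" "P = R H k" by auto
    have "pd B (n + n) (\<lambda>e. \<forall>P\<in>H. P (take n e))" "pd B (n + n) (\<lambda>e. \<forall>P\<in>H. P (drop n e))"
      by (rule pd_sel[OF pH[OF H(1,2)]]; auto intro!: sel_intros BU)+
    moreover have "pd B (n + n) (\<lambda>e. \<exists>x\<in>V n. D H e x \<and> Ht k (D H e) x)"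
    proof (rule pd_chain[OF _ assms(3) BU])
      show "pd B (n + n + n) (\<lambda>z. D H (take (n + n) z) (drop (n + n) z))"
        unfolding D_def
        by (intro pd_conj pd_sel[OF pH[OF H(1,2)]] pd_lt_sel sel_intros assms(3) BU) auto
    qed
    ultimately show "pd B (n + n) P" unfolding H(3) R_def by (intro pd_conj)
  next
    fix PP assume "finite PP" "PP \<subseteq> (\<lambda>(H, k). R H k) ` ?I"
    then obtain J where J: "finite J" "J \<subseteq> ?I" "PP = (\<lambda>(H, k). R H k) ` J"
      by (rule finite_subset_image[elim_format]) auto
    obtain K where K: "\<forall>k\<in>snd ` J. k < K" using J(1) finite_nat_set_iff_bounded[of "snd ` J"] by blast
    let ?H = "\<Union>(fst ` J)"
    have "finite H \<and> H \<subseteq> tpp a B" if "H \<in> fst ` J" for H using J(2) that by fastforce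
    then have H: "finite ?H" "?H \<subseteq> tpp a B" using J(1) by auto
    have "Big (\<lambda>x. \<forall>P\<in>?H. P x)" by (rule largeD[OF assms(1) H])
    \<comment> \<open>Two extra members: the lowest becomes \<open>c\<close>, and the highest
      becomes the point \<open>y\<close> below which the remaining \<open>K\<close> lie.\<close>
    then obtain c' where c': "c' \<in> V n" "\<forall>P\<in>?H. P c'" "Ht (Suc (Suc K)) (\<lambda>x. \<forall>P\<in>?H. P x) c'"
      unfolding big_def by blast
    obtain y where y: "y \<in> V n" "\<forall>P\<in>?H. P y" "lt y c'" "Ht (Suc K) (\<lambda>x. \<forall>P\<in>?H. P x) y"
      using c'(3) unfolding ht.simps(2)[of _ _ "Suc K"] by blast
    obtain c where c: "c \<in> V n" "\<forall>P\<in>?H. P c" "lt c y" "Ht K (\<lambda>x. (\<forall>P\<in>?H. P x) \<and> lt c x) y"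
      using ht_bottom[OF y(4,1) trans] by blast
    let ?e = "c @ c'"
    have e: "?e \<in> V (n + n)" "take n ?e = c" "drop n ?e = c'" using c(1) c'(1) by (auto simp: tuples_def)
    have "R H k ?e" if "(H, k) \<in> J" for H k
    proof -
      have sub: "H \<subseteq> ?H" using that by force
      have k: "k \<le> K" using K that by force
      have "Ht k (D H ?e) y"
      proof (rule ht_mono[OF ht_below[OF c(4) y(1) trans] k])
        fix z assume "z \<in> V n" "((\<forall>P\<in>?H. P z) \<and> lt c z) \<and> lt z y"
        moreover from this have "lt z c'" using y(1,3) c'(1) trans unfolding trans_lt_def by blast
        ultimately show "D H ?e z" using sub e unfolding D_def by auto
      qed
      moreover have "D H ?e y" using sub y c e unfolding D_def by auto
      moreover have "\<forall>P\<in>H. P c" "\<forall>P\<in>H. P c'" using sub c(2) c'(2) by blast+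
      ultimately show ?thesis using y(1) unfolding R_def e by blast
    qed
    then show "\<exists>e\<in>V (n + n). \<forall>P\<in>PP. P e" using e(1) J(3) by (intro bexI[of _ ?e]) auto
  qed
  then obtain e where e: "e \<in> V (n + n)" "\<And>H k. finite H \<Longrightarrow> H \<subseteq> tpp a B \<Longrightarrow> R H k e" by auto
  let ?c = "take n e" and ?c' = "drop n e"
  have V: "?c \<in> V n" "?c' \<in> V n" using e(1) by (auto simp: tuples_def dest: in_set_takeD in_set_dropD)
  have P: "P ?c" "P ?c'" if "P \<in> tpp a B" for P
    using e(2)[of "{P}" 0] that by (auto simp: R_def)
  have "tpp a B \<subseteq> tpp ?c B" "tpp a B \<subseteq> tpp ?c' B" using P by (auto simp: tpp_def)
  moreover have "large (insert (\<lambda>x. lt ?c x \<and> lt x ?c') (tpp a B))"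
  proof (rule ccontr)
    assume "\<not> ?thesis"
    then obtain H where H: "finite H" "H \<subseteq> tpp a B" "\<not> Big (\<lambda>x. (\<forall>Q\<in>H. Q x) \<and> (lt ?c x \<and> lt x ?c'))"
      using not_large_insert by blast
    have "Big (D H e)" unfolding big_def using e(2)[OF H(1,2)] unfolding R_def by blast
    then show False using H(3) unfolding D_def by simp
  qed
  ultimately show ?thesis using V by blast
qed

section \<open>Excluding wrong values for one ultrafilter\<close>

text \<open>The truth value that cannot be added at the next term of the coheir sequence is, for
  almost all \<open>b\<close> of \<open>B\<close>, the one that \<open>a\<close> does not have:
  otherwise the instance at \<open>b\<close> already belongs to \<open>F\<close>, and its
  conjunction with \<open>H\<close> is large.\<close>

lemma kill_ultrafilter:
  assumes D: "small D" "B \<subseteq> D" "C \<subseteq> D" and F: "\<And>P. P \<in> F \<Longrightarrow> pd D n P" "large F" "tpp a B \<subseteq> F"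
    and a: "a \<in> V n" and \<phi>: "\<phi> \<in> fms L (n + m)" and r: "ultrafilter (tuples B m) r"
  shows "\<exists>H. finite H \<and> (\<forall>P\<in>H. \<exists>E. finite E \<and> E \<subseteq> univ U \<and> pd E n P) \<and> large (F \<union> H) \<and>
    ev (tuples B m) r (\<lambda>b. \<not> Big (\<lambda>x. (\<forall>P\<in>H. P x) \<and> holds U \<phi> (x @ b) \<noteq> holds U \<phi> (a @ b)))"
proof -
  have DU: "D \<subseteq> univ U" using D(1) by (simp add: small_subset_def)
  have T: "tuples B m \<subseteq> tuples D m" "tuples B m \<subseteq> V m" using D(2) DU by (auto simp: tuples_def)
  obtain bs where bs: "generic_seq m (tuples B m) r D bs" using generic_seq_exists[OF r T(2) D(1)] .
  have bV: "bs i \<in> V m" for i by (rule generic_seq_in[OF bs])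
  define A where "A i x \<longleftrightarrow> (holds U \<phi> (x @ bs i) \<longleftrightarrow> even i)" for i x
  have pA: "pd (set (bs i)) n (A i)" for i
    unfolding A_def
    by (rule pd_iff[OF pd_holds[OF \<phi>] pd_const]) (use bV[of i] in \<open>auto intro!: sel_intros simp: tuples_def\<close>)
  have "\<exists>k. \<not> large (F \<union> A ` {..<k})"
  proof (rule ccontr)
    assume "\<not> ?thesis"
    then have l: "large (F \<union> A ` {..<k})" for k by blast
    have "\<exists>x\<in>V n. \<forall>i<k. holds U \<phi> (x @ bs i) \<longleftrightarrow> even i" for k
      using Big_ex[OF largeD[OF l[of k], of "A ` {..<k}"]] by (auto simp: A_def)
    then show False using generic_seq_alternation[OF nip r T(1) DU bs \<phi>] by blast
  qed
  \<comment> \<open>The least length that fails is positive because \<open>F\<close> itself is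
    large; its predecessor is the longest pattern that can be added.\<close>
  then obtain k' where k': "\<not> large (F \<union> A ` {..<k'})" "\<And>k. k < k' \<Longrightarrow> large (F \<union> A ` {..<k})"
    using exists_least_iff[of "\<lambda>k. \<not> large (F \<union> A ` {..<k})"] by blast
  have "k' \<noteq> 0" using k'(1) F(2) by (cases k') auto
  then obtain k where k: "k' = Suc k" by (cases k') auto
  let ?G = "F \<union> A ` {..<k}"
  have G: "large ?G" using k'(2)[of k] k by simp
  have "\<not> large (insert (A k) ?G)" using k'(1) k by (simp add: lessThan_Suc)
  then obtain H where H: "finite H" "H \<subseteq> ?G" "\<not> Big (\<lambda>x. (\<forall>Q\<in>H. Q x) \<and> A k x)"
    using not_large_insert by blast
  then obtain j where j: "\<And>x. x \<in> V n \<Longrightarrow> (\<forall>Q\<in>H. Q x) \<Longrightarrow> A k x \<Longrightarrow> \<not> Ht j (\<lambda>x. (\<forall>Q\<in>H. Q x) \<and> A k x) x"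
    unfolding big_def by blast
  \<comment> \<open>The next term of the sequence becomes a variable \<open>b\<close>. Nonexistence
    of a chain of the fixed length \<open>j\<close> is then a definable property of
    \<open>b\<close>, which passes from the generic term to almost all tuples of
    \<open>B\<close>.\<close>
  define N where "N b x \<longleftrightarrow> (\<forall>Q\<in>H. Q x) \<and> (holds U \<phi> (x @ b) \<longleftrightarrow> even k)" for b x
  define W where "W b \<longleftrightarrow> (\<exists>x\<in>V n. N b x \<and> Ht j (N b) x)" for b
  let ?D = "D \<union> (\<Union>i<k. set (bs i))"
  have DU': "?D \<subseteq> univ U" "C \<subseteq> ?D" using DU bV D(3) by (auto simp: tuples_def)
  have pG: "pd ?D n P" if P: "P \<in> ?G" for P
  proof (cases "P \<in> F")
    case True
    show ?thesis using F(1)[OF True] by (rule pd_mono) simp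
  next
    case False
    then obtain i where "i < k" "P = A i" using P by auto
    show ?thesis unfolding \<open>P = A i\<close> using pA[of i] by (rule pd_mono) (use \<open>i < k\<close> in auto)
  qed
  have "pd ?D m W"
    unfolding W_def
  proof (rule pd_chain[OF _ DU'(2,1)])
    have "pd ?D n (\<lambda>x. \<forall>Q\<in>H. Q x)" using H(1,2) pG by (intro pd_ball_finite) blast+
    then have "pd ?D (m + n) (\<lambda>z. \<forall>Q\<in>H. Q (drop m z))"
      by (rule pd_sel[OF _ _ _ DU'(1)]) (auto intro!: sel_intros)
    moreover have "pd ?D (m + n) (\<lambda>z. holds U \<phi> (drop m z @ take m z))"
      by (rule pd_holds[OF \<phi>]) (auto intro!: sel_intros)
    ultimately show "pd ?D (m + n) (\<lambda>z. N (take m z) (drop m z))"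
      unfolding N_def by (intro pd_conj pd_iff[OF _ pd_const])
  qed
  moreover have "\<not> W (bs k)"
  proof
    assume "W (bs k)"
    then obtain x where x: "x \<in> V n" "N (bs k) x" "Ht j (N (bs k)) x" by (auto simp: W_def)
    have e: "N (bs k) = (\<lambda>x. (\<forall>Q\<in>H. Q x) \<and> A k x)" by (simp add: fun_eq_iff N_def A_def)
    show False using j[OF x(1)] x(2,3) unfolding e by blast
  qed
  ultimately have "\<not> ev (tuples B m) r W" using bs by (auto simp: generic_seq_def generic_def)
  then have "ev (tuples B m) r (\<lambda>b. \<not> W b)" using ev_not[OF r] by blast
  then have "ev (tuples B m) r (\<lambda>b. \<not> Big (\<lambda>x. (\<forall>P\<in>H. P x) \<and> holds U \<phi> (x @ b) \<noteq> holds U \<phi> (a @ b)))"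
  proof (rule ev_mono[OF r])
    fix b assume b: "b \<in> tuples B m" "\<not> W b"
    then have nb: "\<not> Big (N b)" unfolding W_def big_def by blast
    \<comment> \<open>With equality, the instance at \<open>b\<close> would be in
      \<open>tpp a B\<close>, hence in the large family \<open>?G\<close> that also contains
      \<open>H\<close>, although \<open>N b\<close> has bounded chains.\<close>
    have "holds U \<phi> (a @ b) \<noteq> even k"
    proof
      assume e: "holds U \<phi> (a @ b) = even k"
      let ?P = "\<lambda>x. holds U \<phi> (x @ b) \<longleftrightarrow> even k"
      have "pd B n ?P"
        by (rule pd_iff[OF pd_holds[OF \<phi>] pd_const]) (use b(1) in \<open>auto intro!: sel_intros simp: tuples_def\<close>)
      then have "?P \<in> F" using e F(3) by (auto simp: tpp_def)
      then have "Big (\<lambda>x. \<forall>Q\<in>insert ?P H. Q x)" using H(1,2) by (intro largeD[OF G]) auto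
      then have "Big (N b)" by (rule big_mono) (auto simp: N_def)
      then show False using nb by contradiction
    qed
    then have "(\<lambda>x. (\<forall>P\<in>H. P x) \<and> holds U \<phi> (x @ b) \<noteq> holds U \<phi> (a @ b)) = N b"
      by (auto simp: N_def fun_eq_iff)
    then show "\<not> Big (\<lambda>x. (\<forall>P\<in>H. P x) \<and> holds U \<phi> (x @ b) \<noteq> holds U \<phi> (a @ b))" using nb by simp
  qed
  moreover have "large (F \<union> H)" by (rule large_mono[OF G]) (use H(2) in auto)
  \<comment> \<open>The members of \<open>H\<close> may use terms of the sequence, which lie outside
    \<open>D\<close>. Finiteness of their parameter sets keeps the base small when all ultrafilters
    are treated.\<close>
  moreover have "\<exists>E. finite E \<and> E \<subseteq> univ U \<and> pd E n P" if "P \<in> H" for P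
  proof -
    have "P \<in> ?G" using that H(2) by (rule subsetD[rotated])
    from pd_finite[OF pG[OF this]] obtain E where "finite E \<and> E \<subseteq> ?D \<and> pd E n P" by (elim exE)
    then show ?thesis using DU'(1) by (intro exI[of _ E]) (simp add: order_trans[OF _ DU'(1)])
  qed
  ultimately show ?thesis using H(1) by (intro exI[of _ H]) simp
qed

end

section \<open>Deciding all formulas over a set\<close>

lemma finite_ordLeq: "infinite Z \<Longrightarrow> finite A \<Longrightarrow> |A| \<le>o |Z|"
  by (rule ordLess_imp_ordLeq[OF finite_ordLess_infinite[OF card_of_Well_order card_of_Well_order]])
    (simp_all add: Field_card_of)

lemma card_tuples:
  assumes "infinite Z" "|B| \<le>o |Z|" shows "|tuples B k| \<le>o |Z|"
proof (induction k)
  case 0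
  have "tuples B 0 = {[]}" by (auto simp: tuples_def)
  then show ?case using assms(1) by (simp add: finite_ordLeq)
next
  case (Suc k)
  have "tuples B (Suc k) = (\<lambda>(x, xs). x # xs) ` (B \<times> tuples B k)"
    by (auto simp: tuples_Suc image_iff)
  then have "|tuples B (Suc k)| \<le>o |B \<times> tuples B k|" by (simp add: card_of_image)
  also have "|B \<times> tuples B k| \<le>o |Z|"
    by (rule card_of_Sigma_ordLeq_infinite[OF assms(1,2)]) (simp add: Suc)
  finally show ?case .
qed

lemma nat_ordLeq_infinite: "infinite Z \<Longrightarrow> |UNIV :: nat set| \<le>o |Z|"
  using infinite_iff_card_of_nat by blast

lemma card_lists:
  assumes "infinite Z" "|B| \<le>o |Z|" shows "|lists B| \<le>o |Z|"
proof -
  have "lists B = (\<Union>k. tuples B k)" by (auto simp: tuples_def lists_eq_set)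
  then show ?thesis
    using card_of_UNION_ordLeq_infinite[OF assms(1) nat_ordLeq_infinite[OF assms(1)], of "tuples B"]
      card_tuples[OF assms] by simp
qed

lemma card_formulas_over:
  assumes "infinite Z" "|Fm L| \<le>o |Z|" "|B| \<le>o |Z|"
  shows "|formulas_over L n B| \<le>o |Z|"
proof -
  have "formulas_over L n B \<subseteq> Fm L \<times> lists B" by (auto simp: formulas_over_def fms_def)
  then have "|formulas_over L n B| \<le>o |Fm L \<times> lists B|" by (rule card_of_mono1)
  also have "|Fm L \<times> lists B| \<le>o |Z|"
    by (rule card_of_Sigma_ordLeq_infinite[OF assms(1,2)]) (simp add: card_lists assms)
  finally show ?thesis .
qed

section \<open>Cardinal arithmetic below the smallness bound\<close>

context monster begin

text \<open>Adding the set of formulas makes the cardinal infinite without leaving the range below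
  \<kappa>, so that infinite cardinal arithmetic also covers finite \<open>A\<close>.\<close>

lemma pad:
  assumes "|A| <o \<kappa>"
  shows "infinite (A <+> Fm L)" "|A <+> Fm L| <o \<kappa>"
    "|A| \<le>o |A <+> Fm L|" "|Fm L| \<le>o |A <+> Fm L|"
proof -
  show "infinite (A <+> Fm L)" using infinite_wf by simp
  show "|A <+> Fm L| <o \<kappa>"
    by (rule card_of_Plus_ordLess_infinite_Field[OF infinite_Field card_order assms few])
qed (rule card_of_Plus1 card_of_Plus2)+

lemma less_Pow: assumes "|A| <o \<kappa>" shows "|Pow A| <o \<kappa>"
proof -
  have "|A| \<le>o |Field \<kappa>|"
    using ordLess_imp_ordLeq[OF assms] ordIso_symmetric[OF card_of_Field_ordIso[OF card_order]]
    by (rule ordLeq_ordIso_trans)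
  then obtain f where f: "inj_on f A" "f ` A \<subseteq> Field \<kappa>" unfolding card_of_ordLeq[symmetric] by blast
  have "|f ` A| <o \<kappa>" using card_of_image assms by (rule ordLeq_ordLess_trans)
  then have "|Pow (f ` A)| <o \<kappa>" using limit f(2) unfolding strong_limit_def by blast
  moreover have "|Pow A| \<le>o |Pow (f ` A)|"
    unfolding card_of_ordLeq[symmetric]
    using inj_on_image_Pow[OF f(1)] by (intro exI[of _ "image f"]) auto
  ultimately show ?thesis by (rule ordLeq_ordLess_trans[rotated])
qed

lemma less_Times: assumes "|A| <o \<kappa>" "|B| <o \<kappa>" shows "|A \<times> B| <o \<kappa>"
proof -
  have "|A <+> B| <o \<kappa>"
    by (rule card_of_Plus_ordLess_infinite_Field[OF infinite_Field card_order assms])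
  from pad[OF this] have Z: "infinite ((A <+> B) <+> Fm L)" "|(A <+> B) <+> Fm L| <o \<kappa>"
    "|A <+> B| \<le>o |(A <+> B) <+> Fm L|" by blast+
  have "|A \<times> B| \<le>o |(A <+> B) <+> Fm L|"
    by (rule card_of_Sigma_ordLeq_infinite[OF Z(1)])
      (use ordLeq_transitive[OF card_of_Plus1 Z(3)] ordLeq_transitive[OF card_of_Plus2 Z(3)] in auto)
  then show ?thesis using Z(2) by (rule ordLeq_ordLess_trans)
qed

text \<open>Only finite members are allowed, since \<kappa> may be singular and a small union of
  small sets need not be small.\<close>

lemma less_UN_finite:
  assumes "|I| <o \<kappa>" "\<And>i. i \<in> I \<Longrightarrow> finite (A i)" shows "|\<Union>i\<in>I. A i| <o \<kappa>"
proof -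
  note Z = pad[OF assms(1)]
  have "|\<Union>i\<in>I. A i| \<le>o |I <+> Fm L|"
    by (rule card_of_UNION_ordLeq_infinite[OF Z(1,3)]) (use finite_ordLeq[OF Z(1)] assms(2) in blast)
  then show ?thesis using Z(2) by (rule ordLeq_ordLess_trans)
qed

lemma less_lists: assumes "|A| <o \<kappa>" shows "|lists A| <o \<kappa>"
  using card_lists[OF pad(1,3)[OF assms]] pad(2)[OF assms] by (rule ordLeq_ordLess_trans)

lemma nat_less: "|UNIV :: nat set| <o \<kappa>"
  using nat_ordLeq_infinite[OF infinite_wf] few by (rule ordLeq_ordLess_trans)

end

section \<open>All ultrafilters at once, and intervals free of wrong values\<close>

context ordered begin

text \<open>The ultrafilters on tuples of \<open>B\<close> form a small set, so all of them can be treated while the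
  parameters stay small, as the coheir sequences require.\<close>

lemma kill_all_ultrafilters:
  assumes B: "small B" "C \<subseteq> B" and a: "a \<in> V n" "large (tpp a B)"
  shows "\<exists>G D. small D \<and> B \<subseteq> D \<and> tpp a B \<subseteq> G \<and> large G \<and> (\<forall>P\<in>G. pd D n P) \<and>
    (\<forall>m. \<forall>\<phi>\<in>fms L (n + m). \<exists>H. finite H \<and> H \<subseteq> G \<and>
      (\<forall>b\<in>tuples B m. \<not> Big (\<lambda>x. (\<forall>P\<in>H. P x) \<and> holds U \<phi> (x @ b) \<noteq> holds U \<phi> (a @ b))))"
proof -
  let ?N = "\<lambda>H \<phi> b. Big (\<lambda>x. (\<forall>P\<in>H. P x) \<and> holds U \<phi> (x @ b) \<noteq> holds U \<phi> (a @ b))"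
  define Idx where "Idx = {(m, \<phi>, r). \<phi> \<in> fms L (n + m) \<and> ultrafilter (tuples B m) r}"
  define good where "good H \<longleftrightarrow> finite H \<and> (\<forall>P\<in>H. \<exists>E. finite E \<and> E \<subseteq> univ U \<and> pd E n P)" for H
  define kills where "kills i H \<longleftrightarrow> good H \<and> (case i of (m, \<phi>, r) \<Rightarrow> ev (tuples B m) r (\<lambda>b. \<not> ?N H \<phi> b))"
    for i :: "nat \<times> ('f, 'r) fm \<times> 'u list set set" and H
  define K where "K = {(i, H). i \<in> Idx \<and> kills i H}"
  \<comment> \<open>The clause \<open>inj_on fst\<close> makes \<open>S\<close> a partial choice
    function from indices to sets that kill them. A maximal one, obtained by finite character,
    replaces a transfinite recursion over the indices.\<close>
  define Q where "Q S \<longleftrightarrow> inj_on fst S \<and> large (tpp a B \<union> \<Union>(snd ` S))"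
    for S :: "((nat \<times> ('f, 'r) fm \<times> 'u list set set) \<times> ('u list \<Rightarrow> bool) set) set"
  have "|Idx| <o \<kappa>"
  proof -
    have "Idx \<subseteq> UNIV \<times> Fm L \<times> Pow (Pow (lists B))"
    proof
      fix i assume "i \<in> Idx"
      then obtain m \<phi> r where i: "i = (m, \<phi>, r)" "\<phi> \<in> fms L (n + m)" "ultrafilter (tuples B m) r"
        by (auto simp: Idx_def)
      have "r \<subseteq> Pow (tuples B m)" using i(3) by (simp add: ultrafilter_def)
      moreover have "tuples B m \<subseteq> lists B" using tuples_lists by blast
      ultimately have "r \<subseteq> Pow (lists B)" by (meson Pow_mono order_trans)
      then show "i \<in> UNIV \<times> Fm L \<times> Pow (Pow (lists B))" using i(1,2) by (simp add: fms_def)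
    qed
    then have "|Idx| \<le>o |(UNIV :: nat set) \<times> Fm L \<times> Pow (Pow (lists B))|"
      by (rule card_of_mono1)
    also have "|(UNIV :: nat set) \<times> Fm L \<times> Pow (Pow (lists B))| <o \<kappa>"
      using B(1) by (intro less_Times nat_less few less_Pow less_lists) (simp add: small_subset_def)
    finally show ?thesis .
  qed
  have "\<exists>S. fin_maximal Q {} K S"
  proof (rule tukey)
    show "Q H'" if Q: "Q H" and sub: "H' \<subseteq> H" for H H'
    proof -
      have "inj_on fst H'" using Q sub unfolding Q_def by (blast intro: inj_on_subset)
      moreover have "large (tpp a B \<union> \<Union>(snd ` H'))"
        by (rule large_mono[of "tpp a B \<union> \<Union>(snd ` H)"]) (use Q sub in \<open>auto simp: Q_def\<close>)
      ultimately show ?thesis by (simp add: Q_def)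
    qed
    show "Q H" if "finite H" "H \<subseteq> {}" for H
      using that a(2) by (simp add: Q_def)
  qed simp
  then obtain S where "fin_maximal Q {} K S" by (elim exE)
  note S = this[unfolded fin_maximal_def]
  note SK = S[THEN conjunct2, THEN conjunct1]
    and SQ = S[THEN conjunct2, THEN conjunct2, THEN conjunct1, rule_format]
    and Smax = S[THEN conjunct2, THEN conjunct2, THEN conjunct2, rule_format, OF DiffI]
  let ?F = "tpp a B \<union> \<Union>(snd ` S)"
  have inj: "inj_on fst S"
  proof (rule inj_onI)
    fix x y assume xy: "x \<in> S" "y \<in> S" "fst x = fst y"
    have "Q {x, y}" by (rule SQ) (use xy in simp_all)
    then have "inj_on fst {x, y}" by (simp only: Q_def)
    then show "x = y" using xy(3) by (rule inj_onD) simp_all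
  qed
  have lF: "large ?F"
    unfolding large_def
  proof (intro allI impI)
    fix H assume H: "finite H" "H \<subseteq> ?F"
    then have "\<forall>P\<in>H - tpp a B. \<exists>s. s \<in> S \<and> P \<in> snd s" by blast
    from bchoice[OF this] obtain s where s: "\<forall>P\<in>H - tpp a B. s P \<in> S \<and> P \<in> snd (s P)" by blast
    let ?S = "s ` (H - tpp a B)"
    have "Q ?S" by (rule SQ) (use H(1) s in auto)
    then have "large (tpp a B \<union> \<Union>(snd ` ?S))" by (simp add: Q_def)
    moreover have "H \<subseteq> tpp a B \<union> \<Union>(snd ` ?S)" using s by auto
    ultimately show "Big (\<lambda>x. \<forall>P\<in>H. P x)" using largeD H(1) by blast
  qed
  have "\<forall>P\<in>\<Union>(snd ` S). \<exists>E. finite E \<and> E \<subseteq> univ U \<and> pd E n P"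
    using SK by (auto simp: K_def kills_def good_def)
  from bchoice[OF this] obtain E where E: "\<forall>P\<in>\<Union>(snd ` S). finite (E P) \<and> E P \<subseteq> univ U \<and> pd (E P) n P" by (elim exE)
  define D where "D = B \<union> (\<Union>s\<in>S. \<Union>P\<in>snd s. E P)"
  \<comment> \<open>Each index is used at most once, so the parameters added to \<open>B\<close>
    remain few.\<close>
  have "|S| <o \<kappa>"
  proof -
    have "fst ` S \<subseteq> Idx" using SK by (auto simp: K_def)
    then have "|S| \<le>o |Idx|" using inj card_of_ordLeq by blast
    then show ?thesis using \<open>|Idx| <o \<kappa>\<close> by (rule ordLeq_ordLess_trans)
  qed
  moreover have "finite (\<Union>P\<in>snd s. E P)" if "s \<in> S" for s
  proof -
    have "finite (snd s)" using SK that by (auto simp: K_def kills_def good_def)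
    then show ?thesis using E that by auto
  qed
  ultimately have "|\<Union>s\<in>S. \<Union>P\<in>snd s. E P| <o \<kappa>" by (rule less_UN_finite)
  moreover have "(\<Union>s\<in>S. \<Union>P\<in>snd s. E P) \<subseteq> univ U" using E by blast
  ultimately have "small (\<Union>s\<in>S. \<Union>P\<in>snd s. E P)" by (simp add: small_subset_def)
  then have D: "small D" "B \<subseteq> D" unfolding D_def using small_Un[OF B(1)] by auto
  have pF: "pd D n P" if P: "P \<in> ?F" for P
  proof (cases "P \<in> tpp a B")
    case True
    then have "pd B n P" by (simp add: tpp_def)
    then show ?thesis using D(2) by (rule pd_mono)
  next
    case False
    then obtain s where s: "s \<in> S" "P \<in> snd s" using P by blast
    then have "pd (E P) n P" using E by blast
    then show ?thesis by (rule pd_mono) (use s in \<open>auto simp: D_def\<close>)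
  qed
  \<comment> \<open>An index without an assigned set would contradict maximality:
    \<open>kill_ultrafilter\<close>, applied over the base \<open>D\<close> with everything chosen
    so far, supplies a set that is large together with all of it.\<close>
  have cover: "\<exists>H. (i, H) \<in> S" if i: "i \<in> Idx" for i
  proof -
    obtain m \<phi> r where mr: "i = (m, \<phi>, r)" "\<phi> \<in> fms L (n + m)" "ultrafilter (tuples B m) r"
      using i by (auto simp: Idx_def)
    obtain H where H: "finite H \<and> (\<forall>P\<in>H. \<exists>E. finite E \<and> E \<subseteq> univ U \<and> pd E n P) \<and> large (?F \<union> H) \<and>
        ev (tuples B m) r (\<lambda>b. \<not> ?N H \<phi> b)"
      using kill_ultrafilter[OF D _ pF lF _ a(1) mr(2,3)] B(2) D(2) by auto
    have "(i, H) \<in> S \<or> (\<exists>H'. (i, H') \<in> S)"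
    proof (rule disjCI)
      assume n: "\<not> (\<exists>H'. (i, H') \<in> S)"
      show "(i, H) \<in> S"
      proof (rule ccontr)
        assume "(i, H) \<notin> S"
        moreover have "(i, H) \<in> K" using H i mr(1) by (simp add: K_def kills_def good_def)
        ultimately obtain S' where S': "finite S' \<and> S' \<subseteq> S \<and> \<not> Q (insert (i, H) S')"
          using Smax[of "(i, H)"] by blast
        have "inj_on fst (insert (i, H) S')"
          using inj_on_subset[OF inj, of S'] S' n by (auto simp: inj_on_def)
        moreover have "large (tpp a B \<union> \<Union>(snd ` insert (i, H) S'))"
          by (rule large_mono[of "?F \<union> H"]) (use H S' in auto)
        ultimately show False using S' by (simp add: Q_def)
      qed
    qed
    then show ?thesis by blast
  qed
  have "\<exists>H. finite H \<and> H \<subseteq> ?F \<and> (\<forall>b\<in>tuples B m. \<not> ?N H \<phi> b)" if \<phi>: "\<phi> \<in> fms L (n + m)" for m \<phi>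
  proof (rule ccontr)
    assume n: "\<not> ?thesis"
    \<comment> \<open>If every finite \<open>H\<close> fails somewhere, the sets of failures have
      the finite intersection property. They generate an ultrafilter, and this ultrafilter was
      treated by some \<open>H\<close>.\<close>
    define X where "X H = {b \<in> tuples B m. ?N H \<phi> b}" for H
    have ne: "X H \<noteq> {}" if "finite H" "H \<subseteq> ?F" for H
      using n that unfolding X_def by blast
    have mono: "X H \<subseteq> X H'" if "H' \<subseteq> H" for H H'
      unfolding X_def using that by (auto intro: big_mono)
    let ?G = "X ` {H. finite H \<and> H \<subseteq> ?F}"
    obtain r where r: "ultrafilter (tuples B m) r" "?G \<subseteq> r"
    proof (rule ultrafilter_extend[of ?G "tuples B m"])
      show "?G \<subseteq> Pow (tuples B m)" by (auto simp: X_def)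
      fix Y assume "finite Y" "Y \<subseteq> ?G"
      then obtain J where J: "finite J" "J \<subseteq> {H. finite H \<and> H \<subseteq> ?F}" "Y = X ` J"
        by (rule finite_subset_image[elim_format]) auto
      have "X (\<Union>J) \<noteq> {}" using J(1,2) by (intro ne) auto
      moreover have "X (\<Union>J) \<subseteq> tuples B m \<inter> \<Inter>Y"
        using mono[of _ "\<Union>J"] J(3) by (auto simp: X_def)
      ultimately show "tuples B m \<inter> \<Inter>Y \<noteq> {}" by blast
    qed auto
    have "(m, \<phi>, r) \<in> Idx" using \<phi> r(1) by (simp add: Idx_def)
    then obtain H where H: "((m, \<phi>, r), H) \<in> S" using cover by blast
    then have k: "kills (m, \<phi>, r) H" using SK by (auto simp: K_def)
    then have "ev (tuples B m) r (\<lambda>b. \<not> ?N H \<phi> b)" by (simp add: kills_def)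
    then have nev: "\<not> ev (tuples B m) r (\<lambda>b. ?N H \<phi> b)" using ev_not[OF r(1)] by blast
    have "H \<subseteq> ?F" using H by force
    moreover have "finite H" using k by (simp add: kills_def good_def)
    ultimately have "X H \<in> r" using r(2) by blast
    then show False using nev by (simp add: ev_def X_def)
  qed
  then show ?thesis using D lF pF by (intro exI[of _ ?F] exI[of _ D]) auto
qed

text \<open>Boundedness of the chains of wrong solutions is turned into their absence from an
  interval. Largeness of \<open>G\<close> together with the interval is kept, so that the step can
  be repeated.\<close>

lemma one_step:
  assumes B: "small B" "C \<subseteq> B" and a: "a \<in> V n" "large (tpp a B)"
  shows "\<exists>G c c'. c \<in> V n \<and> c' \<in> V n \<and> large (insert (\<lambda>x. lt c x \<and> lt x c') G) \<and> tpp a B \<subseteq> G \<and>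
    (\<forall>P\<in>G. pd (univ U) n P) \<and>
    (\<forall>m. \<forall>\<phi>\<in>fms L (n + m). \<exists>H. finite H \<and> H \<subseteq> G \<and>
      (\<forall>b\<in>tuples B m. \<forall>x\<in>V n. (\<forall>P\<in>H. P x) \<longrightarrow> lt c x \<longrightarrow> lt x c' \<longrightarrow> (holds U \<phi> (x @ b) \<longleftrightarrow> holds U \<phi> (a @ b))))"
proof -
  obtain G D where G: "small D \<and> B \<subseteq> D \<and> tpp a B \<subseteq> G \<and> large G \<and> (\<forall>P\<in>G. pd D n P) \<and>
    (\<forall>m. \<forall>\<phi>\<in>fms L (n + m). \<exists>H. finite H \<and> H \<subseteq> G \<and>
      (\<forall>b\<in>tuples B m. \<not> Big (\<lambda>x. (\<forall>P\<in>H. P x) \<and> holds U \<phi> (x @ b) \<noteq> holds U \<phi> (a @ b))))"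
    using kill_all_ultrafilters[OF assms] by (elim exE)
  then have D: "small D" "B \<subseteq> D" "tpp a B \<subseteq> G" "large G" "\<And>P. P \<in> G \<Longrightarrow> pd D n P"
    and G': "\<And>m \<phi>. \<phi> \<in> fms L (n + m) \<Longrightarrow> \<exists>H. finite H \<and> H \<subseteq> G \<and>
      (\<forall>b\<in>tuples B m. \<not> Big (\<lambda>x. (\<forall>P\<in>H. P x) \<and> holds U \<phi> (x @ b) \<noteq> holds U \<phi> (a @ b)))"
    by simp_all
  have DU: "D \<subseteq> univ U" "C \<subseteq> D" using D(1,2) B(2) by (auto simp: small_subset_def)
  \<comment> \<open>Completing \<open>G\<close> over \<open>D\<close>, not only over
    \<open>B\<close>, makes both ends of the interval agree on the heights, whose definitions use
    the parameters of \<open>G\<close>.\<close>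
  obtain a1 where a1: "a1 \<in> V n" "G \<subseteq> tpp a1 D" "large (tpp a1 D)"
    using large_complete[OF D(4,5,1)] by blast
  obtain c c' where c: "c \<in> V n" "c' \<in> V n" "tpp a1 D \<subseteq> tpp c D" "tpp a1 D \<subseteq> tpp c' D"
    "large (insert (\<lambda>x. lt c x \<and> lt x c') (tpp a1 D))"
    using interval[OF a1(3) D(1) DU(2)] by blast
  have cc: "P c \<longleftrightarrow> P c'" if "pd D n P" for P
  proof (cases "P a1")
    case True
    then have "P \<in> tpp a1 D" using that by (simp add: tpp_def)
    then show ?thesis using c(3,4) by (auto simp: tpp_def)
  next
    case False
    then have "(\<lambda>x. \<not> P x) \<in> tpp a1 D" using pd_not[OF that] by (simp add: tpp_def)
    then have "(\<lambda>x. \<not> P x) \<in> tpp c D" "(\<lambda>x. \<not> P x) \<in> tpp c' D" using c(3,4) by blast+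
    then show ?thesis by (simp add: tpp_def)
  qed
  have empty: "\<not> (\<exists>z\<in>V n. N z \<and> lt c z \<and> lt z c')" if N: "pd D n N" "\<not> Big N" for N
  proof
    assume "\<exists>z\<in>V n. N z \<and> lt c z \<and> lt z c'"
    then obtain z where z: "z \<in> V n" "N z" "lt c z" "lt z c'" by blast
    obtain k where k: "\<And>x. x \<in> V n \<Longrightarrow> N x \<Longrightarrow> \<not> Ht k N x" using N(2) unfolding big_def by blast
    \<comment> \<open>The bound \<open>k\<close> speaks of points of \<open>N\<close>, and
      \<open>c\<close> need not be one; the top of a longer chain below \<open>c\<close> would
      be.\<close>
    then have "\<not> Ht (Suc k) N c" by auto
    then obtain j where j: "\<not> Ht j N c" "\<And>i. i < j \<Longrightarrow> Ht i N c"
      using exists_least_iff[of "\<lambda>j. \<not> Ht j N c"] by blast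
    then obtain i where i: "j = Suc i" by (cases j) auto
    have "Ht i N z" by (rule ht_up[OF _ z(3) c(1) z(1) trans]) (use j(2) i in simp)
    then have "Ht j N c'" using z i by auto
    moreover have "pd D n (Ht j N)"
      using pd_Ht[of D 0 "\<lambda>_. N" j, OF _ DU(2,1)] N(1) by simp
    ultimately show False using cc[of "Ht j N"] j(1) by blast
  qed
  have "\<exists>H. finite H \<and> H \<subseteq> G \<and> (\<forall>b\<in>tuples B m. \<forall>x\<in>V n. (\<forall>P\<in>H. P x) \<longrightarrow> lt c x \<longrightarrow> lt x c' \<longrightarrow>
      (holds U \<phi> (x @ b) \<longleftrightarrow> holds U \<phi> (a @ b)))" if \<phi>: "\<phi> \<in> fms L (n + m)" for m \<phi>
  proof -
    obtain H where H: "finite H" "H \<subseteq> G"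
      "\<forall>b\<in>tuples B m. \<not> Big (\<lambda>x. (\<forall>P\<in>H. P x) \<and> holds U \<phi> (x @ b) \<noteq> holds U \<phi> (a @ b))"
      using G'[OF \<phi>] by blast
    have "holds U \<phi> (x @ b) \<longleftrightarrow> holds U \<phi> (a @ b)"
      if x: "b \<in> tuples B m" "x \<in> V n" "\<forall>P\<in>H. P x" "lt c x" "lt x c'" for b x
    proof (rule ccontr)
      assume n: "\<not> ?thesis"
      let ?N = "\<lambda>x. (\<forall>P\<in>H. P x) \<and> holds U \<phi> (x @ b) \<noteq> holds U \<phi> (a @ b)"
      have "b \<in> lists D" using x(1) D(2) by (auto simp: tuples_def)
      then have "pd D n (\<lambda>x. holds U \<phi> (x @ b))"
        using x(1) by (intro pd_holds[OF \<phi>] sel_intros) (auto simp: tuples_def)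
      then have "pd D n ?N"
        using H(1,2) D(5) by (intro pd_conj pd_ball_finite pd_not pd_iff pd_const) blast+
      from empty[OF this] H(3) x n show False by blast
    qed
    then show ?thesis using H(1,2) by blast
  qed
  moreover have "large (insert (\<lambda>x. lt c x \<and> lt x c') G)"
    by (rule large_mono[OF c(5)]) (use a1(2) in auto)
  moreover have "\<forall>P\<in>G. pd (univ U) n P" using D(5) pd_mono[OF _ DU(1)] by blast
  ultimately show ?thesis using c(1,2) D(3) by (intro exI[of _ G] exI[of _ c] exI[of _ c']) simp
qed

end

section \<open>A type in which formulas are decided uniformly\<close>

text \<open>A transfinite iteration along the successor cardinal of |Z|, whose regularity puts every
  subset of the union of size at most |Z| into one stage. The relation \<open>le\<close> is
  inclusion in \<open>uniform_type\<close> and elementary substructure in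
  \<open>saturated_extension\<close>; \<open>R\<close> records what a successor achieves.\<close>

lemma cardSuc_chain:
  fixes P :: "'a set \<Rightarrow> bool" and le R :: "'a set \<Rightarrow> 'a set \<Rightarrow> bool" and Z :: "'z set"
  assumes Z: "infinite Z" and start: "P s0"
    and step: "\<And>X. P X \<Longrightarrow> \<exists>Y. P Y \<and> le X Y \<and> R X Y"
    and trans: "\<And>X Y W. le X Y \<Longrightarrow> le Y W \<Longrightarrow> le X W"
    and sub: "\<And>X Y. le X Y \<Longrightarrow> X \<subseteq> Y"
    and union: "\<And>CC. CC \<noteq> {} \<Longrightarrow> |CC| \<le>o cardSuc |Z| \<Longrightarrow> \<forall>X\<in>CC. P X \<Longrightarrow>
       \<forall>X\<in>CC. \<forall>Y\<in>CC. X = Y \<or> le X Y \<or> le Y X \<Longrightarrow> P (\<Union>CC) \<and> (\<forall>X\<in>CC. le X (\<Union>CC))"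
  shows "\<exists>W. P W \<and> le s0 W \<and>
    (\<forall>S\<subseteq>W. |S| \<le>o |Z| \<longrightarrow> (\<exists>X Y. S \<subseteq> X \<and> P X \<and> P Y \<and> R X Y \<and> le X Y \<and> le Y W))"
proof -
  define r where "r = cardSuc |Z|"
  have cr: "Card_order r" unfolding r_def by (rule cardSuc_Card_order[OF card_of_Card_order])
  have inf: "infinite (Field r)" unfolding r_def cardSuc_finite[OF card_of_Card_order]
    using Z by (simp add: Field_card_of)
  interpret wo: wo_rel r
    using cr by (simp add: wo_rel_def card_order_on_def)
  define st where "st X = (SOME Y. P Y \<and> le X Y \<and> R X Y)" for X
  have st: "P (st X) \<and> le X (st X) \<and> R X (st X)" if "P X" for X
    unfolding st_def by (rule someI_ex[OF step[OF that]])
  \<comment> \<open>Limit and successor stages are not distinguished: a step is applied to the union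
    of all earlier stages.\<close>
  define H where "H f i = st (\<Union>(insert s0 (f ` underS r i)))" for f :: "_ \<Rightarrow> 'a set" and i
  define F where "F = wo.worec H"
  define G where "G i = \<Union>(insert s0 (F ` underS r i))" for i
  have "wo.adm_wo H"
    unfolding wo.adm_wo_def H_def by (auto simp: image_def intro!: arg_cong[of _ _ st])
  then have "F = H F" unfolding F_def by (rule wo.worec_fixpoint)
  then have F: "F i = st (G i)" for i unfolding G_def by (metis H_def)
  have underS: "j \<in> underS r i \<longleftrightarrow> j \<noteq> i \<and> (j, i) \<in> r" for i j
    by (simp add: underS_def)
  \<comment> \<open>Stated for arbitrary \<open>J\<close>, so that it covers the initial segments
    needed in the recursion as well as the final union.\<close>
  have fam: "P (\<Union>(insert s0 (F ` J))) \<and> (\<forall>X\<in>insert s0 (F ` J). le X (\<Union>(insert s0 (F ` J))))"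
    if J: "J \<subseteq> Field r" and IH: "\<And>j. j \<in> J \<Longrightarrow> P (F j) \<and> le s0 (F j) \<and> (\<forall>k\<in>underS r j. le (F k) (F j))" for J
  proof (rule union)
    have "|F ` J| \<le>o |J|" by (rule card_of_image)
    also have "|J| \<le>o |Field r|" using J by (rule card_of_mono1)
    also have "|Field r| =o r" by (rule card_of_Field_ordIso[OF cr])
    finally have "|F ` J| \<le>o r" .
    moreover have "|{s0}| \<le>o r"
    proof -
      have "|{s0}| \<le>o |Field r|" using inf by (intro finite_ordLeq) auto
      then show ?thesis using card_of_Field_ordIso[OF cr] by (rule ordLeq_ordIso_trans)
    qed
    ultimately have "|{s0} \<union> F ` J| \<le>o r" using inf cr by (intro card_of_Un_ordLeq_infinite_Field)
    then show "|insert s0 (F ` J)| \<le>o cardSuc |Z|" by (simp add: r_def)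
    show "\<forall>X\<in>insert s0 (F ` J). P X" using start IH by blast
    have "F j = F k \<or> le (F j) (F k) \<or> le (F k) (F j)" if "j \<in> J" "k \<in> J" for j k
    proof -
      have "(j, k) \<in> r \<or> (k, j) \<in> r" using wo.TOTALS J that by blast
      then show ?thesis using IH that underS by (cases "j = k") blast+
    qed
    then show "\<forall>X\<in>insert s0 (F ` J). \<forall>Y\<in>insert s0 (F ` J). X = Y \<or> le X Y \<or> le Y X"
      using IH by blast
  qed simp
  have main: "i \<in> Field r \<longrightarrow> P (F i) \<and> le s0 (F i) \<and> (\<forall>k\<in>underS r i. le (F k) (F i))" for i
  proof (induction i rule: wo.well_order_induct)
    case (1 i)
    show ?case
    proof
      assume "i \<in> Field r"
      have J: "underS r i \<subseteq> Field r" by (auto simp: underS_def Field_def)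
      then have "P (G i) \<and> (\<forall>X\<in>insert s0 (F ` underS r i). le X (G i))"
        unfolding G_def
      proof (rule fam)
        fix j assume j: "j \<in> underS r i"
        then have "j \<in> Field r" "j \<noteq> i \<and> (j, i) \<in> r" using J underS by blast+
        then show "P (F j) \<and> le s0 (F j) \<and> (\<forall>k\<in>underS r j. le (F k) (F j))"
          using 1[rule_format, of j] by blast
      qed
      then show "P (F i) \<and> le s0 (F i) \<and> (\<forall>k\<in>underS r i. le (F k) (F i))"
        unfolding F[of i] using st[of "G i"] trans by blast
    qed
  qed
  have PG: "P (G i)" if "i \<in> Field r" for i
  proof -
    have "underS r i \<subseteq> Field r" by (auto simp: underS_def Field_def)
    then have "P (\<Union>(insert s0 (F ` underS r i))) \<and>
        (\<forall>X\<in>insert s0 (F ` underS r i). le X (\<Union>(insert s0 (F ` underS r i))))"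
      by (rule fam) (use \<open>underS r i \<subseteq> Field r\<close> main in blast)
    then show ?thesis unfolding G_def by (rule conjunct1)
  qed
  define W where "W = \<Union>(insert s0 (F ` Field r))"
  have W: "P W" "\<And>X. X \<in> insert s0 (F ` Field r) \<Longrightarrow> le X W"
  proof -
    have "P W \<and> (\<forall>X\<in>insert s0 (F ` Field r). le X W)"
      unfolding W_def by (rule fam[OF order_refl]) (use main in blast)
    then show "P W" "\<And>X. X \<in> insert s0 (F ` Field r) \<Longrightarrow> le X W" by blast+
  qed
  have chain: "relChain r F"
    unfolding relChain_def
  proof (intro allI impI)
    fix i j assume ij: "(i, j) \<in> r"
    then have "j \<in> Field r" by (auto simp: Field_def)
    then show "F i \<subseteq> F j" using main[of j] sub ij underS[of i j] by (cases "i = j") blast+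
  qed
  obtain i0 where i0: "i0 \<in> Field r" using inf by fastforce
  have "W \<subseteq> (\<Union>i\<in>Field r. F i)" using main[of i0] sub[of s0] i0 unfolding W_def by blast
  have "\<exists>X Y. S \<subseteq> X \<and> P X \<and> P Y \<and> R X Y \<and> le X Y \<and> le Y W" if S: "S \<subseteq> W" "|S| \<le>o |Z|" for S
  proof -
    have "\<exists>i\<in>Field (cardSuc |Z| ). S \<subseteq> F i"
    proof (rule cardSuc_UNION[OF card_of_Card_order _ _ _ S(2)])
      show "infinite (Field |Z| )" using Z by (simp add: Field_card_of)
      show "relChain (cardSuc |Z| ) F" using chain by (simp add: r_def)
      show "S \<subseteq> (\<Union>i\<in>Field (cardSuc |Z| ). F i)"
        using S(1) \<open>W \<subseteq> (\<Union>i\<in>Field r. F i)\<close> by (simp add: r_def)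
    qed
    then obtain i where i: "i \<in> Field r" "S \<subseteq> F i" by (auto simp: r_def)
    \<comment> \<open>One position further on, stage \<open>i\<close> is contained in
      \<open>G j\<close>, so \<open>G j\<close> and its successor \<open>F j\<close> are the
      required pair.\<close>
    obtain j where j: "j \<in> Field r" "i \<noteq> j" "(i, j) \<in> r"
      using infinite_Card_order_limit[OF cr inf i(1)] by blast
    have "F i \<subseteq> G j" using underS[of i j] j unfolding G_def by blast
    then have "S \<subseteq> G j" using i(2) by blast
    moreover have "le (F j) W" using W(2) j(1) by blast
    ultimately show ?thesis using PG[OF j(1)] st[OF PG[OF j(1)]] F[of j] by auto
  qed
  then show ?thesis using W by (intro exI[of _ W]) blast
qed

section \<open>Large sets of formulas that decide their own parameters\<close>

context ordered begin

definition inst :: "('f, 'r) fm \<times> 'u list \<Rightarrow> 'u list \<Rightarrow> bool" where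
  "inst q x \<longleftrightarrow> holds U (fst q) (x @ snd q)"

definition params :: "(('f, 'r) fm \<times> 'u list) set \<Rightarrow> 'u set" where
  "params s = (\<Union>q\<in>s. set (snd q))"

lemma pd_inst: "s \<subseteq> formulas_over L n (univ U) \<Longrightarrow> q \<in> s \<Longrightarrow> params s \<subseteq> B \<Longrightarrow> pd B n (inst q)"
proof -
  assume s: "s \<subseteq> formulas_over L n (univ U)" "q \<in> s" "params s \<subseteq> B"
  then have "q \<in> formulas_over L n (univ U)" "set (snd q) \<subseteq> B" unfolding params_def by blast+
  then have "(fst q, snd q) \<in> formulas_over L n B" by (auto simp: formulas_over_def)
  then show ?thesis unfolding inst_def by (rule pd_over)
qed

text \<open>Two arbitrary solutions are compared because the realization \<open>a\<close> is chosen
  only after the whole chain has been built.\<close>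

definition decides :: "(('f, 'r) fm \<times> 'u list) set \<Rightarrow> ('f, 'r) fm \<Rightarrow> nat \<Rightarrow> 'u set \<Rightarrow> bool" where
  "decides H \<phi> m B \<longleftrightarrow> (\<forall>x\<in>V n. \<forall>x'\<in>V n. (\<forall>q\<in>H. inst q x \<and> inst q x') \<longrightarrow>
     (\<forall>b\<in>tuples B m. holds U \<phi> (x @ b) \<longleftrightarrow> holds U \<phi> (x' @ b)))"

text \<open>The passage from predicates back to formulas lets the size of each stage be counted and
  its parameters be named.\<close>

lemma step_formulas:
  assumes s: "s \<subseteq> formulas_over L n (univ U)" "large (inst ` s)"
    and B: "small B" "C \<subseteq> B" "params s \<subseteq> B" and Z: "infinite Z" "|s| \<le>o |Z|" "|Fm L| \<le>o |Z|"
  shows "\<exists>s'. s \<subseteq> s' \<and> s' \<subseteq> formulas_over L n (univ U) \<and> large (inst ` s') \<and> |s'| \<le>o |Z| \<and>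
    (\<forall>m. \<forall>\<phi>\<in>fms L (n + m). \<exists>H. finite H \<and> H \<subseteq> s' \<and> decides H \<phi> m B)"
proof -
  have "\<exists>a\<in>V n. inst ` s \<subseteq> tpp a B \<and> large (tpp a B)"
    by (rule large_complete[OF s(2) _ B(1)]) (use pd_inst[OF s(1) _ B(3)] in blast)
  then obtain a where a: "a \<in> V n" "inst ` s \<subseteq> tpp a B" "large (tpp a B)" by blast
  obtain G c c' where G: "c \<in> V n \<and> c' \<in> V n \<and> large (insert (\<lambda>x. lt c x \<and> lt x c') G) \<and> tpp a B \<subseteq> G \<and>
    (\<forall>P\<in>G. pd (univ U) n P) \<and>
    (\<forall>m. \<forall>\<phi>\<in>fms L (n + m). \<exists>H. finite H \<and> H \<subseteq> G \<and>
      (\<forall>b\<in>tuples B m. \<forall>x\<in>V n. (\<forall>P\<in>H. P x) \<longrightarrow> lt c x \<longrightarrow> lt x c' \<longrightarrow> (holds U \<phi> (x @ b) \<longleftrightarrow> holds U \<phi> (a @ b))))"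
    using one_step[OF B(1,2) a(1,3)] by (elim exE)
  define I where "I x \<longleftrightarrow> lt c x \<and> lt x c'" for x
  have c: "c \<in> V n" "c' \<in> V n" "large (insert I G)" "tpp a B \<subseteq> G"
    and pG: "\<And>P. P \<in> G \<Longrightarrow> pd (univ U) n P"
    using G unfolding I_def by simp_all
  define Idx where "Idx = (UNIV :: nat set) \<times> Fm L"
  define good where "good i H \<longleftrightarrow> finite H \<and> H \<subseteq> G \<and> (\<forall>b\<in>tuples B (fst i). \<forall>x\<in>V n. (\<forall>P\<in>H. P x) \<longrightarrow> I x \<longrightarrow>
      (holds U (snd i) (x @ b) \<longleftrightarrow> holds U (snd i) (a @ b)))" for i H
  have "\<forall>i\<in>Idx. \<exists>H. finite H \<and> H \<subseteq> G \<and> (snd i \<in> fms L (n + fst i) \<longrightarrow> good i H)"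
  proof
    fix i assume "i \<in> Idx"
    show "\<exists>H. finite H \<and> H \<subseteq> G \<and> (snd i \<in> fms L (n + fst i) \<longrightarrow> good i H)"
    proof (cases "snd i \<in> fms L (n + fst i)")
      case True
      then obtain H where "finite H" "H \<subseteq> G" "\<forall>b\<in>tuples B (fst i). \<forall>x\<in>V n. (\<forall>P\<in>H. P x) \<longrightarrow> lt c x \<longrightarrow> lt x c' \<longrightarrow>
          (holds U (snd i) (x @ b) \<longleftrightarrow> holds U (snd i) (a @ b))" using G by blast
      then have "good i H" unfolding good_def I_def by blast
      then show ?thesis by (auto simp: good_def)
    qed auto
  qed
  from bchoice[OF this] obtain h where h: "\<forall>i\<in>Idx. finite (h i) \<and> h i \<subseteq> G \<and>
    (snd i \<in> fms L (n + fst i) \<longrightarrow> good i (h i))" by (elim exE)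
  have pI: "pd (univ U) n I"
    unfolding I_def
    by (intro pd_conj pd_lt_sel sel_intros C order_refl) (use c(1,2) in \<open>auto simp: tuples_def\<close>)
  then have pK: "pd (univ U) n P" if "P \<in> insert I G" for P using pG that by blast
  have "\<forall>P\<in>insert I G. \<exists>q. q \<in> formulas_over L n (univ U) \<and> (\<forall>x\<in>V n. inst q x \<longleftrightarrow> P x)"
    using pK unfolding pd_def inst_def by fastforce
  from bchoice[OF this] obtain fml where fml: "\<forall>P\<in>insert I G. fml P \<in> formulas_over L n (univ U) \<and>
    (\<forall>x\<in>V n. inst (fml P) x \<longleftrightarrow> P x)" by (elim exE)
  \<comment> \<open>Only the interval and finitely many members of \<open>G\<close> per formula are
    kept; all of \<open>G\<close> could exceed |Z|.\<close>
  define s' where "s' = s \<union> (\<Union>i\<in>Idx. fml ` insert I (h i))"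
  show ?thesis
  proof (rule exI[of _ s'], intro conjI allI ballI)
    show "s \<subseteq> s'" by (simp add: s'_def)
    have hG: "h i \<subseteq> G" if "i \<in> Idx" for i using h that by blast
    show "s' \<subseteq> formulas_over L n (univ U)" unfolding s'_def using s(1) fml hG by blast
    show "large (inst ` s')"
    proof (rule large_equiv[OF c(3)])
      fix P assume "P \<in> inst ` s'"
      then consider q where "q \<in> s" "P = inst q" | Q where "Q \<in> insert I G" "P = inst (fml Q)"
        unfolding s'_def using hG by blast
      then show "\<exists>P'\<in>insert I G. \<forall>x\<in>V n. P' x \<longrightarrow> P x"
      proof cases
        case 1
        then have "P \<in> insert I G" using a(2) c(4) by blast
        then show ?thesis by blast
      next
        case 2
        then show ?thesis using fml by (intro bexI[of _ Q]) auto
      qed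
    qed
    have "|Idx| \<le>o |Z|" unfolding Idx_def
      by (rule card_of_Sigma_ordLeq_infinite[OF Z(1) nat_ordLeq_infinite[OF Z(1)]]) (simp add: Z(3))
    then have "|\<Union>i\<in>Idx. fml ` insert I (h i)| \<le>o |Z|"
    proof (rule card_of_UNION_ordLeq_infinite[OF Z(1)])
      show "\<forall>i\<in>Idx. |fml ` insert I (h i)| \<le>o |Z|" using h by (intro ballI finite_ordLeq[OF Z(1)]) simp
    qed
    from card_of_Un_ordLeq_infinite_Field[OF _ Z(2) this card_of_Card_order]
    show "|s'| \<le>o |Z|" unfolding s'_def using Z(1) by (simp only: Field_card_of simp_thms)
    fix m \<phi> assume \<phi>: "\<phi> \<in> fms L (n + m)"
    let ?i = "(m, \<phi>)"
    have i: "?i \<in> Idx" using \<phi> by (simp add: Idx_def fms_def)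
    then have g: "finite (h ?i)" "h ?i \<subseteq> G" "good ?i (h ?i)" using h \<phi> by auto
    show "\<exists>H. finite H \<and> H \<subseteq> s' \<and> decides H \<phi> m B"
    proof (intro exI[of _ "fml ` insert I (h ?i)"] conjI)
      show "finite (fml ` insert I (h ?i))" using g(1) by simp
      show "fml ` insert I (h ?i) \<subseteq> s'" using i unfolding s'_def by blast
      have eq: "holds U \<phi> (x @ b) \<longleftrightarrow> holds U \<phi> (a @ b)"
        if x: "x \<in> V n" "\<forall>q\<in>fml ` insert I (h ?i). inst q x" and b: "b \<in> tuples B m" for x b
      proof -
        have "\<forall>P\<in>h ?i. P x" "I x" using x fml g(2) by blast+
        then show ?thesis using g(3) x(1) b unfolding good_def fst_conv snd_conv by blast
      qed
      show "decides (fml ` insert I (h ?i)) \<phi> m B"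
        unfolding decides_def
      proof (intro ballI impI)
        fix x x' b assume x: "x \<in> V n" "x' \<in> V n" "\<forall>q\<in>fml ` insert I (h ?i). inst q x \<and> inst q x'"
          and b: "b \<in> tuples B m"
        have "\<forall>q\<in>fml ` insert I (h ?i). inst q x" "\<forall>q\<in>fml ` insert I (h ?i). inst q x'"
          using x(3) by simp_all
        then show "holds U \<phi> (x @ b) \<longleftrightarrow> holds U \<phi> (x' @ b)" using eq[OF x(1) _ b] eq[OF x(2) _ b] by simp
      qed
    qed
  qed
qed

lemma large_UN_chain:
  assumes "CC \<noteq> {}" "\<And>X. X \<in> CC \<Longrightarrow> large (g ` X)" "\<forall>X\<in>CC. \<forall>Y\<in>CC. X = Y \<or> X \<subseteq> Y \<or> Y \<subseteq> X"
  shows "large (g ` \<Union>CC)"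
  unfolding large_def
proof (intro allI impI)
  fix H assume "finite H" "H \<subseteq> g ` \<Union>CC"
  then obtain J where J: "finite J" "J \<subseteq> \<Union>CC" "H = g ` J"
    by (rule finite_subset_image[elim_format]) auto
  have "subset.chain CC CC" using assms(3) by (auto simp: subset_chain_def)
  then obtain X where "X \<in> CC" "J \<subseteq> X"
    using finite_subset_Union_chain[OF J(1,2) assms(1)] by blast
  then show "Big (\<lambda>x. \<forall>P\<in>H. P x)" using largeD[OF assms(2)[of X], of H] J \<open>finite H\<close> by blast
qed

definition decided_by :: "'u set \<Rightarrow> 'u list \<Rightarrow> ('f, 'r) fm \<Rightarrow> nat \<Rightarrow> ('f, 'r) fm \<Rightarrow> 'u list set \<Rightarrow> bool" where
  "decided_by B a \<phi> k \<zeta> A0 \<longleftrightarrow> (\<exists>e\<in>tuples B k. holds U \<zeta> (a @ e) \<and>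
     (\<forall>x\<in>V n. holds U \<zeta> (x @ e) \<longrightarrow> (\<forall>b\<in>A0. holds U \<phi> (x @ b) \<longleftrightarrow> holds U \<phi> (a @ b))))"

text \<open>The finitary form of compressibility: \<open>\<zeta>\<close> depends on
  \<open>\<phi>\<close> alone and its parameters come from the base.\<close>

definition uniformly_decided :: "'u set \<Rightarrow> 'u list \<Rightarrow> bool" where
  "uniformly_decided B a \<longleftrightarrow> (\<forall>m. \<forall>\<phi>\<in>fms L (n + m). \<exists>k. \<exists>\<zeta>\<in>fms L (n + k).
     \<forall>A0. finite A0 \<longrightarrow> A0 \<subseteq> tuples B m \<longrightarrow> decided_by B a \<phi> k \<zeta> A0)"

text \<open>If every \<open>\<zeta>\<close> failed for some \<open>A0\<close>, these finite sets would lie in a single stage of the chain,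
  whose successor contradicts the failure of its own \<open>\<zeta>\<close>. All stages have size at most \<open>|Pow Z|\<close>, so
  that their union is small also when \<open>\<kappa>\<close> is singular.\<close>

lemma uniform_type:
  assumes M: "small M" and p: "p \<subseteq> formulas_over L n M" "large (inst ` p)"
  shows "\<exists>B a. small B \<and> M \<subseteq> B \<and> C \<subseteq> B \<and> a \<in> V n \<and> large (tpp a B) \<and> (\<forall>q\<in>p. inst q a) \<and>
    uniformly_decided B a"
proof -
  define N where "N = M \<union> C"
  have smC: "small C" using C by (rule small_finite)
  have N: "small N" unfolding N_def by (rule small_Un[OF M smC])
  define Z where "Z = N <+> Fm L"
  have Z: "infinite Z" "|Z| <o \<kappa>" "|N| \<le>o |Z|" "|Fm L| \<le>o |Z|"
    using pad[of N] N unfolding Z_def small_subset_def by blast+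
  have PZ: "infinite (Pow Z)" "|Pow Z| <o \<kappa>" "|Z| \<le>o |Pow Z|"
    using Z(1) less_Pow[OF Z(2)] ordLess_imp_ordLeq[OF card_of_Pow[of Z]] by (simp_all add: finite_Pow_iff)
  have ZP: "|Fm L| \<le>o |Pow Z|" "|N| \<le>o |Pow Z|"
    using ordLeq_transitive[OF _ PZ(3)] Z(3,4) by blast+
  have sucZ: "cardSuc |Z| \<le>o |Pow Z|"
    \<comment> \<open>The length of the chain is at most |Pow Z|, and so is the size of its stages;
      hence so is the size of every union formed on the way.\<close>
    by (rule cardSuc_least[OF card_of_Card_order card_of_Card_order card_of_Pow])
  have MU: "M \<subseteq> univ U" using M by (simp add: small_subset_def)
  define P where "P s \<longleftrightarrow> p \<subseteq> s \<and> s \<subseteq> formulas_over L n (univ U) \<and> large (inst ` s) \<and> |s| \<le>o |Pow Z|" for s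
  define R where "R s s' \<longleftrightarrow> (\<forall>m. \<forall>\<phi>\<in>fms L (n + m). \<exists>H. finite H \<and> H \<subseteq> s' \<and> decides H \<phi> m (N \<union> params s))" for s s'
  have smN: "small (N \<union> params s)" if "P s" for s
  proof -
    have "|params s| <o \<kappa>" unfolding params_def
    proof (rule less_UN_finite)
      show "|s| <o \<kappa>" using that PZ(2) unfolding P_def by (blast intro: ordLeq_ordLess_trans)
    qed simp
    moreover have "params s \<subseteq> univ U" using that by (auto simp: P_def params_def formulas_over_def)
    ultimately have "small (params s)" by (simp add: small_subset_def)
    then show ?thesis using N small_Un by blast
  qed
  have "\<exists>W. P W \<and> p \<subseteq> W \<and> (\<forall>S\<subseteq>W. |S| \<le>o |Z| \<longrightarrow> (\<exists>X Y. S \<subseteq> X \<and> P X \<and> P Y \<and> R X Y \<and> X \<subseteq> Y \<and> Y \<subseteq> W))"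
  proof (rule cardSuc_chain[OF Z(1)])
    have pU: "p \<subseteq> formulas_over L n (univ U)" using p(1) MU by (fastforce simp: formulas_over_def)
    have "|p| \<le>o |formulas_over L n M|" using p(1) by (rule card_of_mono1)
    also have "|formulas_over L n M| \<le>o |Pow Z|"
    proof (rule card_formulas_over[OF PZ(1) ZP(1)])
      have "|M| \<le>o |N|" by (rule card_of_mono1) (simp add: N_def)
      then show "|M| \<le>o |Pow Z|" using ZP(2) by (rule ordLeq_transitive)
    qed
    finally show "P p" using pU p(2) by (simp add: P_def)
    fix X assume X: "P X"
    have "\<exists>s'. X \<subseteq> s' \<and> s' \<subseteq> formulas_over L n (univ U) \<and> large (inst ` s') \<and> |s'| \<le>o |Pow Z| \<and>
      (\<forall>m. \<forall>\<phi>\<in>fms L (n + m). \<exists>H. finite H \<and> H \<subseteq> s' \<and> decides H \<phi> m (N \<union> params X))"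
      using X smN[OF X] ZP(1) PZ(1) by (intro step_formulas) (auto simp: P_def N_def)
    then obtain s' where "X \<subseteq> s' \<and> s' \<subseteq> formulas_over L n (univ U) \<and> large (inst ` s') \<and> |s'| \<le>o |Pow Z| \<and>
      (\<forall>m. \<forall>\<phi>\<in>fms L (n + m). \<exists>H. finite H \<and> H \<subseteq> s' \<and> decides H \<phi> m (N \<union> params X))" by (elim exE)
    then show "\<exists>Y. P Y \<and> X \<subseteq> Y \<and> R X Y" using X unfolding P_def R_def by (intro exI[of _ s']) auto
  next
    fix CC assume CC: "CC \<noteq> {}" "|CC| \<le>o cardSuc |Z|" "\<forall>X\<in>CC. P X"
      "\<forall>X\<in>CC. \<forall>Y\<in>CC. X = Y \<or> X \<subseteq> Y \<or> Y \<subseteq> X"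
    have "|\<Union>X\<in>CC. X| \<le>o |Pow Z|"
      by (rule card_of_UNION_ordLeq_infinite[OF PZ(1) ordLeq_transitive[OF CC(2) sucZ]])
        (use CC(3) in \<open>simp add: P_def\<close>)
    then have "|\<Union>CC| \<le>o |Pow Z|" by simp
    moreover have "large (inst ` \<Union>CC)" by (rule large_UN_chain[OF CC(1) _ CC(4)]) (use CC(3) in \<open>simp add: P_def\<close>)
    ultimately show "P (\<Union>CC) \<and> (\<forall>X\<in>CC. X \<subseteq> \<Union>CC)" using CC(1,3) unfolding P_def by blast
  qed auto
  then obtain W where W': "P W \<and> p \<subseteq> W \<and>
    (\<forall>S\<subseteq>W. |S| \<le>o |Z| \<longrightarrow> (\<exists>X Y. S \<subseteq> X \<and> P X \<and> P Y \<and> R X Y \<and> X \<subseteq> Y \<and> Y \<subseteq> W))"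
    by (elim exE)
  note W = W'[THEN conjunct1] W'[THEN conjunct2, THEN conjunct1]
    W'[THEN conjunct2, THEN conjunct2, rule_format]
  define B where "B = N \<union> params W"
  have B: "small B" "M \<subseteq> B" "C \<subseteq> B" unfolding B_def using smN[OF W(1)] by (auto simp: N_def)
  have WU: "W \<subseteq> formulas_over L n (univ U)" "large (inst ` W)" using W(1) by (auto simp: P_def)
  have "\<exists>a\<in>V n. inst ` W \<subseteq> tpp a B \<and> large (tpp a B)"
  proof (rule large_complete[OF WU(2) _ B(1)])
    fix Q assume "Q \<in> inst ` W"
    then show "pd B n Q" using pd_inst[OF WU(1), of _ B] by (auto simp: B_def)
  qed
  then obtain a where a: "a \<in> V n" "inst ` W \<subseteq> tpp a B" "large (tpp a B)" by blast
  have aW: "inst q a" if "q \<in> W" for q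
  proof -
    have "inst q \<in> tpp a B" using a(2) that by blast
    then show ?thesis by (simp add: tpp_def)
  qed
  have unif: "\<exists>k. \<exists>\<zeta>\<in>fms L (n + k). \<forall>A0. finite A0 \<longrightarrow> A0 \<subseteq> tuples B m \<longrightarrow> decided_by B a \<phi> k \<zeta> A0"
    if \<phi>: "\<phi> \<in> fms L (n + m)" for m \<phi>
  proof (rule ccontr)
    assume neg: "\<not> ?thesis"
    define Idx where "Idx = (UNIV :: nat set) \<times> Fm L"
    have "\<forall>i\<in>Idx. \<exists>A0. finite A0 \<and> A0 \<subseteq> tuples B m \<and> (snd i \<in> fms L (n + fst i) \<longrightarrow> \<not> decided_by B a \<phi> (fst i) (snd i) A0)"
    proof
      fix i assume "i \<in> Idx"
      show "\<exists>A0. finite A0 \<and> A0 \<subseteq> tuples B m \<and> (snd i \<in> fms L (n + fst i) \<longrightarrow> \<not> decided_by B a \<phi> (fst i) (snd i) A0)"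
      proof (cases "snd i \<in> fms L (n + fst i)")
        case True
        then have "\<not> (\<forall>A0. finite A0 \<longrightarrow> A0 \<subseteq> tuples B m \<longrightarrow> decided_by B a \<phi> (fst i) (snd i) A0)"
          using neg by blast
        then show ?thesis by blast
      next
        case False
        then show ?thesis by (intro exI[of _ "{}"]) simp
      qed
    qed
    \<comment> \<open>One finite counterexample per candidate \<open>\<zeta>\<close>, so their
      entries together form a set \<open>S\<close> of size at most |Z|.\<close>
    from bchoice[OF this] obtain A where A: "\<forall>i\<in>Idx. finite (A i) \<and> A i \<subseteq> tuples B m \<and>
      (snd i \<in> fms L (n + fst i) \<longrightarrow> \<not> decided_by B a \<phi> (fst i) (snd i) (A i))" by (elim exE)
    define S where "S = (\<Union>i\<in>Idx. \<Union>b\<in>A i. set b)"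
    have "|Idx| \<le>o |Z|" unfolding Idx_def
      by (rule card_of_Sigma_ordLeq_infinite[OF Z(1) nat_ordLeq_infinite[OF Z(1)]]) (simp add: Z(4))
    then have cS: "|S| \<le>o |Z|" unfolding S_def
    proof (rule card_of_UNION_ordLeq_infinite[OF Z(1)])
      show "\<forall>i\<in>Idx. |\<Union>b\<in>A i. set b| \<le>o |Z|"
        using A by (intro ballI finite_ordLeq[OF Z(1)]) simp
    qed
    have SB: "S \<subseteq> B" using A unfolding S_def tuples_def by blast
    then have "\<forall>u\<in>S - N. \<exists>q. q \<in> W \<and> u \<in> set (snd q)" unfolding B_def params_def by blast
    \<comment> \<open>Stages are sets of formulas, not of elements; each element of \<open>S\<close>
      outside \<open>N\<close> is traced to a formula of \<open>W\<close> in which it is a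
      parameter.\<close>
    from bchoice[OF this] obtain g where g: "\<forall>u\<in>S - N. g u \<in> W \<and> u \<in> set (snd (g u))" by (elim exE)
    have "|g ` (S - N)| \<le>o |S - N|" by (rule card_of_image)
    also have "|S - N| \<le>o |S|" by (rule card_of_mono1) auto
    also note cS
    finally have gZ: "|g ` (S - N)| \<le>o |Z|" .
    have "g ` (S - N) \<subseteq> W" using g by blast
    from W(3)[OF this gZ]
    obtain X Y where XY': "g ` (S - N) \<subseteq> X \<and> P X \<and> P Y \<and> R X Y \<and> X \<subseteq> Y \<and> Y \<subseteq> W"
      by (elim exE)
    then have XY: "g ` (S - N) \<subseteq> X" "R X Y" "Y \<subseteq> W" by simp_all
    have SX: "S \<subseteq> N \<union> params X" using XY(1) g unfolding params_def by blast
    \<comment> \<open>\<open>Y\<close> comes after a stage whose parameters include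
      \<open>S\<close>, so one finite \<open>H\<close> handles every counterexample, among them the
      one chosen for the conjunction of \<open>H\<close> itself.\<close>
    obtain H where H: "finite H" "H \<subseteq> Y" "decides H \<phi> m (N \<union> params X)"
      using XY(2) \<phi> unfolding R_def by blast
    have HW: "H \<subseteq> W" using H(2) XY(3) by blast
    have "H \<subseteq> formulas_over L n B"
    proof
      fix q assume q: "q \<in> H"
      then have "q \<in> formulas_over L n (univ U)" "set (snd q) \<subseteq> B"
        using HW WU(1) unfolding B_def params_def by blast+
      then show "q \<in> formulas_over L n B" by (auto simp: formulas_over_def)
    qed
    from conj_over[OF H(1) this] obtain \<zeta> e where \<zeta>: "(\<zeta>, e) \<in> formulas_over L n B"
      "\<And>(N :: ('f, 'r, 'u) fo_struct) x. length x = n \<Longrightarrow> holds N \<zeta> (x @ e) \<longleftrightarrow> (\<forall>(\<phi>, b)\<in>H. holds N \<phi> (x @ b))"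
      by blast
    have ze: "holds U \<zeta> (x @ e) \<longleftrightarrow> (\<forall>q\<in>H. inst q x)" if "x \<in> V n" for x
      using \<zeta>(2)[of x U] that by (auto simp: inst_def tuples_def)
    let ?k = "length e"
    have \<zeta>f: "\<zeta> \<in> fms L (n + ?k)" "e \<in> tuples B ?k"
      using \<zeta>(1) by (auto simp: formulas_over_def tuples_def)
    have "(?k, \<zeta>) \<in> Idx" using \<zeta>f(1) by (simp add: Idx_def fms_def)
    then have Ai: "A (?k, \<zeta>) \<subseteq> tuples B m" "\<not> decided_by B a \<phi> ?k \<zeta> (A (?k, \<zeta>))"
      "\<Union>(set ` A (?k, \<zeta>)) \<subseteq> S" using A \<zeta>f(1) unfolding S_def by auto
    have aH: "\<forall>q\<in>H. inst q a" using aW HW by blast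
    have "decided_by B a \<phi> ?k \<zeta> (A (?k, \<zeta>))"
      unfolding decided_by_def
    proof (rule bexI[OF _ \<zeta>f(2)], intro conjI ballI impI)
      show "holds U \<zeta> (a @ e)" using ze[OF a(1)] aH by simp
      fix x b assume x: "x \<in> V n" "holds U \<zeta> (x @ e)" and b: "b \<in> A (?k, \<zeta>)"
      have "length b = m" using Ai(1) b by (auto simp: tuples_def)
      moreover have "set b \<subseteq> N \<union> params X" using Ai(3) b SX by blast
      ultimately have "b \<in> tuples (N \<union> params X) m" by (simp add: tuples_def)
      moreover have "\<forall>q\<in>H. inst q x" using ze[OF x(1)] x(2) by simp
      ultimately show "holds U \<phi> (x @ b) \<longleftrightarrow> holds U \<phi> (a @ b)"
        using H(3) x(1) a(1) aH unfolding decides_def by blast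
    qed
    then show False using Ai(2) by contradiction
  qed
  show ?thesis
  proof (intro exI[of _ B] exI[of _ a] conjI allI ballI)
    show "small B" "M \<subseteq> B" "C \<subseteq> B" "a \<in> V n" "large (tpp a B)" by (fact B a)+
    show "inst q a" if "q \<in> p" for q using that aW W(2) by blast
    show "uniformly_decided B a" unfolding uniformly_decided_def using unif by blast
  qed
qed

end

section \<open>Saturated extensions of pairs\<close>

lemma wf_tm_pair_lang: "wf_tm (pair_lang L n) t \<longleftrightarrow> (\<exists>i. t = Var i)"
  by (cases t) (auto simp: pair_lang_def)

lemma wf_tms_pair_lang:
  "(\<forall>t\<in>set ts. wf_tm (pair_lang L n) t) \<longleftrightarrow> (\<exists>is. ts = map Var is)"
proof
  assume "\<forall>t\<in>set ts. wf_tm (pair_lang L n) t"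
  then show "\<exists>is. ts = map Var is"
  proof (induction ts)
    case (Cons t ts)
    then obtain i "is" where "t = Var i" "ts = map Var is" by (auto simp: wf_tm_pair_lang)
    then show ?case by (intro exI[of _ "i # is"]) simp
  qed simp
qed (auto simp: wf_tm_pair_lang)

lemma wf_Rel_pair_lang:
  "wf_fm (pair_lang L n) (Rel r ts) \<longleftrightarrow>
     (\<exists>k \<phi> is. r = (k, \<phi>) \<and> \<phi> \<in> fms L (k + n) \<and> ts = map Var is \<and> length is = k)"
proof -
  obtain k \<phi> where r: "r = (k, \<phi>)" by force
  show ?thesis
    unfolding wf_fm.simps wf_tms_pair_lang by (auto simp: r pair_lang_def)
qed

fun depth :: "('f, 'r) fm \<Rightarrow> nat" where
  "depth (Eq s t) = 0"
| "depth (Rel r ts) = 0"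
| "depth (Neg \<phi>) = Suc (depth \<phi>)"
| "depth (Conj \<phi> \<psi>) = Suc (max (depth \<phi>) (depth \<psi>))"
| "depth (Exists \<phi>) = Suc (depth \<phi>)"

lemma card_Un_le: "infinite Z \<Longrightarrow> |A| \<le>o |Z| \<Longrightarrow> |B| \<le>o |Z| \<Longrightarrow> |A \<union> B| \<le>o |Z|"
  by (rule card_of_Un_ordLeq_infinite_Field[OF _ _ _ card_of_Card_order]) (simp_all add: Field_card_of)

lemma card_Times_le: "infinite Z \<Longrightarrow> |A| \<le>o |Z| \<Longrightarrow> |B| \<le>o |Z| \<Longrightarrow> |A \<times> B| \<le>o |Z|"
  by (rule card_of_Sigma_ordLeq_infinite) auto

lemma card_image_le: "|A| \<le>o |Z| \<Longrightarrow> |f ` A| \<le>o |Z|"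
  using card_of_image ordLeq_transitive by blast

text \<open>A predicate symbol consists of an arity and an \<open>L\<close>-formula, so the symbols
  are no more than |Z|; the formulas are counted layer by layer along \<open>depth\<close>.\<close>

lemma card_pair_formulas:
  assumes Z: "infinite Z" "|Fm L| \<le>o |Z|"
  shows "|Fm (pair_lang L n)| \<le>o |Z|"
proof -
  let ?W = "Fm (pair_lang L n)"
  let ?S = "\<lambda>d. {\<chi> \<in> ?W. depth \<chi> \<le> d}"
  have nat: "|UNIV :: nat set| \<le>o |Z|" by (rule nat_ordLeq_infinite[OF Z(1)])
  let ?E = "(\<lambda>(i, j). Eq (Var i) (Var j)) ` (UNIV \<times> UNIV)"
  let ?R = "(\<lambda>((k, \<phi>), is). Rel (k, \<phi>) (map Var is)) ` (((UNIV :: nat set) \<times> Fm L) \<times> lists UNIV)"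
  have E: "|?E| \<le>o |Z|" by (intro card_image_le card_Times_le Z(1) nat)
  have R: "|?R| \<le>o |Z|" by (intro card_image_le card_Times_le card_lists Z nat)
  have atoms: "\<chi> \<in> ?E \<union> ?R" if \<chi>: "\<chi> \<in> ?W" "depth \<chi> = 0" for \<chi>
  proof (cases \<chi>)
    case (Eq s t)
    then obtain i j where "s = Var i" "t = Var j" using \<chi> by (auto simp: wf_tm_pair_lang)
    then show ?thesis using Eq by (intro UnI1 image_eqI[of _ _ "(i, j)"]) auto
  next
    case (Rel r ts)
    then obtain k \<phi> "is" where "r = (k, \<phi>)" "\<phi> \<in> fms L (k + n)" "ts = map Var is"
      using \<chi>(1) unfolding mem_Collect_eq Rel wf_Rel_pair_lang by blast
    then show ?thesis using Rel by (intro UnI2 image_eqI[of _ _ "((k, \<phi>), is)"]) (auto simp: fms_def)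
  qed (use \<chi> in auto)
  have S: "|?S d| \<le>o |Z|" for d
  proof (induction d)
    case 0
    have "?S 0 \<subseteq> ?E \<union> ?R" using atoms by blast
    then show ?case using card_of_mono1 card_Un_le[OF Z(1) E R] ordLeq_transitive by blast
  next
    case (Suc d)
    let ?T = "(?E \<union> ?R) \<union> (Neg ` ?S d \<union> ((\<lambda>(\<phi>, \<psi>). Conj \<phi> \<psi>) ` (?S d \<times> ?S d) \<union> Exists ` ?S d))"
    have "?S (Suc d) \<subseteq> ?T"
    proof
      fix \<chi> assume \<chi>: "\<chi> \<in> ?S (Suc d)"
      show "\<chi> \<in> ?T"
      proof (cases "depth \<chi> = 0")
        case True
        then show ?thesis using \<chi> atoms by blast
      next
        case False
        then show ?thesis using \<chi> by (cases \<chi>) auto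
      qed
    qed
    moreover have "|?T| \<le>o |Z|"
      by (intro card_Un_le card_image_le card_Times_le Z(1) E R Suc)
    ultimately show ?case using card_of_mono1 ordLeq_transitive by blast
  qed
  have eq: "?W = (\<Union>d. ?S d)" by auto
  have "|\<Union>d. ?S d| \<le>o |Z|"
    by (rule card_of_UNION_ordLeq_infinite[OF Z(1) nat]) (use S in blast)
  then show ?thesis by (subst eq)
qed

text \<open>The equation that a power 2 to |Z| raised to |Z| is again 2 to |Z|. A nonempty set is
  coded by an enumeration along \<open>Z\<close>; with values in \<open>Pow Z\<close> this is a
  subset of \<open>Z \<times> Z\<close>, and \<open>g\<close> carries it into \<open>Z\<close>. The
  empty set has no enumeration and is added separately.\<close>

lemma card_bounded_subsets:
  fixes Z :: "'z set" and F :: "'a set"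
  assumes Z: "infinite Z" and F: "|F| \<le>o |Pow Z|"
  shows "|{t. t \<subseteq> F \<and> |t| \<le>o |Z|}| \<le>o |Pow Z|"
proof -
  obtain j where j: "inj_on j F" "j ` F \<subseteq> Pow Z" using F unfolding card_of_ordLeq[symmetric] by blast
  have "|Z \<times> Z| \<le>o |Z|" by (rule card_Times_le[OF Z]) (simp_all add: ordLeq_refl card_of_Card_order)
  then obtain g where g: "inj_on g (Z \<times> Z)" "g ` (Z \<times> Z) \<subseteq> Z" unfolding card_of_ordLeq[symmetric] by blast
  define code where "code f = g ` {(z, w). z \<in> Z \<and> w \<in> j (f z)}" for f
  have "\<forall>t\<in>{t. t \<subseteq> F \<and> |t| \<le>o |Z|} - {{}}. \<exists>f. f ` Z = t"
  proof
    fix t assume t: "t \<in> {t. t \<subseteq> F \<and> |t| \<le>o |Z|} - {{}}"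
    then have "\<exists>f. f ` Z = t" using card_of_ordLeq2[of t Z] by blast
    then show "\<exists>f. f ` Z = t" .
  qed
  from bchoice[OF this] obtain f where f: "\<forall>t\<in>{t. t \<subseteq> F \<and> |t| \<le>o |Z|} - {{}}. f t ` Z = t" by (elim exE)
  let ?T = "{t. t \<subseteq> F \<and> |t| \<le>o |Z|} - {{}}"
  have "inj_on (\<lambda>t. code (f t)) ?T"
  proof (rule inj_onI)
    fix t t' assume t: "t \<in> ?T" "t' \<in> ?T" and eq: "code (f t) = code (f t')"
    have ft: "f t ` Z = t" "f t' ` Z = t'" using f t by blast+
    have fF: "f t z \<in> F" "f t' z \<in> F" if "z \<in> Z" for z
      using imageI[OF that, of "f t"] imageI[OF that, of "f t'"] t unfolding ft by auto
    have "j x \<subseteq> Z" if "x \<in> F" for x using j(2) that by auto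
    then have jZ: "j (f t z) \<subseteq> Z \<and> j (f t' z) \<subseteq> Z" if "z \<in> Z" for z
      using fF[OF that] by simp
    have "{(z, w). z \<in> Z \<and> w \<in> j (f t z)} = {(z, w). z \<in> Z \<and> w \<in> j (f t' z)}"
    proof (rule inj_on_image_eq_iff[THEN iffD1, OF g(1)])
      show "g ` {(z, w). z \<in> Z \<and> w \<in> j (f t z)} = g ` {(z, w). z \<in> Z \<and> w \<in> j (f t' z)}"
        using eq by (simp add: code_def)
    qed (use jZ in auto)
    then have "j (f t z) = j (f t' z)" if "z \<in> Z" for z using that by blast
    then have "f t z = f t' z" if "z \<in> Z" for z
      using inj_onD[OF j(1) _ fF[OF that]] that by simp
    then show "t = t'" using ft by (metis image_cong)
  qed
  moreover have "(\<lambda>t. code (f t)) ` ?T \<subseteq> Pow Z"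
  proof
    fix Y assume "Y \<in> (\<lambda>t. code (f t)) ` ?T"
    then obtain t where t: "t \<in> ?T" "Y = code (f t)" by blast
    have "f t z \<in> F" if "z \<in> Z" for z
    proof -
      have "f t ` Z = t" using f t(1) by blast
      then show ?thesis using imageI[OF that, of "f t"] t(1) by auto
    qed
    then have "j (f t z) \<subseteq> Z" if "z \<in> Z" for z using j(2) that by auto
    then have "{(z, w). z \<in> Z \<and> w \<in> j (f t z)} \<subseteq> Z \<times> Z" by auto
    then have "g ` {(z, w). z \<in> Z \<and> w \<in> j (f t z)} \<subseteq> g ` (Z \<times> Z)" by (rule image_mono)
    then show "Y \<in> Pow Z" using g(2) unfolding t(2) code_def by simp
  qed
  ultimately have "|?T| \<le>o |Pow Z|" unfolding card_of_ordLeq[symmetric] by blast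
  moreover have "infinite (Pow Z)" using Z by (simp add: finite_Pow_iff)
  moreover have "|{{}} :: 'a set set| \<le>o |Pow Z|" using \<open>infinite (Pow Z)\<close> by (intro finite_ordLeq) auto
  ultimately have T: "|?T \<union> {{}}| \<le>o |Pow Z|" by (intro card_Un_le)
  have "|{t. t \<subseteq> F \<and> |t| \<le>o |Z|}| \<le>o |?T \<union> {{}}|" by (rule card_of_mono1) auto
  then show ?thesis using T by (rule ordLeq_transitive)
qed

section \<open>Elementary substructures of pair structures\<close>

locale paired = monster L U \<kappa> for L :: "('f, 'r) lang" and U :: "('f, 'r, 'u) fo_struct" and \<kappa> :: "'k rel" +
  fixes n :: nat and a :: "'u list"
  assumes a: "a \<in> V n"
begin

abbreviation "PL \<equiv> pair_lang L n"
abbreviation "PS X \<equiv> pair_struct U X a"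

lemma univ_PS [simp]: "univ (PS X) = X"
  by (simp add: pair_struct_def)

lemma sat_PS_Rel:
  assumes "\<And>i. i \<in> set is \<Longrightarrow> v i \<in> X" "length is = k"
  shows "sat (PS X) v (Rel (k, \<phi>) (map Var is)) \<longleftrightarrow> holds U \<phi> (map v is @ a)"
  using assms by (auto simp: pair_struct_def tuples_def comp_def)

text \<open>Elementarity is expressed by infinite assignments instead of lists, which suits
  inductions through \<open>Exists\<close>; nonemptiness allows a list to be padded to an
  assignment.\<close>

definition le :: "'u set \<Rightarrow> 'u set \<Rightarrow> bool" where
  "le X Y \<longleftrightarrow> X \<noteq> {} \<and> X \<subseteq> Y \<and> (\<forall>\<chi> v. wf_fm PL \<chi> \<longrightarrow> range v \<subseteq> X \<longrightarrow> (sat (PS X) v \<chi> \<longleftrightarrow> sat (PS Y) v \<chi>))"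

lemma leD: "le X Y \<Longrightarrow> wf_fm PL \<chi> \<Longrightarrow> range v \<subseteq> X \<Longrightarrow> sat (PS X) v \<chi> \<longleftrightarrow> sat (PS Y) v \<chi>"
  by (simp add: le_def)

lemma le_sub: "le X Y \<Longrightarrow> X \<subseteq> Y"
  by (simp add: le_def)

lemma le_trans: assumes "le X Y" "le Y W" shows "le X W"
proof -
  have "sat (PS X) v \<chi> \<longleftrightarrow> sat (PS W) v \<chi>" if "wf_fm PL \<chi>" "range v \<subseteq> X" for \<chi> v
    using leD[OF assms(1) that] leD[OF assms(2) that(1), of v] that(2) le_sub[OF assms(1)] by auto
  then show ?thesis using assms unfolding le_def by auto
qed

lemma le_within: assumes "le X W" "le Y W" "X \<subseteq> Y" shows "le X Y"
proof -
  have "sat (PS X) v \<chi> \<longleftrightarrow> sat (PS Y) v \<chi>" if "wf_fm PL \<chi>" "range v \<subseteq> X" for \<chi> v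
    using leD[OF assms(1) that] leD[OF assms(2) that(1), of v] that(2) assms(3) by auto
  then show ?thesis using assms unfolding le_def by auto
qed

lemma sat_list:
  assumes "\<chi> \<in> fms PL (length as)" "\<And>i. i < length as \<Longrightarrow> v i = as ! i"
  shows "holds N \<chi> as \<longleftrightarrow> sat N v \<chi>"
  unfolding holds_def by (rule sat_cong) (use assms in \<open>auto simp: fms_def\<close>)

lemma le_holds:
  assumes "le X Y" "\<chi> \<in> fms PL (length as)" "set as \<subseteq> X"
  shows "holds (PS X) \<chi> as \<longleftrightarrow> holds (PS Y) \<chi> as"
proof -
  obtain x where x: "x \<in> X" using assms(1) by (auto simp: le_def)
  define v where "v i = (if i < length as then as ! i else x)" for i
  have "range v \<subseteq> X" using assms(3) x by (auto simp: v_def)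
  then have "sat (PS X) v \<chi> \<longleftrightarrow> sat (PS Y) v \<chi>"
    using leD[OF assms(1)] assms(2) by (simp add: fms_def)
  then show ?thesis using sat_list[OF assms(2), of v] by (simp add: v_def)
qed

lemma tarski_vaught:
  assumes "X \<noteq> {}" "X \<subseteq> Y"
    and ex: "\<And>\<chi> v. wf_fm PL \<chi> \<Longrightarrow> range v \<subseteq> X \<Longrightarrow> \<exists>u\<in>Y. sat (PS Y) (case_nat u v) \<chi> \<Longrightarrow>
      \<exists>u\<in>X. sat (PS Y) (case_nat u v) \<chi>"
  shows "le X Y"
proof -
  have "range v \<subseteq> X \<Longrightarrow> sat (PS X) v \<chi> \<longleftrightarrow> sat (PS Y) v \<chi>" if "wf_fm PL \<chi>" for \<chi> v
    using that
  proof (induction \<chi> arbitrary: v)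
    case (Eq s t)
    then show ?case by (auto simp: wf_tm_pair_lang)
  next
    case (Rel r ts)
    then obtain k \<phi> "is" where "r = (k, \<phi>)" "ts = map Var is" "length is = k"
      unfolding wf_Rel_pair_lang by blast
    moreover have "\<And>i. v i \<in> X" "\<And>i. v i \<in> Y" using Rel.prems(1) assms(2) by auto
    ultimately show ?case by (simp only: sat_PS_Rel)
  next
    case (Exists \<chi>)
    have r: "range (case_nat u v) \<subseteq> X" if "u \<in> X" for u
      using that Exists.prems(1) by (auto split: nat.splits simp: image_subset_iff)
    have "sat (PS X) v (Exists \<chi>) \<longleftrightarrow> (\<exists>u\<in>X. sat (PS Y) (case_nat u v) \<chi>)"
      using Exists.IH[OF r] Exists.prems(2) by simp
    also have "\<dots> \<longleftrightarrow> (\<exists>u\<in>Y. sat (PS Y) (case_nat u v) \<chi>)"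
      using ex[of \<chi> v] Exists.prems assms(2) by auto
    finally show ?case by simp
  qed auto
  then show ?thesis using assms(1,2) by (simp add: le_def)
qed

lemma loewenheim_skolem:
  assumes Z: "infinite Z" "|Fm PL| \<le>o |Z|" and S: "S \<subseteq> Y" "|S| \<le>o |Z|" "Y \<noteq> {}"
  shows "\<exists>X. S \<subseteq> X \<and> |X| \<le>o |Z| \<and> le X Y"
proof -
  obtain y0 where y0: "y0 \<in> Y" using S(3) by blast
  \<comment> \<open>Skolem functions on lists, with the default \<open>y0\<close> where no witness
    exists, so that their values never leave \<open>Y\<close>.\<close>
  define sk where "sk \<chi> as = (if \<exists>u\<in>Y. holds (PS Y) \<chi> (u # as) then SOME u. u \<in> Y \<and> holds (PS Y) \<chi> (u # as) else y0)"
    for \<chi> as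
  have sk: "sk \<chi> as \<in> Y \<and> ((\<exists>u\<in>Y. holds (PS Y) \<chi> (u # as)) \<longrightarrow> holds (PS Y) \<chi> (sk \<chi> as # as))" for \<chi> as
  proof (cases "\<exists>u\<in>Y. holds (PS Y) \<chi> (u # as)")
    case True
    then have "\<exists>u. u \<in> Y \<and> holds (PS Y) \<chi> (u # as)" by blast
    from someI_ex[OF this] True show ?thesis by (simp add: sk_def)
  qed (use y0 in \<open>simp add: sk_def\<close>)
  define St where "St X = X \<union> (\<lambda>(\<chi>, as). sk \<chi> as) ` (Fm PL \<times> lists X)" for X
  define Xs where "Xs k = (St ^^ k) (insert y0 S)" for k
  have Xs_Suc: "Xs (Suc k) = Xs k \<union> (\<lambda>(\<chi>, as). sk \<chi> as) ` (Fm PL \<times> lists (Xs k))" for k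
    by (simp add: Xs_def St_def)
  have card: "|Xs k| \<le>o |Z|" for k
  proof (induction k)
    case 0
    have "|{y0} \<union> S| \<le>o |Z|" by (intro card_Un_le Z(1) finite_ordLeq S(2)) simp
    then show ?case by (simp add: Xs_def)
  next
    case (Suc k)
    show ?case unfolding Xs_Suc by (intro card_Un_le card_image_le card_Times_le card_lists Z Suc)
  qed
  have XY: "Xs k \<subseteq> Y" for k
  proof (induction k)
    case (Suc k)
    then show ?case unfolding Xs_Suc using sk by auto
  qed (use y0 S(1) in \<open>simp add: Xs_def\<close>)
  have mono: "i \<le> j \<Longrightarrow> Xs i \<subseteq> Xs j" for i j
    by (rule lift_Suc_mono_le[of Xs]) (auto simp: Xs_Suc)
  define X where "X = (\<Union>k. Xs k)"
  have "le X Y"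
  proof (rule tarski_vaught)
    show "X \<noteq> {}" unfolding X_def by (auto simp: Xs_def intro: exI[of _ 0])
    show "X \<subseteq> Y" unfolding X_def using XY by blast
    fix \<chi> v assume \<chi>: "wf_fm PL \<chi>" and v: "range v \<subseteq> X" and ex: "\<exists>u\<in>Y. sat (PS Y) (case_nat u v) \<chi>"
    \<comment> \<open>Index 0 is reserved for the witness; the other free variables refer to the
      first \<open>k\<close> values of \<open>v\<close>.\<close>
    obtain k where k: "\<forall>i\<in>fv \<chi>. i < Suc k"
      using finite_nat_set_iff_bounded[of "fv \<chi>"] finite_fv[of \<chi>] by (meson less_SucI)
    let ?as = "map v [0..<k]"
    have conv: "holds (PS Y) \<chi> (u # ?as) \<longleftrightarrow> sat (PS Y) (case_nat u v) \<chi>" for u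
      by (rule sat_list) (use \<chi> k in \<open>auto simp: fms_def nth_Cons split: nat.splits\<close>)
    have "\<exists>j. set ?as \<subseteq> Xs j"
    proof (rule ccontr)
      have "\<forall>i<k. \<exists>j. v i \<in> Xs j" using v unfolding X_def by blast
      then obtain f where f: "\<forall>i<k. v i \<in> Xs (f i)" by metis
      have "v i \<in> Xs (Max (f ` {..<k}))" if "i < k" for i
        using f that mono[of "f i" "Max (f ` {..<k})"] by auto
      then have "set ?as \<subseteq> Xs (Max (f ` {..<k}))" by auto
      moreover assume "\<nexists>j. set ?as \<subseteq> Xs j"
      ultimately show False by blast
    qed
    then obtain j where j: "set ?as \<subseteq> Xs j" by blast
    have "sk \<chi> ?as \<in> Xs (Suc j)" unfolding Xs_Suc using \<chi> j by (intro UnI2 image_eqI[of _ _ "(\<chi>, ?as)"]) auto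
    then have "sk \<chi> ?as \<in> X" unfolding X_def by blast
    moreover have "sat (PS Y) (case_nat (sk \<chi> ?as) v) \<chi>" using sk[of \<chi> ?as] ex conv by blast
    ultimately show "\<exists>u\<in>X. sat (PS Y) (case_nat u v) \<chi>" by blast
  qed
  moreover have "|X| \<le>o |Z|" unfolding X_def
    by (rule card_of_UNION_ordLeq_infinite[OF Z(1) nat_ordLeq_infinite[OF Z(1)]]) (use card in blast)
  moreover have "S \<subseteq> X"
  proof -
    have "S \<subseteq> Xs 0" by (auto simp: Xs_def)
    then show ?thesis unfolding X_def by blast
  qed
  ultimately show ?thesis by blast
qed

lemma le_refl: "X \<noteq> {} \<Longrightarrow> le X X"
  by (simp add: le_def)

text \<open>Tarski's theorem on elementary chains. A witness in the union lies in a member; the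
  larger of that member and \<open>X\<close> is again in \<open>CC\<close>, and elementarity pulls
  existence back to \<open>X\<close>.\<close>

lemma le_Union:
  assumes CC: "CC \<noteq> {}" "\<And>X. X \<in> CC \<Longrightarrow> X \<noteq> {}" "\<forall>X\<in>CC. \<forall>Y\<in>CC. X = Y \<or> le X Y \<or> le Y X"
    and X: "X \<in> CC"
  shows "le X (\<Union>CC)"
proof -
  have "X \<in> CC \<Longrightarrow> range v \<subseteq> X \<Longrightarrow> sat (PS X) v \<chi> \<longleftrightarrow> sat (PS (\<Union>CC)) v \<chi>" if "wf_fm PL \<chi>" for X v \<chi>
    using that
  proof (induction \<chi> arbitrary: v X)
    case (Eq s t)
    then show ?case by (auto simp: wf_tm_pair_lang)
  next
    case (Rel r ts)
    then obtain k \<phi> "is" where "r = (k, \<phi>)" "ts = map Var is" "length is = k"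
      unfolding wf_Rel_pair_lang by blast
    moreover have "\<And>i. v i \<in> X" "\<And>i. v i \<in> \<Union>CC" using Rel.prems(1,2) by auto
    ultimately show ?case by (simp only: sat_PS_Rel)
  next
    case (Exists \<chi>)
    have r: "range (case_nat u v) \<subseteq> Y" if "u \<in> Y" "X \<subseteq> Y" for u Y
      using that Exists.prems(2) by (auto split: nat.splits simp: image_subset_iff)
    have wf: "wf_fm PL \<chi>" using Exists.prems(3) by simp
    have "(\<exists>u\<in>\<Union>CC. sat (PS (\<Union>CC)) (case_nat u v) \<chi>) \<Longrightarrow> \<exists>u\<in>X. sat (PS X) (case_nat u v) \<chi>"
    proof -
      assume "\<exists>u\<in>\<Union>CC. sat (PS (\<Union>CC)) (case_nat u v) \<chi>"
      then obtain u Y where u: "Y \<in> CC" "u \<in> Y" "sat (PS (\<Union>CC)) (case_nat u v) \<chi>" by blast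
      have "X = Y \<or> le X Y \<or> le Y X" using CC(3) u(1) Exists.prems(1) by blast
      then obtain Y' where Y': "Y' \<in> CC" "u \<in> Y'" "le X Y'"
        using u(1,2) Exists.prems(1) le_sub le_refl CC(2) by blast
      have "sat (PS Y') (case_nat u v) \<chi>"
        using Exists.IH[OF Y'(1) r[OF Y'(2) le_sub[OF Y'(3)]] wf] u(3) by simp
      then have "sat (PS Y') v (Exists \<chi>)" using Y'(2) by auto
      then have "sat (PS X) v (Exists \<chi>)" using leD[OF Y'(3) Exists.prems(3,2)] by blast
      then show ?thesis by simp
    qed
    moreover have "(\<exists>u\<in>X. sat (PS X) (case_nat u v) \<chi>) \<Longrightarrow> (\<exists>u\<in>\<Union>CC. sat (PS (\<Union>CC)) (case_nat u v) \<chi>)"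
      using Exists.IH[OF Exists.prems(1) r[OF _ order_refl] wf] Exists.prems(1) by blast
    ultimately show ?case by auto
  qed auto
  then show ?thesis using X CC(2) by (auto simp: le_def)
qed

end

section \<open>Ultrapowers realized inside the monster model\<close>

context paired begin

definition fin_sat :: "'u set \<Rightarrow> nat \<Rightarrow> (('f, nat \<times> ('f, 'r) fm) fm \<times> 'u list) set \<Rightarrow> bool" where
  "fin_sat X k t \<longleftrightarrow> (\<forall>t0. finite t0 \<longrightarrow> t0 \<subseteq> t \<longrightarrow> (\<exists>x\<in>tuples X k. \<forall>(\<chi>, b)\<in>t0. holds (PS X) \<chi> (x @ b)))"

definition realized_in :: "'u set \<Rightarrow> nat \<Rightarrow> (('f, nat \<times> ('f, 'r) fm) fm \<times> 'u list) set \<Rightarrow> bool" where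
  "realized_in Y k t \<longleftrightarrow> (\<exists>y\<in>tuples Y k. \<forall>(\<chi>, b)\<in>t. holds (PS Y) \<chi> (y @ b))"

text \<open>The ultrapower itself is never formed: its elements are represented by functions \<open>f\<close>, and \<open>h\<close>
  realizes their joint type inside \<open>U\<close>.\<close>

lemma embed_ultrapower:
  fixes I :: "'i set" and E :: "'u set"
  assumes D: "ultrafilter I D" and E: "E \<subseteq> univ U" and small: "|Func I E| <o \<kappa>"
  shows "\<exists>h. (\<forall>f\<in>Func I E. h f \<in> univ U) \<and>
    (\<forall>x\<in>E. h (\<lambda>i. if i \<in> I then x else undefined) = x) \<and>
    (\<forall>fs\<in>lists (Func I E). \<forall>\<phi>\<in>fms L (length fs).
       holds U \<phi> (map h fs) \<longleftrightarrow> ev I D (\<lambda>i. holds U \<phi> (map (\<lambda>f. f i) fs)))"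
proof -
  let ?F = "Func I E"
  define cst where "cst x = (\<lambda>i. if i \<in> I then x else undefined)" for x :: 'u
  have cst: "cst x \<in> ?F" if "x \<in> E" for x using that by (auto simp: cst_def Func_def)
  \<comment> \<open>The theorem of Los, demanded of a relation between functions and elements. Lists
    with repetitions are included, so equality formulas make the relation single-valued.\<close>
  define Q where "Q g \<longleftrightarrow> (\<forall>ps\<in>lists g. \<forall>\<phi>\<in>fms L (length ps).
      holds U \<phi> (map snd ps) \<longleftrightarrow> ev I D (\<lambda>i. holds U \<phi> (map (\<lambda>p. fst p i) ps)))" for g :: "(('i \<Rightarrow> 'u) \<times> 'u) set"
  let ?C = "(\<lambda>x. (cst x, x)) ` E"
  have "\<exists>g. fin_maximal Q ?C (?F \<times> univ U) g"
  proof (rule tukey)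
    show "Q H'" if "Q H" "H' \<subseteq> H" for H H'
      using that lists_mono[OF that(2)] unfolding Q_def by blast
    show "?C \<subseteq> ?F \<times> univ U" using cst E by auto
    fix H assume H: "H \<subseteq> ?C"
    show "Q H"
      unfolding Q_def
    proof (intro ballI)
      fix ps \<phi> assume ps: "ps \<in> lists H"
      have eq: "map (\<lambda>p. fst p i) ps = map snd ps" if "i \<in> I" for i
        using ps H that by (auto simp: cst_def)
      have "ev I D (\<lambda>i. holds U \<phi> (map (\<lambda>p. fst p i) ps)) \<longleftrightarrow> ev I D (\<lambda>i. holds U \<phi> (map snd ps))"
        by (rule ev_cong) (simp only: eq)
      then show "holds U \<phi> (map snd ps) \<longleftrightarrow> ev I D (\<lambda>i. holds U \<phi> (map (\<lambda>p. fst p i) ps))"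
        by (simp add: ev_const[OF D])
    qed
  qed
  then obtain g where "fin_maximal Q ?C (?F \<times> univ U) g" by (elim exE)
  note g = this[unfolded fin_maximal_def]
  note gC = g[THEN conjunct1] and gF = g[THEN conjunct2, THEN conjunct1]
    and gQ = g[THEN conjunct2, THEN conjunct2, THEN conjunct1, rule_format]
    and gmax = g[THEN conjunct2, THEN conjunct2, THEN conjunct2, rule_format, OF DiffI]
  have Qg: "holds U \<phi> (map snd ps) \<longleftrightarrow> ev I D (\<lambda>i. holds U \<phi> (map (\<lambda>p. fst p i) ps))"
    if "ps \<in> lists g" "\<phi> \<in> fms L (length ps)" for ps \<phi>
  proof -
    have "Q (set ps)" using that(1) by (intro gQ) auto
    moreover have "ps \<in> lists (set ps)" by auto
    ultimately show ?thesis using that(2) unfolding Q_def by blast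
  qed
  have sv: "u = u'" if "(f, u) \<in> g" "(f, u') \<in> g" for f u u'
  proof -
    have "holds U (Eq (Var 0) (Var 1)) (map snd [(f, u), (f, u')]) \<longleftrightarrow>
        ev I D (\<lambda>i. holds U (Eq (Var 0) (Var 1)) (map (\<lambda>p. fst p i) [(f, u), (f, u')]))"
      by (rule Qg) (use that in \<open>auto simp: fms_def\<close>)
    moreover have "ev I D (\<lambda>i. holds U (Eq (Var 0) (Var 1)) (map (\<lambda>p. fst p i) [(f, u), (f, u')]))"
      by (rule ev_True[OF D]) (simp add: holds_def)
    ultimately show ?thesis by (simp add: holds_def)
  qed
  have "inj_on fst g"
  proof (rule inj_onI)
    fix x y assume "x \<in> g" "y \<in> g" "fst x = fst y"
    then show "x = y" using sv[of "fst x" "snd x" "snd y"] by (cases x; cases y) simp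
  qed
  moreover have "fst ` g \<subseteq> ?F" using gF by auto
  ultimately have "|g| \<le>o |?F|" unfolding card_of_ordLeq[symmetric] by (intro exI[of _ fst] conjI)
  then have "|snd ` g| \<le>o |?F|" by (rule card_image_le)
  then have sg: "small (snd ` g)" using small gF unfolding small_subset_def
    by (auto intro: ordLeq_ordLess_trans)
  \<comment> \<open>A function left out by a maximal \<open>g\<close> would be added: the formulas
    that hold almost everywhere along \<open>f\<close> form a set over the small range of
    \<open>g\<close>, which saturation realizes.\<close>
  have total: "\<exists>u. (f, u) \<in> g" if f: "f \<in> ?F" for f
  proof (rule ccontr)
    assume nf: "\<nexists>u. (f, u) \<in> g"
    have fi: "f i \<in> univ U" if "i \<in> I" for i using f E that by (auto simp: Func_def)
    define pp where "pp = {(\<phi>, ps). ps \<in> lists g \<and> \<phi> \<in> fms L (1 + length ps) \<and>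
        ev I D (\<lambda>i. holds U \<phi> ([f i] @ map (\<lambda>p. fst p i) ps))}"
    let ?p = "(\<lambda>(\<phi>, ps). (\<phi>, map snd ps)) ` pp"
    have "\<exists>x\<in>V 1. \<forall>(\<phi>, b)\<in>?p. holds U \<phi> (x @ b)"
    proof (rule realize_formulas[OF sg])
      show "?p \<subseteq> formulas_over L 1 (snd ` g)"
      proof
        fix q assume "q \<in> ?p"
        then obtain \<phi> ps where q: "q = (\<phi>, map snd ps)" "ps \<in> lists g" "\<phi> \<in> fms L (1 + length ps)"
          by (auto simp: pp_def)
        have "map snd ps \<in> lists (snd ` g)" unfolding lists_image using q(2) by (rule imageI)
        then show "q \<in> formulas_over L 1 (snd ` g)" using q(1,3) by (simp add: formulas_over_def)
      qed
      fix p0 assume "finite p0" "p0 \<subseteq> ?p"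
      then obtain q0 where q0: "finite q0" "q0 \<subseteq> pp" "p0 = (\<lambda>(\<phi>, ps). (\<phi>, map snd ps)) ` q0"
        by (rule finite_subset_image[elim_format]) auto
      have "q0 \<subseteq> formulas_over L 1 g" using q0(2) by (auto simp: pp_def formulas_over_def)
      from conj_over_map[OF q0(1) this] obtain \<chi> qs where \<chi>: "(\<chi>, qs) \<in> formulas_over L 1 g"
        "\<forall>(N :: ('f, 'r, 'u) fo_struct) h x. length x = 1 \<longrightarrow>
           (holds N \<chi> (x @ map h qs) \<longleftrightarrow> (\<forall>(\<phi>, b)\<in>q0. holds N \<phi> (x @ map h b)))"
        by blast
      have "ev I D (\<lambda>i. \<forall>q\<in>q0. holds U (fst q) ([f i] @ map (\<lambda>p. fst p i) (snd q)))"
        unfolding ev_ball_finite[OF D q0(1)] using q0(2) by (auto simp: pp_def)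
      \<comment> \<open>The values \<open>f i\<close> witness \<open>\<chi>\<close> coordinatewise;
        its existential closure is a formula about \<open>g\<close> alone and transfers to
        \<open>U\<close>.\<close>
      then have "ev I D (\<lambda>i. holds U (Exists \<chi>) (map (\<lambda>p. fst p i) qs))"
      proof (rule ev_mono[OF D])
        fix i assume i: "i \<in> I" "\<forall>q\<in>q0. holds U (fst q) ([f i] @ map (\<lambda>p. fst p i) (snd q))"
        then have "\<forall>(\<phi>, b)\<in>q0. holds U \<phi> ([f i] @ map (\<lambda>p. fst p i) b)" by (simp add: case_prod_beta)
        then have "holds U \<chi> ([f i] @ map (\<lambda>p. fst p i) qs)"
          using \<chi>(2)[rule_format, where N = U and h = "\<lambda>p. fst p i" and x = "[f i]"] by simp
        then show "holds U (Exists \<chi>) (map (\<lambda>p. fst p i) qs)" using fi[OF i(1)] by (auto simp: holds_Exists)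
      qed
      moreover have "qs \<in> lists g" "Exists \<chi> \<in> fms L (length qs)"
        using \<chi>(1) by (auto simp: formulas_over_def)
      ultimately have "holds U (Exists \<chi>) (map snd qs)" using Qg by blast
      then obtain u where u: "u \<in> univ U" "holds U \<chi> ([u] @ map snd qs)" by (auto simp: holds_Exists)
      then have "\<forall>(\<phi>, b)\<in>q0. holds U \<phi> ([u] @ map snd b)"
        using \<chi>(2)[rule_format, where N = U and h = snd and x = "[u]"] by simp
      then have "\<forall>(\<phi>, b)\<in>p0. holds U \<phi> ([u] @ b)" unfolding q0(3) by auto
      then show "\<exists>x\<in>V 1. \<forall>(\<phi>, b)\<in>p0. holds U \<phi> (x @ b)"
        using u(1) by (intro bexI[of _ "[u]"]) (auto simp: tuples_def)
    qed
    then obtain x where x: "x \<in> V 1" "\<forall>(\<phi>, b)\<in>?p. holds U \<phi> (x @ b)" by blast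
    then obtain u where u: "x = [u]" "u \<in> univ U"
      by (auto simp: tuples_def length_Suc_conv)
    have uQ1: "holds U \<phi> ([u] @ map snd ps)"
      if "ps \<in> lists g" "\<phi> \<in> fms L (1 + length ps)" "ev I D (\<lambda>i. holds U \<phi> ([f i] @ map (\<lambda>p. fst p i) ps))" for ps \<phi>
    proof -
      have "(\<phi>, ps) \<in> pp" using that by (simp add: pp_def)
      then have "(\<phi>, map snd ps) \<in> ?p" by (rule image_eqI[rotated]) simp
      then show ?thesis using x(2) u(1) by blast
    qed
    have uQ: "holds U \<phi> ([u] @ map snd ps) \<longleftrightarrow> ev I D (\<lambda>i. holds U \<phi> ([f i] @ map (\<lambda>p. fst p i) ps))"
      if "ps \<in> lists g" "\<phi> \<in> fms L (1 + length ps)" for ps \<phi>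
      using uQ1[OF that] uQ1[OF that(1), of "Neg \<phi>"] that(2) ev_not[OF D, of "\<lambda>i. holds U \<phi> ([f i] @ map (\<lambda>p. fst p i) ps)"]
      by auto
    have "(f, u) \<in> ?F \<times> univ U" "(f, u) \<notin> g" using f u(2) nf by auto
    from gmax[OF this] obtain H where H: "finite H \<and> H \<subseteq> g \<and> \<not> Q (insert (f, u) H)" by (elim exE)
    obtain ps where ps: "set ps = H" using H finite_list by blast
    have psg: "ps \<in> lists g" using ps H by auto
    have "Q (insert (f, u) H)"
      unfolding Q_def
    proof (intro ballI)
      fix qs \<phi> assume qs: "qs \<in> lists (insert (f, u) H)" and \<phi>: "\<phi> \<in> fms L (length qs)"
      \<comment> \<open>The list may repeat or omit entries; renaming variables reduces it to the
        standard list headed by the new pair.\<close>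
      have "set qs \<subseteq> set ((f, u) # ps)" using qs ps by auto
      then obtain js where js: "qs = map ((!) ((f, u) # ps)) js" "\<forall>j\<in>set js. j < length ((f, u) # ps)"
        by (rule lists_select)
      let ?\<psi> = "ren ((!) js) \<phi>"
      have \<psi>: "?\<psi> \<in> fms L (1 + length ps)"
        by (rule fms_ren[OF \<phi>]) (use js in auto)
      have r: "holds U ?\<psi> (map k ((f, u) # ps)) \<longleftrightarrow> holds U \<phi> (map k qs)" for k :: "('i \<Rightarrow> 'u) \<times> 'u \<Rightarrow> 'u"
        by (rule holds_ren[OF \<phi>]) (use js in \<open>auto simp del: list.map nth_Cons_Suc\<close>)
      have "holds U \<phi> (map snd qs) \<longleftrightarrow> holds U ?\<psi> ([u] @ map snd ps)" using r[of snd] by simp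
      also have "\<dots> \<longleftrightarrow> ev I D (\<lambda>i. holds U ?\<psi> ([f i] @ map (\<lambda>p. fst p i) ps))" by (rule uQ[OF psg \<psi>])
      also have "\<dots> \<longleftrightarrow> ev I D (\<lambda>i. holds U \<phi> (map (\<lambda>p. fst p i) qs))" using r[of "\<lambda>p. fst p _"] by (intro ev_cong) simp
      finally show "holds U \<phi> (map snd qs) \<longleftrightarrow> ev I D (\<lambda>i. holds U \<phi> (map (\<lambda>p. fst p i) qs))" .
    qed
    then show False using H by blast
  qed
  define h where "h f = (SOME u. (f, u) \<in> g)" for f
  have h: "(f, h f) \<in> g" if "f \<in> ?F" for f
    unfolding h_def by (rule someI_ex[OF total[OF that]])
  show ?thesis
  proof (rule exI[of _ h], intro conjI ballI)
    show "h f \<in> univ U" if "f \<in> ?F" for f using h[OF that] gF by auto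
    show "h (\<lambda>i. if i \<in> I then x else undefined) = x" if "x \<in> E" for x
      using sv[OF h[OF cst[OF that]], of x] gC that by (auto simp: cst_def)
    fix fs \<phi> assume fs: "fs \<in> lists ?F" and \<phi>: "\<phi> \<in> fms L (length fs)"
    let ?ps = "map (\<lambda>f. (f, h f)) fs"
    have "holds U \<phi> (map snd ?ps) \<longleftrightarrow> ev I D (\<lambda>i. holds U \<phi> (map (\<lambda>p. fst p i) ?ps))"
      by (rule Qg) (use fs \<phi> h in auto)
    then show "holds U \<phi> (map h fs) \<longleftrightarrow> ev I D (\<lambda>i. holds U \<phi> (map (\<lambda>f. f i) fs))"
      by (simp add: comp_def)
  qed
qed

text \<open>The indices are the finite sets of formulas over \<open>X\<close>, and the ultrafilter
  contains, for each formula, the indices to which it belongs. Choosing at each index a solution of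
  its part of \<open>t\<close> gives a solution of all of \<open>t\<close>.\<close>

lemma ultrapower_extension:
  assumes X: "X \<noteq> {}" "small X"
  shows "\<exists>Y. Y \<subseteq> univ U \<and> le X Y \<and>
    (\<forall>k t. t \<subseteq> formulas_over PL k X \<longrightarrow> fin_sat X k t \<longrightarrow> realized_in Y k t)"
proof -
  obtain x0 where x0: "x0 \<in> X" using X(1) by blast
  define F where "F = Fm PL \<times> lists X"
  define I where "I = {i. finite i \<and> i \<subseteq> F}"
  \<comment> \<open>The predicates of the pair language mention \<open>a\<close>, so its entries
    need constant functions, although \<open>Y\<close> is built from functions into \<open>X\<close>
    only.\<close>
  let ?E = "X \<union> set a"
  have "|Fm PL| <o \<kappa>"
    using card_pair_formulas[OF infinite_wf ordLeq_refl[OF card_of_Card_order]] few by (rule ordLeq_ordLess_trans)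
  then have "|F| <o \<kappa>" unfolding F_def using X(2)
    by (intro less_Times less_lists) (simp_all add: small_subset_def)
  moreover have "|I| \<le>o |Pow F|" by (rule card_of_mono1) (auto simp: I_def)
  ultimately have I: "|I| <o \<kappa>" using less_Pow ordLeq_ordLess_trans by blast
  have sE: "small ?E" using X(2) small_set[OF a] by (rule small_Un)
  then have E: "?E \<subseteq> univ U" "|?E| <o \<kappa>" by (simp_all add: small_subset_def)
  have "|Func I ?E| \<le>o |Pow (I \<times> ?E)|"
    unfolding card_of_ordLeq[symmetric]
  proof (intro exI conjI)
    show "inj_on (\<lambda>f. (\<lambda>i. (i, f i)) ` I) (Func I ?E)"
    proof (rule inj_onI)
      fix f f' assume f: "f \<in> Func I ?E" "f' \<in> Func I ?E" "(\<lambda>i. (i, f i)) ` I = (\<lambda>i. (i, f' i)) ` I"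
      have "f i = f' i" for i
      proof (cases "i \<in> I")
        case True
        then have "(i, f i) \<in> (\<lambda>i. (i, f' i)) ` I" using f(3) by blast
        then show ?thesis by auto
      qed (use f in \<open>simp add: Func_def\<close>)
      then show "f = f'" by (rule ext)
    qed
    show "(\<lambda>f. (\<lambda>i. (i, f i)) ` I) ` Func I ?E \<subseteq> Pow (I \<times> ?E)" by (auto simp: Func_def)
  qed
  then have small: "|Func I ?E| <o \<kappa>" using less_Pow[OF less_Times[OF I E(2)]] by (rule ordLeq_ordLess_trans)
  obtain D where D: "ultrafilter I D" "(\<lambda>q. {i \<in> I. q \<in> i}) ` F \<subseteq> D"
  proof (rule ultrafilter_extend[of "(\<lambda>q. {i \<in> I. q \<in> i}) ` F" I])
    fix H assume "finite H" "H \<subseteq> (\<lambda>q. {i \<in> I. q \<in> i}) ` F"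
    then obtain J where J: "finite J" "J \<subseteq> F" "H = (\<lambda>q. {i \<in> I. q \<in> i}) ` J"
      by (rule finite_subset_image[elim_format]) auto
    then have "J \<in> I \<inter> \<Inter>H" by (auto simp: I_def)
    then show "I \<inter> \<Inter>H \<noteq> {}" by blast
  qed auto
  obtain h where h: "(\<forall>f\<in>Func I ?E. h f \<in> univ U) \<and>
    (\<forall>x\<in>?E. h (\<lambda>i. if i \<in> I then x else undefined) = x) \<and>
    (\<forall>fs\<in>lists (Func I ?E). \<forall>\<phi>\<in>fms L (length fs).
       holds U \<phi> (map h fs) \<longleftrightarrow> ev I D (\<lambda>i. holds U \<phi> (map (\<lambda>f. f i) fs)))"
    using embed_ultrapower[OF D(1) E(1) small] by (elim exE)
  define cst where "cst x = (\<lambda>i. if i \<in> I then x else undefined)" for x :: 'u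
  have hU: "h f \<in> univ U" if "f \<in> Func I ?E" for f using h that by blast
  have hcst: "h (cst x) = x" if "x \<in> ?E" for x using h that unfolding cst_def by blast
  have transfer: "holds U \<phi> (map h fs) \<longleftrightarrow> ev I D (\<lambda>i. holds U \<phi> (map (\<lambda>f. f i) fs))"
    if "fs \<in> lists (Func I ?E)" "\<phi> \<in> fms L (length fs)" for fs \<phi> using h that by blast
  have cstE: "cst x \<in> Func I ?E" if "x \<in> ?E" for x using that by (auto simp: cst_def Func_def)
  have cstX: "cst x \<in> Func I X" if "x \<in> X" for x using that by (auto simp: cst_def Func_def)
  have sub: "Func I X \<subseteq> Func I ?E" by (auto simp: Func_def)
  define Y where "Y = h ` Func I X"
  have YU: "Y \<subseteq> univ U" unfolding Y_def using hU sub by blast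
  have XY: "X \<subseteq> Y" unfolding Y_def using cstX hcst by force
  \<comment> \<open>The theorem of Los for pair formulas, with \<open>h\<close> in place of the
    quotient map. The existential case picks witnesses coordinatewise, with default
    \<open>x0\<close>.\<close>
  have los: "range w \<subseteq> Func I X \<Longrightarrow> sat (PS Y) (\<lambda>j. h (w j)) \<chi> \<longleftrightarrow> ev I D (\<lambda>i. sat (PS X) (\<lambda>j. w j i) \<chi>)"
    if "wf_fm PL \<chi>" for \<chi> w
    using that
  proof (induction \<chi> arbitrary: w)
    case (Eq s t)
    then obtain j j' where st: "s = Var j" "t = Var j'" by (auto simp: wf_tm_pair_lang)
    have "w j \<in> Func I ?E" "w j' \<in> Func I ?E" using Eq.prems(1) sub by auto
    then have "holds U (Eq (Var 0) (Var 1)) (map h [w j, w j']) \<longleftrightarrow>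
        ev I D (\<lambda>i. holds U (Eq (Var 0) (Var 1)) (map (\<lambda>f. f i) [w j, w j']))"
      by (intro transfer) (auto simp: fms_def)
    then show ?case by (simp add: st holds_def)
  next
    case (Rel r ts)
    then obtain k \<phi> "is" where r: "r = (k, \<phi>)" "\<phi> \<in> fms L (k + n)" "ts = map Var is" "length is = k"
      unfolding wf_Rel_pair_lang by blast
    have w: "w j \<in> Func I X" for j using Rel.prems(1) by auto
    have w': "w j \<in> Func I ?E" for j using w sub by blast
    have "sat (PS Y) (\<lambda>j. h (w j)) (Rel r ts) \<longleftrightarrow> holds U \<phi> (map (\<lambda>j. h (w j)) is @ a)"
      unfolding r(1,3) by (rule sat_PS_Rel) (use w r(4) in \<open>auto simp: Y_def\<close>)
    also have "map (\<lambda>j. h (w j)) is @ a = map h (map w is @ map cst a)"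
      using hcst by (simp add: comp_def map_idI)
    also have "holds U \<phi> (map h (map w is @ map cst a)) \<longleftrightarrow>
        ev I D (\<lambda>i. holds U \<phi> (map (\<lambda>f. f i) (map w is @ map cst a)))"
      by (rule transfer) (use w' cstE r(2,4) a in \<open>auto simp: tuples_def\<close>)
    also have "\<dots> \<longleftrightarrow> ev I D (\<lambda>i. sat (PS X) (\<lambda>j. w j i) (Rel r ts))"
    proof (rule ev_cong)
      fix i assume i: "i \<in> I"
      have "map (\<lambda>f. f i) (map w is @ map cst a) = map (\<lambda>j. w j i) is @ a"
        using i by (simp add: comp_def cst_def)
      moreover have "sat (PS X) (\<lambda>j. w j i) (Rel r ts) \<longleftrightarrow> holds U \<phi> (map (\<lambda>j. w j i) is @ a)"
        unfolding r(1,3) by (rule sat_PS_Rel) (use w i r(4) in \<open>auto simp: Func_def\<close>)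
      ultimately show "holds U \<phi> (map (\<lambda>f. f i) (map w is @ map cst a)) \<longleftrightarrow> sat (PS X) (\<lambda>j. w j i) (Rel r ts)"
        by (simp only:)
    qed
    finally show ?case .
  next
    case (Neg \<chi>)
    then show ?case by (simp add: ev_not[OF D(1)])
  next
    case (Conj \<chi> \<psi>)
    then show ?case by (simp add: ev_conj[OF D(1)])
  next
    case (Exists \<chi>)
    have wf: "wf_fm PL \<chi>" using Exists.prems(2) by simp
    have IH: "sat (PS Y) (case_nat (h f) (\<lambda>j. h (w j))) \<chi> \<longleftrightarrow> ev I D (\<lambda>i. sat (PS X) (case_nat (f i) (\<lambda>j. w j i)) \<chi>)"
      if f: "f \<in> Func I X" for f
    proof -
      have "range (case_nat f w) \<subseteq> Func I X" using f Exists.prems(1)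
        by (auto split: nat.splits simp: image_subset_iff)
      from Exists.IH[OF this wf]
      have "sat (PS Y) (\<lambda>j. h (case_nat f w j)) \<chi> \<longleftrightarrow> ev I D (\<lambda>i. sat (PS X) (\<lambda>j. case_nat f w j i) \<chi>)" .
      moreover have "(\<lambda>j. h (case_nat f w j)) = case_nat (h f) (\<lambda>j. h (w j))"
        "(\<lambda>j. case_nat f w j i) = case_nat (f i) (\<lambda>j. w j i)" for i
        by (auto simp: fun_eq_iff split: nat.split)
      ultimately show ?thesis by simp
    qed
    show ?case
    proof
      assume "sat (PS Y) (\<lambda>j. h (w j)) (Exists \<chi>)"
      then obtain f where f: "f \<in> Func I X" "sat (PS Y) (case_nat (h f) (\<lambda>j. h (w j))) \<chi>"
        by (auto simp: Y_def)
      then have "ev I D (\<lambda>i. sat (PS X) (case_nat (f i) (\<lambda>j. w j i)) \<chi>)" using IH by blast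
      then show "ev I D (\<lambda>i. sat (PS X) (\<lambda>j. w j i) (Exists \<chi>))"
        by (rule ev_mono[OF D(1)]) (use f(1) in \<open>auto simp: Func_def\<close>)
    next
      assume e: "ev I D (\<lambda>i. sat (PS X) (\<lambda>j. w j i) (Exists \<chi>))"
      define c where "c i = (if \<exists>u\<in>X. sat (PS X) (case_nat u (\<lambda>j. w j i)) \<chi>
          then SOME u. u \<in> X \<and> sat (PS X) (case_nat u (\<lambda>j. w j i)) \<chi> else x0)" for i
      have c: "c i \<in> X \<and> ((\<exists>u\<in>X. sat (PS X) (case_nat u (\<lambda>j. w j i)) \<chi>) \<longrightarrow> sat (PS X) (case_nat (c i) (\<lambda>j. w j i)) \<chi>)" for i
      proof (cases "\<exists>u\<in>X. sat (PS X) (case_nat u (\<lambda>j. w j i)) \<chi>")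
        case True
        then have "\<exists>u. u \<in> X \<and> sat (PS X) (case_nat u (\<lambda>j. w j i)) \<chi>" by blast
        from someI_ex[OF this] True show ?thesis by (simp add: c_def)
      qed (use x0 in \<open>simp add: c_def\<close>)
      define f where "f i = (if i \<in> I then c i else undefined)" for i
      have f: "f \<in> Func I X" using c by (auto simp: f_def Func_def)
      have "ev I D (\<lambda>i. sat (PS X) (case_nat (f i) (\<lambda>j. w j i)) \<chi>)"
        by (rule ev_mono[OF D(1) e]) (use c in \<open>simp add: f_def\<close>)
      then have "sat (PS Y) (case_nat (h f) (\<lambda>j. h (w j))) \<chi>" using IH[OF f] by blast
      then show "sat (PS Y) (\<lambda>j. h (w j)) (Exists \<chi>)" using f by (auto simp: Y_def)
    qed
  qed
  have "le X Y"
    unfolding le_def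
  proof (intro conjI allI impI)
    fix \<chi> and v :: "nat \<Rightarrow> 'u" assume \<chi>: "wf_fm PL \<chi>" and v: "range v \<subseteq> X"
    have "sat (PS Y) (\<lambda>j. h (cst (v j))) \<chi> \<longleftrightarrow> ev I D (\<lambda>i. sat (PS X) (\<lambda>j. cst (v j) i) \<chi>)"
      by (rule los[OF \<chi>]) (use cstX v in auto)
    moreover have "(\<lambda>j. h (cst (v j))) = v" using hcst v by (auto simp: fun_eq_iff)
    moreover have "ev I D (\<lambda>i. sat (PS X) (\<lambda>j. cst (v j) i) \<chi>) \<longleftrightarrow> ev I D (\<lambda>i. sat (PS X) v \<chi>)"
      by (rule ev_cong) (simp add: cst_def)
    ultimately show "sat (PS X) v \<chi> \<longleftrightarrow> sat (PS Y) v \<chi>" using ev_const[OF D(1)] by simp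
  qed (use X(1) XY in auto)
  moreover have "realized_in Y k t" if t: "t \<subseteq> formulas_over PL k X" "fin_sat X k t" for k t
  proof -
    define ch where "ch i = (SOME x. x \<in> tuples X k \<and> (\<forall>(\<chi>, b)\<in>t \<inter> i. holds (PS X) \<chi> (x @ b)))" for i
    have ch: "ch i \<in> tuples X k \<and> (\<forall>(\<chi>, b)\<in>t \<inter> i. holds (PS X) \<chi> (ch i @ b))" if "i \<in> I" for i
      unfolding ch_def
    proof (rule someI_ex)
      have "finite (t \<inter> i)" using that by (simp add: I_def)
      then show "\<exists>x. x \<in> tuples X k \<and> (\<forall>(\<chi>, b)\<in>t \<inter> i. holds (PS X) \<chi> (x @ b))"
        using t(2) unfolding fin_sat_def by (meson inf_le1)
    qed
    define f where "f l = (\<lambda>i. if i \<in> I then ch i ! l else undefined)" for l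
    have f: "f l \<in> Func I X" if "l < k" for l
    proof -
      have "ch i ! l \<in> X" if "i \<in> I" for i
      proof -
        have "length (ch i) = k" "set (ch i) \<subseteq> X" using ch[OF that] by (simp_all add: tuples_def)
        then show ?thesis using \<open>l < k\<close> nth_mem[of l "ch i"] by blast
      qed
      then show ?thesis by (auto simp: f_def Func_def)
    qed
    let ?y = "map (\<lambda>l. h (f l)) [0..<k]"
    have y: "?y \<in> tuples Y k" using f by (auto simp: tuples_def Y_def)
    have "holds (PS Y) \<chi> (?y @ b)" if \<chi>: "(\<chi>, b) \<in> t" for \<chi> b
    proof -
      have fm: "\<chi> \<in> fms PL (k + length b)" "b \<in> lists X" using t(1) \<chi> by (auto simp: formulas_over_def)
      \<comment> \<open>The coordinates of the solution, then the parameters as constants; beyond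
        these any function into \<open>X\<close> will do.\<close>
      define w where "w j = (if j < k then f j else if j < k + length b then cst (b ! (j - k)) else cst x0)" for j
      have bX: "b ! j \<in> X" if "j < length b" for j using fm(2) that by auto
      have w: "range w \<subseteq> Func I X" using f cstX bX x0 by (auto simp: w_def)
      have "holds (PS Y) \<chi> (?y @ b) \<longleftrightarrow> sat (PS Y) (\<lambda>j. h (w j)) \<chi>"
        by (rule sat_list) (use fm(1) bX hcst in \<open>auto simp: w_def nth_append\<close>)
      moreover have "ev I D (\<lambda>i. sat (PS X) (\<lambda>j. w j i) \<chi>)"
      proof (rule ev_mono[OF D(1)])
        have "(\<chi>, b) \<in> F" using fm by (simp add: F_def fms_def)
        then show "ev I D (\<lambda>i. (\<chi>, b) \<in> i)" using D(2) by (auto simp: ev_def)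
        fix i assume i: "i \<in> I" "(\<chi>, b) \<in> i"
        have "holds (PS X) \<chi> (ch i @ b)" using ch[OF i(1)] \<chi> i(2) by blast
        moreover have "holds (PS X) \<chi> (ch i @ b) \<longleftrightarrow> sat (PS X) (\<lambda>j. w j i) \<chi>"
          by (rule sat_list) (use fm(1) ch[OF i(1)] i(1) in \<open>auto simp: w_def f_def cst_def nth_append tuples_def\<close>)
        ultimately show "sat (PS X) (\<lambda>j. w j i) \<chi>" by simp
      qed
      ultimately show ?thesis using los[OF _ w, of \<chi>] fm(1) by (simp add: fms_def)
    qed
    then show ?thesis unfolding realized_in_def using y by blast
  qed
  ultimately show ?thesis using YU by blast
qed

text \<open>Sets \<open>t\<close> of size at most |Z| number at most 2 to |Z|. One realization of
  each can therefore be kept while the rest of the ultrapower is cut away, and the size bound is the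
  same before and after the step.\<close>

lemma saturation_step:
  assumes X: "X \<noteq> {}" "small X" "|X| \<le>o |Pow Z|" and Z: "infinite Z" "|Fm L| \<le>o |Z|"
  shows "\<exists>Y. Y \<subseteq> univ U \<and> |Y| \<le>o |Pow Z| \<and> le X Y \<and>
    (\<forall>k t. t \<subseteq> formulas_over PL k X \<longrightarrow> |t| \<le>o |Z| \<longrightarrow> fin_sat X k t \<longrightarrow> realized_in Y k t)"
proof -
  have PZ: "infinite (Pow Z)" "|Z| \<le>o |Pow Z|"
    using Z(1) ordLess_imp_ordLeq[OF card_of_Pow[of Z]] by (simp_all add: finite_Pow_iff)
  have "|Fm PL| \<le>o |Z|" by (rule card_pair_formulas[OF Z])
  then have W: "|Fm PL| \<le>o |Pow Z|" using PZ(2) by (rule ordLeq_transitive)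
  obtain Y where Y: "Y \<subseteq> univ U \<and> le X Y \<and>
    (\<forall>k t. t \<subseteq> formulas_over PL k X \<longrightarrow> fin_sat X k t \<longrightarrow> realized_in Y k t)"
    using ultrapower_extension[OF X(1,2)] by (elim exE)
  define F where "F = Fm PL \<times> lists X"
  have F: "|F| \<le>o |Pow Z|" unfolding F_def by (intro card_Times_le card_lists PZ(1) W X(3))
  have over: "formulas_over PL k X \<subseteq> F" for k by (auto simp: formulas_over_def F_def fms_def)
  define T where "T = {(k, t). t \<subseteq> formulas_over PL k X \<and> |t| \<le>o |Z| \<and> fin_sat X k t}"
  have "T \<subseteq> (UNIV :: nat set) \<times> {t. t \<subseteq> F \<and> |t| \<le>o |Z|}" using over unfolding T_def by blast
  then have "|T| \<le>o |(UNIV :: nat set) \<times> {t. t \<subseteq> F \<and> |t| \<le>o |Z|}|" by (rule card_of_mono1)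
  also have "|(UNIV :: nat set) \<times> {t. t \<subseteq> F \<and> |t| \<le>o |Z|}| \<le>o |Pow Z|"
    by (intro card_Times_le PZ(1) nat_ordLeq_infinite card_bounded_subsets Z(1) F)
  finally have T: "|T| \<le>o |Pow Z|" .
  have "\<forall>i\<in>T. \<exists>y. y \<in> tuples Y (fst i) \<and> (\<forall>(\<chi>, b)\<in>snd i. holds (PS Y) \<chi> (y @ b))"
  proof
    fix i assume "i \<in> T"
    then obtain k t where i: "i = (k, t)" "t \<subseteq> formulas_over PL k X" "fin_sat X k t" by (auto simp: T_def)
    then have "realized_in Y k t" using Y by simp
    then show "\<exists>y. y \<in> tuples Y (fst i) \<and> (\<forall>(\<chi>, b)\<in>snd i. holds (PS Y) \<chi> (y @ b))"
      unfolding realized_in_def i(1) fst_conv snd_conv by (elim bexE) (rule exI, rule conjI)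
  qed
  from bchoice[OF this] obtain y where y: "\<forall>i\<in>T. y i \<in> tuples Y (fst i) \<and> (\<forall>(\<chi>, b)\<in>snd i. holds (PS Y) \<chi> (y i @ b))"
    by (elim exE)
  let ?S = "X \<union> (\<Union>i\<in>T. set (y i))"
  have "|\<Union>i\<in>T. set (y i)| \<le>o |Pow Z|"
    by (rule card_of_UNION_ordLeq_infinite[OF PZ(1) T]) (use finite_ordLeq[OF PZ(1)] in blast)
  then have S: "|?S| \<le>o |Pow Z|" by (intro card_Un_le PZ(1) X(3))
  have XY: "le X Y" "X \<subseteq> Y" using Y le_sub by blast+
  have SY: "?S \<subseteq> Y" using XY(2) y by (auto simp: tuples_def)
  have "Y \<noteq> {}" using XY(2) X(1) by blast
  from loewenheim_skolem[OF PZ(1) W SY S this]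
  obtain X' where X': "?S \<subseteq> X' \<and> |X'| \<le>o |Pow Z| \<and> le X' Y" by (elim exE)
  then have le': "le X' Y" "X \<subseteq> X'" "X' \<subseteq> Y" using le_sub by auto
  have "realized_in X' k t" if t: "t \<subseteq> formulas_over PL k X" "|t| \<le>o |Z|" "fin_sat X k t" for k t
  proof -
    have i: "(k, t) \<in> T" using t by (simp add: T_def)
    then have yk: "y (k, t) \<in> tuples X' k" using y X' by (auto simp: tuples_def)
    have "holds (PS X') \<chi> (y (k, t) @ b)" if "(\<chi>, b) \<in> t" for \<chi> b
    proof -
      have fm: "\<chi> \<in> fms PL (k + length b)" "b \<in> lists X" using t(1) that by (auto simp: formulas_over_def)
      have "\<forall>(\<chi>, b)\<in>t. holds (PS Y) \<chi> (y (k, t) @ b)" using y[rule_format, OF i] by simp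
      then have "holds (PS Y) \<chi> (y (k, t) @ b)" using that by blast
      moreover have "holds (PS X') \<chi> (y (k, t) @ b) \<longleftrightarrow> holds (PS Y) \<chi> (y (k, t) @ b)"
        by (rule le_holds[OF le'(1)]) (use fm yk le'(2) in \<open>auto simp: tuples_def\<close>)
      ultimately show ?thesis by (simp only:)
    qed
    then show ?thesis unfolding realized_in_def using yk by blast
  qed
  moreover have "le X X'" by (rule le_within[OF XY(1) le'(1,2)])
  ultimately show ?thesis using X' le'(3) Y by (intro exI[of _ X']) auto
qed

lemma is_struct_PS: "X \<noteq> {} \<Longrightarrow> is_struct PL (PS X)"
  by (simp add: is_struct_def pair_lang_def)

text \<open>The parameters of a type lie in one stage, and the type has at most |Z| formulas, so the
  next stage realizes it.\<close>

lemma saturated_extension: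
  assumes A: "A \<noteq> {}" "small A"
  shows "\<exists>A'. small A' \<and> elementary_ext PL (PS A) (PS A') \<and> saturated PL (cardSuc |A| ) (PS A')"
proof -
  define Z where "Z = A <+> Fm L"
  have Z: "infinite Z" "|Z| <o \<kappa>" "|A| \<le>o |Z|" "|Fm L| \<le>o |Z|"
    using pad[of A] A(2) unfolding Z_def small_subset_def by blast+
  have PZ: "infinite (Pow Z)" "|Pow Z| <o \<kappa>" "|Z| \<le>o |Pow Z|"
    using Z(1) less_Pow[OF Z(2)] ordLess_imp_ordLeq[OF card_of_Pow[of Z]] by (simp_all add: finite_Pow_iff)
  have sucZ: "cardSuc |Z| \<le>o |Pow Z|"
    by (rule cardSuc_least[OF card_of_Card_order card_of_Card_order card_of_Pow])
  define P where "P X \<longleftrightarrow> X \<noteq> {} \<and> X \<subseteq> univ U \<and> |X| \<le>o |Pow Z|" for X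
  define R where "R X Y \<longleftrightarrow> (\<forall>k t. t \<subseteq> formulas_over PL k X \<longrightarrow> |t| \<le>o |Z| \<longrightarrow> fin_sat X k t \<longrightarrow> realized_in Y k t)"
    for X Y
  have smP: "small X" if "P X" for X
    using that PZ(2) unfolding P_def small_subset_def by (blast intro: ordLeq_ordLess_trans)
  have "\<exists>W. P W \<and> le A W \<and> (\<forall>S\<subseteq>W. |S| \<le>o |Z| \<longrightarrow> (\<exists>X Y. S \<subseteq> X \<and> P X \<and> P Y \<and> R X Y \<and> le X Y \<and> le Y W))"
  proof (rule cardSuc_chain[OF Z(1)])
    show "P A" unfolding P_def using A ordLeq_transitive[OF Z(3) PZ(3)] by (simp add: small_subset_def)
    fix X assume X: "P X"
    then obtain Y where "Y \<subseteq> univ U \<and> |Y| \<le>o |Pow Z| \<and> le X Y \<and>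
      (\<forall>k t. t \<subseteq> formulas_over PL k X \<longrightarrow> |t| \<le>o |Z| \<longrightarrow> fin_sat X k t \<longrightarrow> realized_in Y k t)"
      using saturation_step[OF _ smP[OF X] _ Z(1,4)] unfolding P_def by blast
    then show "\<exists>Y. P Y \<and> le X Y \<and> R X Y"
      using X unfolding P_def R_def by (intro exI[of _ Y]) (auto dest: le_sub)
  next
    show "le X W" if "le X Y" "le Y W" for X Y W by (rule le_trans[OF that])
    show "X \<subseteq> Y" if "le X Y" for X Y by (rule le_sub[OF that])
    fix CC assume CC: "CC \<noteq> {}" "|CC| \<le>o cardSuc |Z|" "\<forall>X\<in>CC. P X"
      "\<forall>X\<in>CC. \<forall>Y\<in>CC. X = Y \<or> le X Y \<or> le Y X"
    have "|\<Union>X\<in>CC. X| \<le>o |Pow Z|"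
      by (rule card_of_UNION_ordLeq_infinite[OF PZ(1) ordLeq_transitive[OF CC(2) sucZ]])
        (use CC(3) in \<open>simp add: P_def\<close>)
    then have "P (\<Union>CC)" using CC(1,3) unfolding P_def by auto
    moreover have "le X (\<Union>CC)" if "X \<in> CC" for X
      by (rule le_Union[OF CC(1) _ CC(4) that]) (use CC(3) in \<open>simp add: P_def\<close>)
    ultimately show "P (\<Union>CC) \<and> (\<forall>X\<in>CC. le X (\<Union>CC))" by blast
  qed
  then obtain W where W: "P W \<and> le A W \<and> (\<forall>S\<subseteq>W. |S| \<le>o |Z| \<longrightarrow>
      (\<exists>X Y. S \<subseteq> X \<and> P X \<and> P Y \<and> R X Y \<and> le X Y \<and> le Y W))" by (elim exE)
  note WP = W[THEN conjunct1] and AW = W[THEN conjunct2, THEN conjunct1]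
    and WS = W[THEN conjunct2, THEN conjunct2, rule_format]
  have "elementary_ext PL (PS A) (PS W)"
    unfolding elementary_ext_def
  proof (intro conjI allI ballI)
    show "is_struct PL (PS A)" "is_struct PL (PS W)"
      using A(1) WP by (auto intro!: is_struct_PS simp: P_def)
    show "univ (PS A) \<subseteq> univ (PS W)" using le_sub[OF AW] by simp
    fix k \<chi> as assume "\<chi> \<in> fms PL k" "as \<in> tuples (univ (PS A)) k"
    then show "holds (PS A) \<chi> as \<longleftrightarrow> holds (PS W) \<chi> as"
      by (intro le_holds[OF AW]) (auto simp: tuples_def)
  qed
  moreover have "saturated PL (cardSuc |A| ) (PS W)"
    unfolding saturated_def
  proof (intro allI impI ballI)
    fix C k t assume C: "C \<subseteq> univ (PS W) \<and> |C| <o cardSuc |A|" and t: "t \<in> complete_types PL (PS W) k C"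
    have "|C| \<le>o |A|" using C cardSuc_ordLeq_ordLess[OF card_of_Card_order card_of_Card_order] by blast
    then have CZ: "|C| \<le>o |Z|" using Z(3) by (rule ordLeq_transitive)
    have CW: "C \<subseteq> W" using C by simp
    have tC: "t \<subseteq> formulas_over PL k C" using t by (simp add: complete_types_def)
    then have "|t| \<le>o |formulas_over PL k C|" by (rule card_of_mono1)
    also have "|formulas_over PL k C| \<le>o |Z|"
      by (rule card_formulas_over[OF Z(1) card_pair_formulas[OF Z(1,4)] CZ])
    finally have tZ: "|t| \<le>o |Z|" .
    from WS[OF CW CZ] obtain X Y where "C \<subseteq> X \<and> P X \<and> P Y \<and> R X Y \<and> le X Y \<and> le Y W" by (elim exE)
    then have XY: "C \<subseteq> X" "R X Y" "le X W" "le Y W" "X \<subseteq> Y" using le_trans le_sub by blast+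
    \<comment> \<open>The type is given as finitely satisfiable in \<open>W\<close>. Its parameters
      lie in \<open>X\<close>, so the existential closure of each finite conjunction descends to
      \<open>X\<close>.\<close>
    have "fin_sat X k t"
      unfolding fin_sat_def
    proof (intro allI impI)
      fix t0 assume t0: "finite t0" "t0 \<subseteq> t"
      then obtain x where x: "realizes (PS W) k x t0" using t unfolding complete_types_def by blast
      have t0C: "t0 \<subseteq> formulas_over PL k C" using t0(2) tC by blast
      from conj_over[OF t0(1) t0C] obtain \<chi> d where \<chi>: "(\<chi>, d) \<in> formulas_over PL k C"
        "\<forall>(N :: ('f, nat \<times> ('f, 'r) fm, 'u) fo_struct) x. length x = k \<longrightarrow>
          (holds N \<chi> (x @ d) \<longleftrightarrow> (\<forall>(\<phi>, b)\<in>t0. holds N \<phi> (x @ b)))" by blast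
      have "x \<in> tuples W k" "holds (PS W) \<chi> (x @ d)"
        using x \<chi>(2) by (auto simp: realizes_def tuples_def)
      then have "holds (PS W) ((Exists ^^ k) \<chi>) d" unfolding holds_Exists_power by auto
      moreover have "holds (PS X) ((Exists ^^ k) \<chi>) d \<longleftrightarrow> holds (PS W) ((Exists ^^ k) \<chi>) d"
        by (rule le_holds[OF XY(3)]) (use \<chi>(1) XY(1) in \<open>auto simp: formulas_over_def fms_Exists_power\<close>)
      ultimately obtain x' where x': "x' \<in> tuples X k" "holds (PS X) \<chi> (x' @ d)"
        unfolding holds_Exists_power by auto
      then show "\<exists>x\<in>tuples X k. \<forall>(\<chi>, b)\<in>t0. holds (PS X) \<chi> (x @ b)"
        using \<chi>(2) tuples_length[OF x'(1)] by (intro bexI[of _ x']) auto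
    qed
    moreover have "t \<subseteq> formulas_over PL k X" using tC XY(1) by (fastforce simp: formulas_over_def)
    ultimately obtain y where y: "y \<in> tuples Y k" "\<forall>(\<chi>, b)\<in>t. holds (PS Y) \<chi> (y @ b)"
      using XY(2) tZ unfolding R_def realized_in_def by blast
    have "realizes (PS W) k y t"
      unfolding realizes_def
    proof (intro conjI ballI)
      show "y \<in> tuples (univ (PS W)) k" using y(1) le_sub[OF XY(4)] by (auto simp: tuples_def)
      fix q assume q: "q \<in> t"
      obtain \<chi> b where cb: "q = (\<chi>, b)" by force
      have "\<chi> \<in> fms PL (k + length b)" "b \<in> lists C" using q tC by (auto simp: cb formulas_over_def)
      then have "holds (PS Y) \<chi> (y @ b) \<longleftrightarrow> holds (PS W) \<chi> (y @ b)"
        using y(1) XY(1,5) by (intro le_holds[OF XY(4)]) (auto simp: tuples_def)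
      then show "case q of (\<chi>, b) \<Rightarrow> holds (PS W) \<chi> (y @ b)" using y(2) q by (auto simp: cb)
    qed
    then show "\<exists>y. realizes (PS W) k y t" by blast
  qed
  ultimately show ?thesis using smP[OF WP] by blast
qed

end

section \<open>From uniform decisions to compressibility\<close>

context ordered begin

text \<open>That \<open>\<zeta>(x;e)\<close> decides \<open>\<phi>(x;b)\<close> as \<open>a\<close>
  does is a first-order condition on \<open>e\<close>, \<open>b\<close> and \<open>a\<close>, hence
  an atomic predicate of the pair language. The resulting set of conditions on \<open>e\<close>, for
  all \<open>b\<close> in \<open>B\<close>, is finitely satisfiable in \<open>B\<close>.\<close>

lemma compressible_if_uniform:
  assumes B: "small B" "B \<noteq> {}" and a: "a \<in> V n"
    and unif: "uniformly_decided B a"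
  shows "compressible_tp L \<kappa> U a B"
proof -
  interpret paired L U \<kappa> n a by unfold_locales (fact a)
  have len: "length a = n" using a by (simp add: tuples_def)
  obtain A where A: "small A \<and> elementary_ext PL (PS B) (PS A) \<and> Defs.saturated PL (cardSuc |B| ) (PS A)"
    using saturated_extension[OF B(2,1)] by (elim exE)
  then have BA: "B \<subseteq> A" by (simp add: elementary_ext_def)
  have AU: "A \<subseteq> univ U" using A by (simp add: small_subset_def)
  have "\<exists>(\<zeta>, e)\<in>tp L U a A. entails_tp_fm U \<zeta> e \<phi> m a B" if \<phi>: "\<phi> \<in> fms L (n + m)" for m \<phi>
  proof -
    obtain k \<zeta> where \<zeta>: "\<zeta> \<in> fms L (n + k)" and u: "\<And>A0. finite A0 \<Longrightarrow> A0 \<subseteq> tuples B m \<Longrightarrow>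
      \<exists>e\<in>tuples B k. holds U \<zeta> (a @ e) \<and>
        (\<forall>x\<in>V n. holds U \<zeta> (x @ e) \<longrightarrow> (\<forall>b\<in>A0. holds U \<phi> (x @ b) \<longleftrightarrow> holds U \<phi> (a @ b)))"
      using unif[unfolded uniformly_decided_def decided_by_def, rule_format, OF \<phi>] by blast
    \<comment> \<open>Truth of \<open>\<zeta>\<close> at \<open>c\<close> is built into the
      relation, so that the \<open>e\<close> found by saturation gives a formula in the type of
      \<open>a\<close>.\<close>
    define E where "E e b c \<longleftrightarrow> holds U \<zeta> (c @ e) \<and>
      (\<forall>x\<in>V n. holds U \<zeta> (x @ e) \<longrightarrow> (holds U \<phi> (x @ b) \<longleftrightarrow> holds U \<phi> (c @ b)))" for e b c
    have "pd {} (k + m + n) (\<lambda>z. holds U \<zeta> (drop (k + m) z @ take k z))"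
      by (rule pd_holds[OF \<zeta>]) (auto intro!: sel_intros)
    moreover have "pd {} (n + (k + m + n)) (\<lambda>z. holds U \<zeta> (take n z @ take k (drop n z)))"
      by (rule pd_holds[OF \<zeta>]) (auto intro!: sel_intros)
    moreover have "pd {} (n + (k + m + n)) (\<lambda>z. holds U \<phi> (take n z @ take m (drop k (drop n z))))"
      by (rule pd_holds[OF \<phi>]) (auto intro!: sel_intros)
    moreover have "pd {} (n + (k + m + n)) (\<lambda>z. holds U \<phi> (drop (k + m) (drop n z) @ take m (drop k (drop n z))))"
      by (rule pd_holds[OF \<phi>]) (auto intro!: sel_intros)
    ultimately have "pd {} (k + m + n) (\<lambda>z. E (take k z) (take m (drop k z)) (drop (k + m) z))"
      unfolding E_def by (intro pd_conj pd_all pd_imp pd_iff)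
    then obtain \<delta> d where \<delta>: "d \<in> lists {}" "\<delta> \<in> fms L (k + m + n + length d)"
      "\<And>z. z \<in> V (k + m + n) \<Longrightarrow> E (take k z) (take m (drop k z)) (drop (k + m) z) \<longleftrightarrow> holds U \<delta> (z @ d)"
      by (rule pdE) auto
    have d: "d = []" using \<delta>(1) by simp
    let ?R = "Rel (k + m, \<delta>) (map Var [0..<k + m]) :: ('f, nat \<times> ('f, 'r) fm) fm"
    have R: "?R \<in> fms PL (k + m)"
    proof -
      have "wf_fm PL ?R"
        unfolding wf_Rel_pair_lang
        by (intro exI[of _ "k + m"] exI[of _ \<delta>] exI[of _ "[0..<k + m]"]) (use \<delta>(2) d in simp)
      moreover have "fv ?R \<subseteq> {..<k + m}" by auto
      ultimately show ?thesis unfolding fms_def by blast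
    qed
    have sat_R: "holds (PS A) ?R (e @ b) \<longleftrightarrow> E e b a" if eb: "e \<in> tuples A k" "b \<in> tuples A m" for e b
    proof -
      have l: "length e = k" "length b = m" "set (e @ b) \<subseteq> A" using eb by (auto simp: tuples_def)
      have "holds (PS A) ?R (e @ b) \<longleftrightarrow> holds U \<delta> (map (\<lambda>i. (e @ b) ! i) [0..<k + m] @ a)"
        unfolding holds_def[of "PS A"]
      proof (rule sat_PS_Rel)
        show "(e @ b) ! i \<in> A" if "i \<in> set [0..<k + m]" for i
        proof -
          have "i < length (e @ b)" using that l by simp
          from nth_mem[OF this] l(3) show ?thesis by (rule subsetD[rotated])
        qed
      qed simp
      also have "map (\<lambda>i. (e @ b) ! i) [0..<k + m] = e @ b"
        using map_nth[of "e @ b"] l(1,2) by simp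
      finally have "holds (PS A) ?R (e @ b) \<longleftrightarrow> holds U \<delta> (e @ b @ a)" by simp
      moreover have "e @ b @ a \<in> V (k + m + n)" using l len AU a by (auto simp: tuples_def)
      ultimately show ?thesis using \<delta>(3)[of "e @ b @ a"] l(1,2) d by simp
    qed
    let ?t = "(\<lambda>b. (?R, b)) ` tuples B m"
    have tover: "?t \<subseteq> formulas_over PL k B" using R by (auto simp: formulas_over_def tuples_def)
    interpret PA: fo PL "PS A" .
    have "\<exists>q\<in>complete_types PL (PS A) k B. ?t \<subseteq> q"
    proof (rule PA.complete_extension[OF tover])
      fix t0 assume "finite t0" "t0 \<subseteq> ?t"
      then obtain A0 where A0: "finite A0" "A0 \<subseteq> tuples B m" "t0 = (\<lambda>b. (?R, b)) ` A0"
        by (rule finite_subset_image[elim_format]) auto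
      obtain e where e: "e \<in> tuples B k" "holds U \<zeta> (a @ e)"
        "\<forall>x\<in>V n. holds U \<zeta> (x @ e) \<longrightarrow> (\<forall>b\<in>A0. holds U \<phi> (x @ b) \<longleftrightarrow> holds U \<phi> (a @ b))"
        using u[OF A0(1,2)] by blast
      have eA: "e \<in> tuples A k" using e(1) tuples_mono[OF BA] by blast
      have "holds (PS A) ?R (e @ b)" if "b \<in> A0" for b
      proof -
        have "b \<in> tuples A m" using that A0(2) tuples_mono[OF BA] by blast
        moreover have "E e b a" using e(2,3) that unfolding E_def by blast
        ultimately show ?thesis using sat_R[OF eA] by blast
      qed
      then have "realizes (PS A) k e t0" using eA unfolding realizes_def A0(3) by auto
      then show "\<exists>e. realizes (PS A) k e t0" by blast
    qed
    then obtain q where q: "q \<in> complete_types PL (PS A) k B" "?t \<subseteq> q" by blast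
    have "|B| <o cardSuc |B|" by (rule cardSuc_greater[OF card_of_Card_order])
    moreover have "B \<subseteq> univ (PS A)" using BA by simp
    ultimately obtain e where "realizes (PS A) k e q"
      using A q(1) unfolding saturated_def by blast
    then have e: "e \<in> tuples A k" "\<forall>b\<in>tuples B m. holds (PS A) ?R (e @ b)"
      using q(2) by (auto simp: realizes_def)
    have Eb: "E e b a" if "b \<in> tuples B m" for b
    proof -
      have "b \<in> tuples A m" using that tuples_mono[OF BA] by blast
      then show ?thesis using sat_R[OF e(1)] e(2) that by blast
    qed
    \<comment> \<open>Truth of \<open>\<zeta>\<close> at \<open>a\<close> is a conjunct of every
      condition; one tuple of \<open>B\<close>, hence a nonempty \<open>B\<close>, suffices to
      extract it.\<close>
    obtain y where "y \<in> B" using B(2) by blast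
    then have "replicate m y \<in> tuples B m" by (auto simp: tuples_def)
    from Eb[OF this] have "holds U \<zeta> (a @ e)" by (simp add: E_def)
    then have "(\<zeta>, e) \<in> tp L U a A"
      using \<zeta> e(1) len by (auto simp: tp_def formulas_over_def tuples_def)
    moreover have "entails_tp_fm U \<zeta> e \<phi> m a B"
      unfolding entails_tp_fm_def len using Eb unfolding E_def by blast
    ultimately show ?thesis by blast
  qed
  then show ?thesis unfolding compressible_tp_def len using A by blast
qed

end

section \<open>The compressible extension\<close>

theorem theorem4p14:
  fixes L :: "('f, 'r) lang" and T :: "('f, 'r) fm set" and \<kappa> :: "'k rel"
    and U :: "('f, 'r, 'u) fo_struct" and M :: "'u set" and n :: nat
    and p :: "(('f, 'r) fm \<times> 'u list) set"
  assumes "complete_theory L T" and "monster_model L T \<kappa> U" and "NIP L U"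
    and "small_subset \<kappa> U M" and "elementary_substructure L M U"
    and "p \<in> complete_types L U n M" and "\<not> stable_type L U n p"
  shows "\<exists>B q. small_subset \<kappa> U B \<and> M \<subseteq> B \<and> q \<in> complete_types L U n B \<and> p \<subseteq> q \<and>
           \<not> (\<exists>b\<in>tuples B n. realizes U n b q) \<and> compressible L \<kappa> U n B q"
proof -
  interpret monster L U \<kappa>
    using assms(2) by unfold_locales (simp_all add: monster_model_def models_def)
  have p: "p \<subseteq> formulas_over L n M" using assms(6) by (simp add: complete_types_def)
  obtain C lt where ord: "finite C" "C \<subseteq> univ U" "pd C (n + n) (\<lambda>z. lt (take n z) (drop n z))"
    "\<And>x. \<not> lt x x" "trans_lt (V n) lt"
    "\<And>p0. finite p0 \<Longrightarrow> p0 \<subseteq> p \<Longrightarrow> big (V n) lt (\<lambda>x. \<forall>(\<theta>, d)\<in>p0. holds U \<theta> (x @ d))"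
    by (rule order_exists[OF assms(3,4) p assms(7)]) blast
  interpret ordered L U \<kappa> n C lt
    by unfold_locales (fact assms(3) ord)+
  have "large (inst ` p)"
    unfolding large_def
  proof (intro allI impI)
    fix H assume "finite H" "H \<subseteq> inst ` p"
    then obtain p0 where p0: "finite p0" "p0 \<subseteq> p" "H = inst ` p0"
      by (rule finite_subset_image[elim_format]) auto
    from ord(6)[OF p0(1,2)] show "Big (\<lambda>x. \<forall>P\<in>H. P x)"
      by (rule big_mono) (auto simp: p0(3) inst_def)
  qed
  from uniform_type[OF assms(4) p this] obtain B a where *: "small B \<and> M \<subseteq> B \<and> C \<subseteq> B \<and> a \<in> V n \<and>
    large (tpp a B) \<and> (\<forall>q\<in>p. inst q a) \<and>
    uniformly_decided B a"
    by (elim exE)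
  then have B: "small B" "M \<subseteq> B" and a: "a \<in> V n" "large (tpp a B)" "\<And>q. q \<in> p \<Longrightarrow> inst q a" by simp_all
  have "M \<noteq> {}"
    using assms(5) by (simp add: elementary_substructure_def elementary_ext_def is_struct_def)
  then have "B \<noteq> {}" using B(2) by blast
  then have comp: "compressible_tp L \<kappa> U a B"
    using * by (intro compressible_if_uniform[OF B(1) _ a(1)]) simp_all
  have len: "length a = n" using a(1) by (simp add: tuples_def)
  have real: "realizes U n a (tp L U a B)"
    using a(1) by (auto simp: realizes_def tp_def)
  have "tp L U a B \<in> complete_types L U n B"
    unfolding complete_types_def
  proof (intro CollectI conjI allI impI ballI)
    show "tp L U a B \<subseteq> formulas_over L n B" by (auto simp: tp_def len)
    show "\<exists>b. realizes U n b p0" if "finite p0 \<and> p0 \<subseteq> tp L U a B" for p0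
      using real that unfolding realizes_def by blast
    show "case q of (\<phi>, b) \<Rightarrow> (\<phi>, b) \<in> tp L U a B \<or> (Neg \<phi>, b) \<in> tp L U a B"
      if "q \<in> formulas_over L n B" for q
      using that by (auto simp: tp_def len formulas_over_def)
  qed
  moreover have "p \<subseteq> tp L U a B"
  proof
    fix q assume q: "q \<in> p"
    obtain \<phi> b where qb: "q = (\<phi>, b)" by force
    then have "(\<phi>, b) \<in> formulas_over L n M" "holds U \<phi> (a @ b)"
      using q p a(3)[OF q] by (auto simp: inst_def)
    then show "q \<in> tp L U a B" using B(2) by (auto simp: qb tp_def len formulas_over_def)
  qed
  moreover have "\<not> realizes U n b (tp L U a B)" if b: "b \<in> tuples B n" for b
  proof
    assume r: "realizes U n b (tp L U a B)"
    have "a = b"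
    proof (rule ccontr)
      assume "a \<noteq> b"
      obtain \<phi> d where \<phi>: "(\<phi>, d) \<in> formulas_over L n B" "\<forall>x\<in>V n. x \<noteq> b \<longleftrightarrow> holds U \<phi> (x @ d)"
        using pd_not[OF pd_eq[OF b]] by (auto simp: pd_def)
      then have "(\<phi>, d) \<in> tp L U a B" using \<open>a \<noteq> b\<close> a(1) by (auto simp: tp_def len)
      then have "holds U \<phi> (b @ d)" "b \<in> V n" using r by (auto simp: realizes_def)
      then show False using \<phi>(2) by blast
    qed
    \<comment> \<open>Largeness now demands a chain of two elements inside the singleton of
      \<open>a\<close>, against irreflexivity.\<close>
    then have "(\<lambda>x. x = a) \<in> tpp a B" using pd_eq[OF b] by (simp add: tpp_def)
    then have "Big (\<lambda>x. \<forall>P\<in>{\<lambda>x. x = a}. P x)" by (intro largeD[OF a(2)]) simp_all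
    then have "Big (\<lambda>x. x = a)" by simp
    then have "\<exists>x\<in>V n. x = a \<and> Ht 1 (\<lambda>x. x = a) x" unfolding big_def by (rule spec)
    then show False using irrefl[of a] by auto
  qed
  moreover have "compressible L \<kappa> U n B (tp L U a B)"
    using a(1) comp unfolding compressible_def by blast
  ultimately show ?thesis using B by blast
qed

end
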